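(* If $V>1/2$, then the operator $L(V)$ has infinitely many spectral singularities and has a spectral singularity at infinity.
   Context: $L(V)$ is the operator $-y''+qy$ in $L_2(-\infty,\infty)$ with domain $W_2^2(-\infty,\infty)$ and $q(x)=(1+2V)e^{i2x}+(1-2V)e^{-i2x}$. For $t\in(-1,1]$, $L_t(V)$ is the operator generated in $L_2[0,\pi]$ by $-y''+qy$ and $y(\pi)=e^{i\pi t}y(0)$, $y'(\pi)=e^{i\pi t}y'(0)$; its eigenvalues (counting multiplicity) are numbered $\lambda_n(t)$, $n\in\mathbb N$, so that each $\lambda_n$ is continuous on $(-1,1]$. For $\lambda_n(t)$ simple, $\Psi_{n,t}$ and $\Psi^*_{n,t}$ are normalized eigenfunctions of $L_t(V)$ and $(L_t(V))^*$ corresponding to $\lambda_n(t)$ and $\overline{\lambda_n(t)}$, and $d_n(t)=(\Psi_{n,t},\Psi^*_{n,t})$ in $L_2[0,\pi]$. A point $\lambda\in\sigma(L(V))$ is a spectral singularity of $L(V)$ if there exist $n\in\mathbb N$ and a sequence $\{t_k\}\subset(-1,1]$ such that $\lambda_n(t_k)$ is a simple eigenvalue of $L_{t_k}(V)$ for each $k$, $\lambda_n(t_k)\to\lambda$ and $|d_n(t_k)|\to0$ as $k\to\infty$. $L(V)$ has a spectral singularity at infinity if there exist sequences $\{n_k\}\subset\mathbb N$ and $\{t_k\}\subset(-1,1]$ such that $\lambda_{n_k}(t_k)$ is a simple eigenvalue for each $k$, $|\lambda_{n_k}(t_k)|\to\infty$ and $|d_{n_k}(t_k)|\to0$ as $k\to\infty$.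 *)

theory Defs
  imports "HOL-Analysis.Analysis" "HOL-Library.Function_Algebras"
begin

section \<open>Unbounded operators in \<open>L\<^sub>2(S)\<close>, represented by their graphs\<close>

definition Ltwo :: "real set \<Rightarrow> (real \<Rightarrow> complex) set" where
  "Ltwo S = {f. f \<in> borel_measurable (lebesgue_on S) \<and>
                integrable (lebesgue_on S) (\<lambda>x. (cmod (f x))\<^sup>2)}"

definition Ltwo_inner :: "real set \<Rightarrow> (real \<Rightarrow> complex) \<Rightarrow> (real \<Rightarrow> complex) \<Rightarrow> complex" where
  "Ltwo_inner S f g = (LINT x|lebesgue_on S. f x * cnj (g x))"

definition Ltwo_norm :: "real set \<Rightarrow> (real \<Rightarrow> complex) \<Rightarrow> real" where
  "Ltwo_norm S f = sqrt (LINT x|lebesgue_on S. (cmod (f x))\<^sup>2)"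

text \<open>An operator \<open>T\<close> is the set of pairs \<open>(y, f)\<close> with \<open>T y = f\<close>. In the graphs
  \<open>L_line\<close> and \<open>L_bloch\<close> below each element of the domain occurs through one representative \<open>y\<close>
  (continuous on \<open>S\<close>, zero off \<open>S\<close>), while \<open>f\<close> runs through all functions representing the
  class of \<open>T y\<close>; hence relational composition is composition of operators, and uniqueness of
  \<open>y\<close> as a function is uniqueness in \<open>L\<^sub>2(S)\<close>. In \<open>adjoint_graph\<close> both components run through
  all representatives.\<close>

type_synonym graph = "((real \<Rightarrow> complex) \<times> (real \<Rightarrow> complex)) set"

definition shift :: "graph \<Rightarrow> complex \<Rightarrow> graph" where
  "shift T \<mu> = {(y, \<lambda>x. f x - \<mu> * y x) | y f. (y, f) \<in> T}"

definition adjoint_graph :: "real set \<Rightarrow> graph \<Rightarrow> graph" where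
  "adjoint_graph S T = {(g, h). g \<in> Ltwo S \<and> h \<in> Ltwo S \<and>
     (\<forall>(y, f) \<in> T. Ltwo_inner S f g = Ltwo_inner S y h)}"

definition resolvent_set :: "real set \<Rightarrow> graph \<Rightarrow> complex set" where
  "resolvent_set S T = {\<mu>. (\<forall>f \<in> Ltwo S. \<exists>!y. (y, f) \<in> shift T \<mu>) \<and>
     (\<exists>C. \<forall>(y, f) \<in> shift T \<mu>. Ltwo_norm S y \<le> C * Ltwo_norm S f)}"

definition spectrum_of :: "real set \<Rightarrow> graph \<Rightarrow> complex set" where
  "spectrum_of S T = - resolvent_set S T"

definition normalized_eigenfunction ::
    "real set \<Rightarrow> graph \<Rightarrow> complex \<Rightarrow> (real \<Rightarrow> complex) \<Rightarrow> bool" where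
  "normalized_eigenfunction S T \<mu> y \<longleftrightarrow> (y, \<lambda>x. \<mu> * y x) \<in> T \<and> Ltwo_norm S y = 1"

definition root_space :: "graph \<Rightarrow> complex \<Rightarrow> (real \<Rightarrow> complex) set" where
  "root_space T \<mu> = {y. \<exists>k. (y, \<lambda>_. 0) \<in> (shift T \<mu>) ^^ k}"

interpretation cfun: vector_space "\<lambda>(c::complex) (f::real \<Rightarrow> complex) x. c * f x"
  by unfold_locales (auto simp: fun_eq_iff algebra_simps)

definition algebraic_multiplicity :: "graph \<Rightarrow> complex \<Rightarrow> nat" where
  "algebraic_multiplicity T \<mu> = cfun.dim (root_space T \<mu>)"

section \<open>The operators \<open>L(V)\<close> and \<open>L\<^sub>t(V)\<close>\<close>

definition q_pot :: "real \<Rightarrow> real \<Rightarrow> complex" where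
  "q_pot V x = (1 + 2 * of_real V) * exp (\<i> * 2 * of_real x)
         + (1 - 2 * of_real V) * exp (- (\<i> * 2 * of_real x))"

text \<open>\<open>sobolev22 S y y1 y2\<close>: on the interval \<open>S\<close>, \<open>y\<close> is in \<open>W\<^sub>2\<^sup>2(S)\<close> with derivatives
  \<open>y1\<close> and \<open>y2\<close>. Being locally square integrable, \<open>y1\<close> and \<open>y2\<close> are locally Lebesgue integrable,
  so the integral conditions say that \<open>y\<close> and \<open>y1\<close> are locally absolutely continuous with
  \<open>y' = y1\<close> and \<open>y1' = y2\<close> almost everywhere.\<close>

definition sobolev22 ::
    "real set \<Rightarrow> (real \<Rightarrow> complex) \<Rightarrow> (real \<Rightarrow> complex) \<Rightarrow> (real \<Rightarrow> complex) \<Rightarrow> bool" where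
  "sobolev22 S y y1 y2 \<longleftrightarrow>
     y \<in> Ltwo S \<and> y1 \<in> Ltwo S \<and> y2 \<in> Ltwo S \<and> (\<forall>x. x \<notin> S \<longrightarrow> y x = 0) \<and>
     (\<forall>a b. a \<le> b \<and> {a..b} \<subseteq> S \<longrightarrow>
        (y1 has_integral (y b - y a)) {a..b} \<and> (y2 has_integral (y1 b - y1 a)) {a..b})"

definition L_line :: "real \<Rightarrow> graph" where
  "L_line V = {(y, f). \<exists>y1 y2. sobolev22 UNIV y y1 y2 \<and>
     f \<in> Ltwo UNIV \<and> (AE x in lebesgue. f x = - y2 x + q_pot V x * y x)}"

definition L_bloch :: "real \<Rightarrow> real \<Rightarrow> graph" where
  "L_bloch V t = {(y, f). \<exists>y1 y2. sobolev22 {0..pi} y y1 y2 \<and>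
     y pi = exp (\<i> * of_real (pi * t)) * y 0 \<and>
     y1 pi = exp (\<i> * of_real (pi * t)) * y1 0 \<and>
     f \<in> Ltwo {0..pi} \<and> (AE x in lebesgue_on {0..pi}. f x = - y2 x + q_pot V x * y x)}"

definition simple_eigenvalue :: "real \<Rightarrow> real \<Rightarrow> complex \<Rightarrow> bool" where
  "simple_eigenvalue V t \<mu> \<longleftrightarrow> algebraic_multiplicity (L_bloch V t) \<mu> = 1"

section \<open>Numbering of the eigenvalues and spectral singularities\<close>

text \<open>Every \<open>\<mu>\<close> occurs in the sequence \<open>n \<mapsto> lam n t\<close> exactly as often as its algebraic
  multiplicity, which is \<open>0\<close> if \<open>\<mu>\<close> is not an eigenvalue.\<close>

definition eigenvalue_numbering :: "real \<Rightarrow> (nat \<Rightarrow> real \<Rightarrow> complex) \<Rightarrow> bool" where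
  "eigenvalue_numbering V lam \<longleftrightarrow>
     (\<forall>t \<in> {-1<..1}. \<forall>\<mu>. finite {n. lam n t = \<mu>} \<and>
        card {n. lam n t = \<mu>} = algebraic_multiplicity (L_bloch V t) \<mu>) \<and>
     (\<forall>n. continuous_on {-1<..1} (lam n))"

text \<open>The eigenfunctions are fixed arbitrarily; at a simple eigenvalue they are unique up to
  unimodular factors, so the modulus of \<open>d_coef\<close> does not depend on the choice.\<close>

definition normalized_eigenfunctions ::
    "real \<Rightarrow> (nat \<Rightarrow> real \<Rightarrow> complex) \<Rightarrow> (nat \<Rightarrow> real \<Rightarrow> real \<Rightarrow> complex) \<Rightarrow>
     (nat \<Rightarrow> real \<Rightarrow> real \<Rightarrow> complex) \<Rightarrow> bool" where
  "normalized_eigenfunctions V lam Psi Psi_star \<longleftrightarrow>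
     (\<forall>n. \<forall>t \<in> {-1<..1}. simple_eigenvalue V t (lam n t) \<longrightarrow>
        normalized_eigenfunction {0..pi} (L_bloch V t) (lam n t) (Psi n t) \<and>
        normalized_eigenfunction {0..pi} (adjoint_graph {0..pi} (L_bloch V t))
          (cnj (lam n t)) (Psi_star n t))"

definition d_coef :: "(nat \<Rightarrow> real \<Rightarrow> real \<Rightarrow> complex) \<Rightarrow> (nat \<Rightarrow> real \<Rightarrow> real \<Rightarrow> complex) \<Rightarrow>
    nat \<Rightarrow> real \<Rightarrow> complex" where
  "d_coef Psi Psi_star n t = Ltwo_inner {0..pi} (Psi n t) (Psi_star n t)"

definition spectral_singularity ::
    "real \<Rightarrow> (nat \<Rightarrow> real \<Rightarrow> complex) \<Rightarrow> (nat \<Rightarrow> real \<Rightarrow> real \<Rightarrow> complex) \<Rightarrow>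
     (nat \<Rightarrow> real \<Rightarrow> real \<Rightarrow> complex) \<Rightarrow> complex \<Rightarrow> bool" where
  "spectral_singularity V lam Psi Psi_star \<mu> \<longleftrightarrow>
     \<mu> \<in> spectrum_of UNIV (L_line V) \<and>
     (\<exists>n. \<exists>t :: nat \<Rightarrow> real. (\<forall>k. t k \<in> {-1<..1} \<and> simple_eigenvalue V (t k) (lam n (t k))) \<and>
        (\<lambda>k. lam n (t k)) \<longlonglongrightarrow> \<mu> \<and>
        (\<lambda>k. cmod (d_coef Psi Psi_star n (t k))) \<longlonglongrightarrow> 0)"

definition spectral_singularity_at_infinity ::
    "real \<Rightarrow> (nat \<Rightarrow> real \<Rightarrow> complex) \<Rightarrow> (nat \<Rightarrow> real \<Rightarrow> real \<Rightarrow> complex) \<Rightarrow>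
     (nat \<Rightarrow> real \<Rightarrow> real \<Rightarrow> complex) \<Rightarrow> bool" where
  "spectral_singularity_at_infinity V lam Psi Psi_star \<longleftrightarrow>
     (\<exists>n :: nat \<Rightarrow> nat. \<exists>t :: nat \<Rightarrow> real.
        (\<forall>k. t k \<in> {-1<..1} \<and> simple_eigenvalue V (t k) (lam (n k) (t k))) \<and>
        filterlim (\<lambda>k. cmod (lam (n k) (t k))) at_top sequentially \<and>
        (\<lambda>k. cmod (d_coef Psi Psi_star (n k) (t k))) \<longlonglongrightarrow> 0)"

end

theory Submission
  imports Defs "HOL-Complex_Analysis.Complex_Analysis"
begin

text \<open>Let \<open>F\<close> be the Hill discriminant. It is entire, real on the real line by PT symmetry, and
  \<open>F (k\<^sup>2)\<close> is close to \<open>2 (-1)\<^sup>k\<close>. For \<open>V > 1/2\<close> there is no real antiperiodic eigenvalue: the Fourier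
  coefficients of an antiperiodic eigenfunction satisfy a three-term recurrence with an antiunitary
  symmetry that would force a double solution, while the Casoratian excludes one. Hence \<open>F > -2\<close> on the
  real line, and for large \<open>j\<close> the minimum of \<open>F\<close> over \<open>[(2j)\<^sup>2, (2j + 2)\<^sup>2]\<close> is an interior critical point
  \<open>s\<close> with \<open>-2 < F s < 0\<close>. To the right of \<open>s\<close> the real numbers \<open>\<mu>\<close> are simple eigenvalues of
  \<open>L\<^sub>t(V)\<close> with \<open>2 cos (pi t) = F \<mu>\<close>, belong to one branch of the numbering, and satisfy
  \<open>\<bar>d\<bar> \<le> C \<bar>F' \<mu>\<bar> / sin (pi t)\<close>, which tends to zero at \<open>s\<close>.\<close>

section \<open>Second-order linear equations\<close>

text \<open>Everything rests on one identity: the Wronskian of solutions of two equations has a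
  derivative built from the difference of the coefficients and from the right-hand sides. Comparing
  two values of \<mu> makes F analytic, the free equation gives the values of F at squares,
  exponentials give the Fourier recurrence, and cubic polynomials bound initial data. For Floquet
  solutions y, z with multipliers \<rho>, 1/\<rho> it equates F' times their Wronskian with (\<rho>
  - 1/\<rho>) times the integral of y z. This pairing serves twice near s: where it is nonzero the
  eigenvalue is simple, and its size controls d. The hypothesis on V enters through the sign of (1 +
  2V)(1 - 2V), the product of the two Fourier coefficients of q. Antiperiodic solutions have odd
  exponents 2k + 1, reflected by k -> -1 - k; there a negative product makes the square of the
  antiunitary symmetry negative. The numbering is given, not constructed, so a branch can only be
  identified through the multiplicity count and continuity. That s belongs to the spectrum on the
  line is a separate matter, settled by approximate eigenfunctions.\<close>

definition ode_on :: "real set \<Rightarrow> (real \<Rightarrow> complex) \<Rightarrow> (real \<Rightarrow> complex) \<Rightarrow>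
    (real \<Rightarrow> complex) \<Rightarrow> (real \<Rightarrow> complex) \<Rightarrow> bool" where
  "ode_on S p f y y1 \<longleftrightarrow> (\<forall>x\<in>S. (y has_vector_derivative y1 x) (at x within S) \<and>
     (y1 has_vector_derivative (p x * y x - f x)) (at x within S))"

text \<open>The integral over \<open>{0..x}\<close> vanishes for negative \<open>x\<close>, hence
  the explicit sign in the second branch.\<close>

definition primitive :: "(real \<Rightarrow> complex) \<Rightarrow> real \<Rightarrow> complex" where
  "primitive f x = (if 0 \<le> x then integral {0..x} f else - integral {x..0} f)"

lemma primitive_0 [simp]: "primitive f 0 = 0"
  by (simp add: primitive_def)

lemma has_vector_derivative_primitive:
  assumes "continuous_on UNIV f"
  shows "(primitive f has_vector_derivative f x) (at x)"
proof -
  define R where "R = \<bar>x\<bar> + 1"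
  have c: "continuous_on {a..b} f" for a b
    using assms continuous_on_subset by blast
  have i: "f integrable_on {a..b}" for a b
    using c integrable_continuous_real by blast
  \<comment> \<open>\<open>primitive f\<close> differs only by a constant from an integral with the
    fixed lower end \<open>- R\<close>, so the fundamental theorem on a compact interval applies at
    \<open>x\<close>, which is interior by the choice of \<open>R\<close>.\<close>
  have e: "integral {- R..y} f - integral {- R..0} f = primitive f y" if "y \<in> {-R<..<R}" for y
    using that Henstock_Kurzweil_Integration.integral_combine[OF _ _ i, of "-R" 0 y] Henstock_Kurzweil_Integration.integral_combine[OF _ _ i, of "-R" y 0]
    by (auto simp: primitive_def R_def algebra_simps)
  have x: "x \<in> {-R<..<R}" by (auto simp: R_def)
  have "((\<lambda>u. integral {-R..u} f) has_vector_derivative f x) (at x within {-R..R})"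
    using x by (intro integral_has_vector_derivative c) auto
  then have "((\<lambda>u. integral {-R..u} f) has_vector_derivative f x) (at x)"
    using x by (simp add: at_within_Icc_at)
  then have "((\<lambda>u. integral {-R..u} f - integral {-R..0} f) has_vector_derivative f x) (at x)"
    by (auto intro!: derivative_eq_intros)
  then show ?thesis
    by (rule has_vector_derivative_transform_within_open[where S="{-R<..<R}"]) (use x e in auto)
qed

lemma continuous_on_primitive:
  assumes "continuous_on UNIV f"
  shows "continuous_on S (primitive f)"
  using has_vector_derivative_primitive[OF assms] has_vector_derivative_continuous
  by (metis continuous_at_imp_continuous_on)

lemma primitive_diff:
  assumes "continuous_on UNIV f" "continuous_on UNIV g"
  shows "primitive (\<lambda>x. f x - g x) x = primitive f x - primitive g x"
proof -
  have "f integrable_on {a..b}" "g integrable_on {a..b}" for a b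
    using assms continuous_on_subset integrable_continuous_real by blast+
  then show ?thesis by (simp add: primitive_def integral_diff)
qed

text \<open>An exponential weight of rate \<open>K\<close> is reproduced by integration up to the
  factor \<open>1 / K\<close>; the boundary term at 0 has the favourable sign.\<close>

lemma norm_primitive_le:
  assumes f: "continuous_on UNIV f" and K: "K > 0" and B: "B \<ge> 0"
    and le: "\<And>x. norm (f x) \<le> B * exp (K * \<bar>x\<bar>)"
  shows "norm (primitive f x) \<le> B / K * exp (K * \<bar>x\<bar>)"
proof -
  have c: "f integrable_on {a..b}" for a b
    using assms(1) continuous_on_subset integrable_continuous_real by blast
  show ?thesis
  proof (cases "0 \<le> x")
    case True
    have "((\<lambda>s. B * exp (K * s)) has_integral (B / K * exp (K * x) - B / K * exp (K * 0))) {0..x}"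
      using K by (intro fundamental_theorem_of_calculus True)
        (auto intro!: derivative_eq_intros simp flip: has_real_derivative_iff_has_vector_derivative)
    moreover have "norm (f s) \<le> B * exp (K * s)" if "s \<in> {0..x}" for s
      using le[of s] that by simp
    ultimately have "norm (integral {0..x} f) \<le> B / K * exp (K * x) - B / K * exp (K * 0)"
      using Henstock_Kurzweil_Integration.integral_norm_bound_integral[OF c]
      by (metis (no_types, lifting) has_integral_integrable integral_unique)
    then show ?thesis using True K B by (simp add: primitive_def) (smt (verit) divide_nonneg_pos)
  next
    case False
    have "((\<lambda>s. B * exp (- (K * s))) has_integral ((- (B / K) * exp (- (K * 0))) - (- (B / K) * exp (- (K * x))))) {x..0}"
      using K False by (intro fundamental_theorem_of_calculus)
        (auto intro!: derivative_eq_intros simp flip: has_real_derivative_iff_has_vector_derivative)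
    moreover have "norm (f s) \<le> B * exp (- (K * s))" if "s \<in> {x..0}" for s
      using le[of s] that by simp
    ultimately have "norm (integral {x..0} f) \<le> (- (B / K) * exp (- (K * 0))) - (- (B / K) * exp (- (K * x)))"
      using Henstock_Kurzweil_Integration.integral_norm_bound_integral[OF c]
      by (metis (no_types, lifting) has_integral_integrable integral_unique)
    then show ?thesis using False K B by (simp add: primitive_def) (smt (verit) divide_nonneg_pos)
  qed
qed

text \<open>The iteration contracts in the norm weighted by \<open>exp (K * \<bar>x\<bar>)\<close>, because each primitive gains
  a factor \<open>1 / K\<close>.\<close>

theorem ode_exists:
  assumes p: "continuous_on UNIV p" and C: "\<And>x. norm (p x) \<le> C"
  shows "\<exists>y y1. ode_on UNIV p (\<lambda>_. 0) y y1 \<and> y 0 = \<alpha> \<and> y1 0 = \<beta>"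
proof -
  have C0: "C \<ge> 0" using C[of 0] norm_ge_zero order_trans by blast
  \<comment> \<open>With \<open>K = C + 1\<close> one has \<open>4 * C \<le> K\<^sup>2\<close>, so
    multiplication by \<open>p\<close> followed by two primitives contracts by
    \<open>C / K\<^sup>2 \<le> 1/4\<close>.\<close>
  define K where "K = C + 1"
  have K: "K \<ge> 1" "K > 0" using C0 by (auto simp: K_def)
  \<comment> \<open>A bounded function \<open>g\<close> stands for the solution
    \<open>exp (K * \<bar>x\<bar>) * g x\<close>. This makes the complete space of bounded
    continuous functions available on the whole line, where solutions may grow; \<open>U g\<close>
    below is the integral equation divided by the weight.\<close>
  define P where "P g = (\<lambda>x. p x * (of_real (exp (K * \<bar>x\<bar>)) * apply_bcontfun g x))" for g
  have Pc: "continuous_on S (P g)" for g S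
    unfolding P_def using continuous_on_subset[OF p]
    by (intro continuous_intros) auto
  have PPc: "continuous_on S (primitive (P g))" for g S
    using continuous_on_primitive Pc by blast
  define U where "U g x = of_real (exp (- (K * \<bar>x\<bar>))) * (\<alpha> + \<beta> * of_real x + primitive (primitive (P g)) x)" for g x
  have bound: "norm (primitive (primitive (\<lambda>x. P g x - P h x)) x) \<le> C * dist g h / K / K * exp (K * \<bar>x\<bar>)" for g h x
  proof (intro norm_primitive_le)
    have "continuous_on UNIV (\<lambda>x. P g x - P h x)" by (intro continuous_intros Pc)
    then show "continuous_on UNIV (\<lambda>x. P g x - P h x)"
      and "continuous_on UNIV (primitive (\<lambda>x. P g x - P h x))"
      using continuous_on_primitive by blast+
    show "norm (P g x - P h x) \<le> C * dist g h * exp (K * \<bar>x\<bar>)" for x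
    proof -
      have "P g x - P h x = p x * of_real (exp (K * \<bar>x\<bar>)) * (apply_bcontfun g x - apply_bcontfun h x)"
        by (simp add: P_def algebra_simps)
      then have "norm (P g x - P h x) = norm (p x) * exp (K * \<bar>x\<bar>) * dist (apply_bcontfun g x) (apply_bcontfun h x)"
        by (simp add: norm_mult dist_norm)
      also have "\<dots> \<le> C * exp (K * \<bar>x\<bar>) * dist g h"
        using C[of x] C0 by (intro mult_mono dist_bounded) auto
      finally show ?thesis by (simp add: mult.commute mult.left_commute)
    qed
  qed (use K C0 in auto)
  have P0: "P 0 = (\<lambda>_. 0)" by (simp add: P_def fun_eq_iff)
  have Ub: "U g \<in> bcontfun" for g
  proof (rule bcontfun_normI)
    show "continuous_on UNIV (U g)"
      unfolding U_def by (intro continuous_intros continuous_on_primitive PPc)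
    fix x
    have 1: "norm (primitive (primitive (P g)) x) \<le> C * dist g 0 / K / K * exp (K * \<bar>x\<bar>)"
      using bound[of g 0 x] by (simp add: P0)
    have 2: "\<bar>x\<bar> \<le> exp (K * \<bar>x\<bar>)" "1 \<le> exp (K * \<bar>x\<bar>)"
    proof -
      have "\<bar>x\<bar> \<le> K * \<bar>x\<bar>" using K by (simp add: mult_le_cancel_right1)
      also have "\<dots> \<le> exp (K * \<bar>x\<bar>)" using exp_ge_add_one_self[of "K * \<bar>x\<bar>"] by linarith
      finally show "\<bar>x\<bar> \<le> exp (K * \<bar>x\<bar>)" .
    qed (use K in auto)
    have "norm (\<alpha> + \<beta> * of_real x + primitive (primitive (P g)) x) \<le>
        norm \<alpha> * 1 + norm \<beta> * \<bar>x\<bar> + norm (primitive (primitive (P g)) x)"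
      by (intro norm_triangle_mono order.refl) (auto simp: norm_mult)
    also have "\<dots> \<le> norm \<alpha> * exp (K * \<bar>x\<bar>) + norm \<beta> * exp (K * \<bar>x\<bar>) + C * dist g 0 / K / K * exp (K * \<bar>x\<bar>)"
      by (intro add_mono mult_left_mono 1 2) auto
    finally have "norm (U g x) \<le> exp (- (K * \<bar>x\<bar>)) * ((norm \<alpha> + norm \<beta> + C * dist g 0 / K / K) * exp (K * \<bar>x\<bar>))"
      unfolding U_def norm_mult by (intro mult_mono) (auto simp: algebra_simps)
    also have "\<dots> = norm \<alpha> + norm \<beta> + C * dist g 0 / K / K"
      by (simp add: exp_minus)
    finally show "norm (U g x) \<le> norm \<alpha> + norm \<beta> + C * dist g 0 / K / K" .
  qed
  define T where "T g = Bcontfun (U g)" for g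
  have T: "apply_bcontfun (T g) = U g" for g
    unfolding T_def using Ub by (rule Bcontfun_inverse)
  have "dist (T g) (T h) \<le> 1/4 * dist g h" for g h
  proof (rule dist_bound)
    fix x
    have "U g x - U h x = of_real (exp (- (K * \<bar>x\<bar>))) * primitive (primitive (\<lambda>x. P g x - P h x)) x"
    proof -
      have "primitive (\<lambda>x. P g x - P h x) = (\<lambda>x. primitive (P g) x - primitive (P h) x)"
        by (rule ext) (intro primitive_diff Pc)
      then show ?thesis
        by (simp add: U_def algebra_simps primitive_diff[OF PPc PPc])
    qed
    then have "dist (U g x) (U h x) = exp (- (K * \<bar>x\<bar>)) * norm (primitive (primitive (\<lambda>x. P g x - P h x)) x)"
      by (simp add: dist_norm norm_mult)
    also have "\<dots> \<le> exp (- (K * \<bar>x\<bar>)) * (C * dist g h / K / K * exp (K * \<bar>x\<bar>))"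
      by (intro mult_left_mono bound) auto
    also have "\<dots> = C / K / K * dist g h" by (simp add: exp_minus)
    also have "\<dots> \<le> 1/4 * dist g h"
    proof -
      have "4 * C \<le> K * K"
        using zero_le_power2[of "C - 1"] by (simp add: power2_eq_square K_def algebra_simps)
      then have "C / K / K \<le> 1/4"
        using K(2) by (simp add: divide_le_eq)
      then show ?thesis using mult_right_mono[of "C / K / K" "1/4" "dist g h"] by simp
    qed
    finally show "dist (apply_bcontfun (T g) x) (apply_bcontfun (T h) x) \<le> 1/4 * dist g h"
      by (simp add: T)
  qed
  then have "\<exists>!g. T g = g"
    by (intro banach_fix_type[of "1/4" T]) auto
  then obtain g where g: "T g = g" by blast
  define y where "y x = \<alpha> + \<beta> * of_real x + primitive (primitive (P g)) x" for x
  define y1 where "y1 x = \<beta> + primitive (P g) x" for x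
  have "apply_bcontfun g x = of_real (exp (- (K * \<bar>x\<bar>))) * y x" for x
    using T[of g] by (simp add: g U_def y_def fun_eq_iff)
  then have "P g x = p x * ((of_real (exp (K * \<bar>x\<bar>)) * of_real (exp (- (K * \<bar>x\<bar>)))) * y x)" for x
    by (simp add: P_def)
  then have Py: "P g x = p x * y x" for x
    by (simp only: of_real_mult[symmetric]) (simp add: exp_minus)
  have "(y has_vector_derivative y1 x) (at x)" for x
    unfolding y_def y1_def
    by (auto intro!: derivative_eq_intros has_vector_derivative_primitive PPc)
  moreover have "(y1 has_vector_derivative p x * y x - 0) (at x)" for x
    unfolding y1_def Py[symmetric]
    by (auto intro!: derivative_eq_intros has_vector_derivative_primitive Pc)
  ultimately have "ode_on UNIV p (\<lambda>_. 0) y y1" by (simp add: ode_on_def)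
  then show ?thesis by (intro exI[of _ y] exI[of _ y1]) (simp add: y_def y1_def)
qed

lemma ode_on_subset: "ode_on S p f y y1 \<Longrightarrow> T \<subseteq> S \<Longrightarrow> ode_on T p f y y1"
  unfolding ode_on_def by (meson has_vector_derivative_within_subset subsetD)

lemma ode_on_continuous:
  assumes "ode_on S p f y y1"
  shows "continuous_on S y" "continuous_on S y1"
  using assms unfolding ode_on_def continuous_on_eq_continuous_within
  by (blast intro: has_vector_derivative_continuous)+

lemma ode_on_combine:
  assumes "ode_on S p f y y1" "ode_on S p g z z1"
  shows "ode_on S p (\<lambda>x. a * f x + b * g x) (\<lambda>x. a * y x + b * z x) (\<lambda>x. a * y1 x + b * z1 x)"
  unfolding ode_on_def
proof (intro ballI conjI)
  fix x assume "x \<in> S"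
  then have *: "(y has_vector_derivative y1 x) (at x within S)" "(z has_vector_derivative z1 x) (at x within S)"
    "(y1 has_vector_derivative (p x * y x - f x)) (at x within S)"
    "(z1 has_vector_derivative (p x * z x - g x)) (at x within S)"
    using assms by (auto simp: ode_on_def)
  show "((\<lambda>x. a * y x + b * z x) has_vector_derivative a * y1 x + b * z1 x) (at x within S)"
    by (intro has_vector_derivative_add has_vector_derivative_mult_right *)
  have "((\<lambda>x. a * y1 x + b * z1 x) has_vector_derivative a * (p x * y x - f x) + b * (p x * z x - g x)) (at x within S)"
    by (intro has_vector_derivative_add has_vector_derivative_mult_right *)
  then show "((\<lambda>x. a * y1 x + b * z1 x) has_vector_derivative
      p x * (a * y x + b * z x) - (a * f x + b * g x)) (at x within S)"
    by (simp add: algebra_simps)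
qed

text \<open>Lagrange's identity. Both coefficients and both right-hand sides are left free, because
  later uses compare different \<mu>, the potential with a constant coefficient, and homogeneous
  with inhomogeneous equations.\<close>

lemma wronskian_deriv:
  assumes "ode_on S p f y y1" "ode_on S r g z z1" "x \<in> S"
  shows "((\<lambda>x. y x * z1 x - y1 x * z x) has_vector_derivative
           ((r x - p x) * (y x * z x) + f x * z x - y x * g x)) (at x within S)"
proof -
  have *: "(y has_vector_derivative y1 x) (at x within S)" "(z has_vector_derivative z1 x) (at x within S)"
    "(y1 has_vector_derivative (p x * y x - f x)) (at x within S)"
    "(z1 has_vector_derivative (r x * z x - g x)) (at x within S)"
    using assms by (auto simp: ode_on_def)
  have "((\<lambda>x. y x * z1 x - y1 x * z x) has_vector_derivative
      (y x * (r x * z x - g x) + y1 x * z1 x) - (y1 x * z1 x + (p x * y x - f x) * z x)) (at x within S)"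
    by (intro has_vector_derivative_diff has_vector_derivative_mult *)
  then show ?thesis by (simp add: algebra_simps)
qed

lemma wronskian_has_integral:
  assumes "ode_on S p f y y1" "ode_on S r g z z1" "a \<le> b" "{a..b} \<subseteq> S"
  shows "((\<lambda>x. (r x - p x) * (y x * z x) + f x * z x - y x * g x) has_integral
           ((y b * z1 b - y1 b * z b) - (y a * z1 a - y1 a * z a))) {a..b}"
  using assms has_vector_derivative_within_subset[OF wronskian_deriv[OF assms(1,2)] assms(4)]
  by (intro fundamental_theorem_of_calculus) auto

lemma wronskian_const:
  assumes "ode_on S p (\<lambda>_. 0) y y1" "ode_on S p (\<lambda>_. 0) z z1" "convex S" "a \<in> S" "b \<in> S"
  shows "y a * z1 a - y1 a * z a = y b * z1 b - y1 b * z b"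
proof -
  have "((\<lambda>x. y x * z1 x - y1 x * z x) has_derivative (\<lambda>h. 0)) (at x within S)" if "x \<in> S" for x
    using wronskian_deriv[OF assms(1,2) that] by (simp add: has_vector_derivative_def)
  then have "\<exists>c. \<forall>x\<in>S. y x * z1 x - y1 x * z x = c"
    by (intro has_derivative_zero_constant[OF assms(3)]) blast
  then show ?thesis using assms(4,5) by auto
qed

lemma ode_on_shift:
  assumes "ode_on UNIV p (\<lambda>_. 0) y y1" "\<And>x. p (x + c) = p x"
  shows "ode_on UNIV p (\<lambda>_. 0) (\<lambda>x. y (x + c)) (\<lambda>x. y1 (x + c))"
proof -
  have *: "((\<lambda>x. h (x + c)) has_vector_derivative D) (at x)"
    if "(h has_vector_derivative D) (at (x + c))" for h :: "real \<Rightarrow> complex" and D x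
  proof -
    have "(((\<lambda>x. x + c)) has_vector_derivative 1) (at x)"
      by (auto intro!: derivative_eq_intros)
    from vector_diff_chain_at[OF this that] show ?thesis by (simp add: o_def)
  qed
  have "(y has_vector_derivative y1 (x + c)) (at (x + c))"
    "(y1 has_vector_derivative p x * y (x + c)) (at (x + c))" for x
    using assms(1) assms(2)[of x] by (auto simp: ode_on_def) metis
  then show ?thesis by (simp add: ode_on_def *)
qed

section \<open>The fundamental system of \<open>-y'' + q y = \<mu> y\<close>\<close>

lemma continuous_on_q_pot [continuous_intros]: "continuous_on S (q_pot V)"
  unfolding q_pot_def by (intro continuous_intros)

lemma q_pot_cis: "q_pot V x = (1 + 2 * of_real V) * cis (2 * x) + (1 - 2 * of_real V) * cis (- 2 * x)"
  by (simp add: q_pot_def cis_conv_exp algebra_simps)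

lemma cmod_q_pot_le: "cmod (q_pot V x) \<le> \<bar>1 + 2 * V\<bar> + \<bar>1 - 2 * V\<bar>"
proof -
  have "(1 + 2 * of_real V :: complex) = of_real (1 + 2 * V)" "(1 - 2 * of_real V :: complex) = of_real (1 - 2 * V)"
    by simp_all
  then have "cmod (1 + 2 * of_real V) = \<bar>1 + 2 * V\<bar>" "cmod (1 - 2 * of_real V) = \<bar>1 - 2 * V\<bar>"
    by (simp_all only: norm_of_real)
  then show ?thesis unfolding q_pot_cis
    by (intro norm_triangle_le) (simp add: norm_mult)
qed

lemma q_pot_periodic [simp]: "q_pot V (x + pi) = q_pot V x"
proof -
  have "cis (2 * (x + pi)) = cis (2 * x)"
    by (simp add: complex_eq_iff distrib_left)
  moreover have "cis (- 2 * (x + pi)) = cis (- 2 * x)"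
    by (simp add: complex_eq_iff distrib_left cos_diff sin_diff)
  ultimately show ?thesis by (simp only: q_pot_cis)
qed

text \<open>Solution and derivative are chosen together as a pair, so that \<open>dsol\<close> is
  the derivative of \<open>sol\<close>; uniqueness of the pair is
  \<open>ode_on_unique\<close>.\<close>

definition ivp :: "real \<Rightarrow> complex \<Rightarrow> complex \<Rightarrow> complex \<Rightarrow> (real \<Rightarrow> complex) \<times> (real \<Rightarrow> complex)" where
  "ivp V \<mu> \<alpha> \<beta> = (SOME Y. ode_on UNIV (\<lambda>x. q_pot V x - \<mu>) (\<lambda>_. 0) (fst Y) (snd Y) \<and>
     fst Y 0 = \<alpha> \<and> snd Y 0 = \<beta>)"

definition sol :: "real \<Rightarrow> complex \<Rightarrow> complex \<Rightarrow> complex \<Rightarrow> real \<Rightarrow> complex" where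
  "sol V \<mu> \<alpha> \<beta> = fst (ivp V \<mu> \<alpha> \<beta>)"

definition dsol :: "real \<Rightarrow> complex \<Rightarrow> complex \<Rightarrow> complex \<Rightarrow> real \<Rightarrow> complex" where
  "dsol V \<mu> \<alpha> \<beta> = snd (ivp V \<mu> \<alpha> \<beta>)"

lemma
  shows ode_on_sol: "ode_on UNIV (\<lambda>x. q_pot V x - \<mu>) (\<lambda>_. 0) (sol V \<mu> \<alpha> \<beta>) (dsol V \<mu> \<alpha> \<beta>)"
    and sol_0 [simp]: "sol V \<mu> \<alpha> \<beta> 0 = \<alpha>"
    and dsol_0 [simp]: "dsol V \<mu> \<alpha> \<beta> 0 = \<beta>"
proof -
  have "norm (q_pot V x - \<mu>) \<le> (\<bar>1 + 2 * V\<bar> + \<bar>1 - 2 * V\<bar>) + norm \<mu>" for x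
    by (intro order_trans[OF norm_triangle_ineq4] add_mono cmod_q_pot_le) auto
  moreover have "continuous_on UNIV (\<lambda>x. q_pot V x - \<mu>)" by (intro continuous_intros)
  ultimately obtain y y1 where "ode_on UNIV (\<lambda>x. q_pot V x - \<mu>) (\<lambda>_. 0) y y1 \<and> y 0 = \<alpha> \<and> y1 0 = \<beta>"
    using ode_exists by blast
  then have "\<exists>Y. ode_on UNIV (\<lambda>x. q_pot V x - \<mu>) (\<lambda>_. 0) (fst Y) (snd Y) \<and> fst Y 0 = \<alpha> \<and> snd Y 0 = \<beta>"
    by (intro exI[of _ "(y, y1)"]) simp
  from someI_ex[OF this]
  show "ode_on UNIV (\<lambda>x. q_pot V x - \<mu>) (\<lambda>_. 0) (sol V \<mu> \<alpha> \<beta>) (dsol V \<mu> \<alpha> \<beta>)"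
    "sol V \<mu> \<alpha> \<beta> 0 = \<alpha>" "dsol V \<mu> \<alpha> \<beta> 0 = \<beta>"
    by (auto simp: ivp_def sol_def dsol_def)
qed

lemma continuous_on_sol [continuous_intros]:
  "continuous_on S (sol V \<mu> \<alpha> \<beta>)" "continuous_on S (dsol V \<mu> \<alpha> \<beta>)"
  using ode_on_continuous[OF ode_on_sol] continuous_on_subset by blast+

lemma wronskian_fundamental:
  "sol V \<mu> 1 0 x * dsol V \<mu> 0 1 x - dsol V \<mu> 1 0 x * sol V \<mu> 0 1 x = 1"
  using wronskian_const[OF ode_on_sol ode_on_sol convex_UNIV, of x 0 V \<mu> 1 0 0 1] by simp

lemma ode_on_eq_sol:
  assumes ode: "ode_on S (\<lambda>x. q_pot V x - \<mu>) (\<lambda>_. 0) y y1" and S: "convex S" "0 \<in> S" "x \<in> S"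
  shows "y x = sol V \<mu> (y 0) (y1 0) x \<and> y1 x = dsol V \<mu> (y 0) (y1 0) x"
proof -
  let ?c = "sol V \<mu> 1 0 x" and ?c1 = "dsol V \<mu> 1 0 x" and ?s = "sol V \<mu> 0 1 x" and ?s1 = "dsol V \<mu> 0 1 x"
  have main: "z x = z 0 * ?c + z1 0 * ?s \<and> z1 x = z 0 * ?c1 + z1 0 * ?s1"
    if z: "ode_on S (\<lambda>x. q_pot V x - \<mu>) (\<lambda>_. 0) z z1" for z z1
  proof -
    have o: "ode_on S (\<lambda>x. q_pot V x - \<mu>) (\<lambda>_. 0) (sol V \<mu> \<alpha> \<beta>) (dsol V \<mu> \<alpha> \<beta>)" for \<alpha> \<beta>
      using ode_on_sol ode_on_subset by blast
    have w: "?c * ?s1 - ?c1 * ?s = 1" by (rule wronskian_fundamental)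
    have 1: "z x * ?s1 - z1 x * ?s = z 0"
      using wronskian_const[OF z o S(1) S(3) S(2), of 0 1] by simp
    have 2: "z x * ?c1 - z1 x * ?c = - z1 0"
      using wronskian_const[OF z o S(1) S(3) S(2), of 1 0] by simp
    have "z x = z x * (?c * ?s1 - ?c1 * ?s)" by (simp add: w)
    also have "\<dots> = (z x * ?s1 - z1 x * ?s) * ?c - (z x * ?c1 - z1 x * ?c) * ?s"
      by (simp add: algebra_simps)
    also have "\<dots> = z 0 * ?c + z1 0 * ?s" unfolding 1 2 by simp
    finally have 3: "z x = z 0 * ?c + z1 0 * ?s" .
    have "z1 x = z1 x * (?c * ?s1 - ?c1 * ?s)" by (simp add: w)
    also have "\<dots> = (z x * ?s1 - z1 x * ?s) * ?c1 - (z x * ?c1 - z1 x * ?c) * ?s1"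
      by (simp add: algebra_simps)
    also have "\<dots> = z 0 * ?c1 + z1 0 * ?s1" unfolding 1 2 by simp
    finally show ?thesis using 3 by blast
  qed
  have "ode_on S (\<lambda>x. q_pot V x - \<mu>) (\<lambda>_. 0) (sol V \<mu> (y 0) (y1 0)) (dsol V \<mu> (y 0) (y1 0))"
    using ode_on_sol ode_on_subset by blast
  from main[OF ode] main[OF this] show ?thesis by simp
qed

lemma ode_on_unique:
  assumes "ode_on UNIV (\<lambda>x. q_pot V x - \<mu>) (\<lambda>_. 0) y y1" "y 0 = \<alpha>" "y1 0 = \<beta>"
  shows "sol V \<mu> \<alpha> \<beta> = y" "dsol V \<mu> \<alpha> \<beta> = y1"
  using ode_on_eq_sol[OF assms(1)] assms(2,3) by (auto simp: fun_eq_iff)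

lemma
  shows sol_combine: "sol V \<mu> (a * \<alpha> + b * \<gamma>) (a * \<beta> + b * \<delta>) x = a * sol V \<mu> \<alpha> \<beta> x + b * sol V \<mu> \<gamma> \<delta> x"
    and dsol_combine: "dsol V \<mu> (a * \<alpha> + b * \<gamma>) (a * \<beta> + b * \<delta>) x = a * dsol V \<mu> \<alpha> \<beta> x + b * dsol V \<mu> \<gamma> \<delta> x"
proof -
  have "ode_on UNIV (\<lambda>x. q_pot V x - \<mu>) (\<lambda>_. 0) (\<lambda>x. a * sol V \<mu> \<alpha> \<beta> x + b * sol V \<mu> \<gamma> \<delta> x)
      (\<lambda>x. a * dsol V \<mu> \<alpha> \<beta> x + b * dsol V \<mu> \<gamma> \<delta> x)"
    using ode_on_combine[where a = a and b = b,
      OF ode_on_sol[of V \<mu> \<alpha> \<beta>] ode_on_sol[of V \<mu> \<gamma> \<delta>]] by simp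
  from ode_on_unique[OF this]
  show "sol V \<mu> (a * \<alpha> + b * \<gamma>) (a * \<beta> + b * \<delta>) x = a * sol V \<mu> \<alpha> \<beta> x + b * sol V \<mu> \<gamma> \<delta> x"
    "dsol V \<mu> (a * \<alpha> + b * \<gamma>) (a * \<beta> + b * \<delta>) x = a * dsol V \<mu> \<alpha> \<beta> x + b * dsol V \<mu> \<gamma> \<delta> x"
    by simp_all
qed

lemma
  shows sol_lincomb: "sol V \<mu> \<alpha> \<beta> x = \<alpha> * sol V \<mu> 1 0 x + \<beta> * sol V \<mu> 0 1 x"
    and dsol_lincomb: "dsol V \<mu> \<alpha> \<beta> x = \<alpha> * dsol V \<mu> 1 0 x + \<beta> * dsol V \<mu> 0 1 x"
  using sol_combine[of V \<mu> \<alpha> 1 \<beta> 0 0 1 x] dsol_combine[of V \<mu> \<alpha> 1 \<beta> 0 0 1 x] by simp_all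

section \<open>The Hill discriminant, the trace of the monodromy matrix, as an entire
  function\<close>

definition disc :: "real \<Rightarrow> complex \<Rightarrow> complex" where
  "disc V \<mu> = sol V \<mu> 1 0 pi + dsol V \<mu> 0 1 pi"

lemma has_real_derivative_cmod_power2:
  assumes "(y has_vector_derivative d) (at x)"
  shows "((\<lambda>x. (cmod (y x))\<^sup>2) has_real_derivative 2 * Re (cnj (y x) * d)) (at x)"
proof -
  have *: "((\<lambda>x. Re (y x)) has_real_derivative Re d) (at x)" "((\<lambda>x. Im (y x)) has_real_derivative Im d) (at x)"
    using assms bounded_linear.has_vector_derivative[OF bounded_linear_Re assms]
      bounded_linear.has_vector_derivative[OF bounded_linear_Im assms]
    by (simp_all add: has_real_derivative_iff_has_vector_derivative)
  show ?thesis
    unfolding cmod_power2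
    by (rule derivative_eq_intros * refl)+ (simp add: algebra_simps)
qed

text \<open>The left-hand side is conserved by \<open>y'' = - k\<^sup>2 y\<close>, so its growth is
  governed by the perturbation \<open>p + k\<^sup>2\<close> alone. The factor \<open>1 / k\<close>
  in the rate makes the bound uniform at \<open>\<mu> = k\<^sup>2\<close>; with \<open>k = 1\<close>
  it gives local bounds in \<mu>.\<close>

lemma energy_bound:
  assumes ode: "ode_on UNIV p (\<lambda>_. 0) y y1" and k: "k > 0"
    and Q: "\<And>x. cmod (p x + of_real (k\<^sup>2)) \<le> Q" and x: "0 \<le> x"
  shows "(cmod (y1 x))\<^sup>2 + k\<^sup>2 * (cmod (y x))\<^sup>2 \<le> exp (Q / k * x) * ((cmod (y1 0))\<^sup>2 + k\<^sup>2 * (cmod (y 0))\<^sup>2)"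
proof -
  define E where "E x = (cmod (y1 x))\<^sup>2 + k\<^sup>2 * (cmod (y x))\<^sup>2" for x
  define D where "D x = 2 * Re (cnj (y1 x) * ((p x + of_real (k\<^sup>2)) * y x))" for x
  have dE: "(E has_real_derivative D x) (at x)" for x
  proof -
    have o: "(y has_vector_derivative y1 x) (at x)" "(y1 has_vector_derivative p x * y x) (at x)"
      using ode by (simp_all add: ode_on_def)
    have "((\<lambda>x. (cmod (y1 x))\<^sup>2 + k\<^sup>2 * (cmod (y x))\<^sup>2) has_real_derivative
       2 * Re (cnj (y1 x) * (p x * y x)) + k\<^sup>2 * (2 * Re (cnj (y x) * y1 x))) (at x)"
      by (intro DERIV_add DERIV_cmult has_real_derivative_cmod_power2 o)
    \<comment> \<open>The terms in \<open>k\<^sup>2\<close> combine because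
      \<open>cnj (y1 x) * y x\<close> and \<open>cnj (y x) * y1 x\<close> have the same real
      part.\<close>
    moreover have "2 * Re (cnj (y1 x) * (p x * y x)) + k\<^sup>2 * (2 * Re (cnj (y x) * y1 x)) = D x"
      by (simp add: D_def algebra_simps)
    ultimately show ?thesis unfolding E_def[abs_def] by simp
  qed
  have Q0: "Q \<ge> 0" using Q norm_ge_zero order_trans by blast
  have DE: "D x \<le> Q / k * E x" for x
  proof -
    have "D x \<le> 2 * cmod (cnj (y1 x) * ((p x + of_real (k\<^sup>2)) * y x))"
      unfolding D_def by (intro mult_left_mono complex_Re_le_cmod) simp
    also have "\<dots> = cmod (p x + of_real (k\<^sup>2)) * (2 * cmod (y1 x) * cmod (y x))"
      by (simp add: norm_mult del: of_real_power)
    also have "\<dots> \<le> Q * (2 * cmod (y1 x) * cmod (y x))"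
      by (intro mult_right_mono Q) auto
    also have "2 * cmod (y1 x) * cmod (y x) \<le> E x / k"
    proof -
      have "0 \<le> (cmod (y1 x) - k * cmod (y x))\<^sup>2" by simp
      then have "2 * cmod (y1 x) * cmod (y x) * k \<le> E x"
        by (simp add: E_def power2_diff power_mult_distrib mult.commute mult.left_commute)
      then show ?thesis using k by (simp add: pos_le_divide_eq)
    qed
    finally show ?thesis using Q0 by (simp add: mult_left_mono)
  qed
  have "exp (- (Q / k * x)) * E x \<le> exp (- (Q / k * 0)) * E 0"
  proof (rule DERIV_nonpos_imp_nonincreasing[OF x])
    fix u
    have "((\<lambda>x. exp (- (Q / k * x)) * E x) has_real_derivative
       (exp (- (Q / k * u)) * (D u - Q / k * E u))) (at u)"
      using k by (auto intro!: derivative_eq_intros dE simp: algebra_simps)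
    moreover have "exp (- (Q / k * u)) * (D u - Q / k * E u) \<le> 0"
      using DE[of u] by (intro mult_nonneg_nonpos) auto
    ultimately show "\<exists>d. ((\<lambda>x. exp (- (Q / k * x)) * E x) has_real_derivative d) (at u) \<and> d \<le> 0"
      by blast
  qed
  moreover have "u \<le> exp a * v" if "exp (- a) * u \<le> v" for a u v :: real
    using that by (simp add: exp_minus field_simps)
  ultimately have "E x \<le> exp (Q / k * x) * E 0" by simp
  then show ?thesis by (simp add: E_def)
qed

lemma sol_locally_bounded:
  "\<exists>B>0. \<forall>\<mu> x. cmod \<mu> \<le> R \<longrightarrow> x \<in> {0..pi} \<longrightarrow> cmod (sol V \<mu> \<alpha> \<beta> x) \<le> B \<and> cmod (dsol V \<mu> \<alpha> \<beta> x) \<le> B"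
proof -
  define Q where "Q = \<bar>1 + 2 * V\<bar> + \<bar>1 - 2 * V\<bar> + \<bar>R\<bar> + 1"
  define M where "M = exp (Q * pi) * ((cmod \<beta>)\<^sup>2 + (cmod \<alpha>)\<^sup>2) + 1"
  have M: "M > 0" unfolding M_def by (intro add_nonneg_pos) auto
  have "cmod (sol V \<mu> \<alpha> \<beta> x) \<le> sqrt M \<and> cmod (dsol V \<mu> \<alpha> \<beta> x) \<le> sqrt M"
    if "cmod \<mu> \<le> R" "x \<in> {0..pi}" for \<mu> x
  proof -
    have "cmod ((q_pot V x - \<mu>) + of_real (1\<^sup>2)) \<le> Q" for x
    proof -
      have "cmod ((q_pot V x - \<mu>) + of_real (1\<^sup>2)) \<le> cmod (q_pot V x) + cmod \<mu> + 1"
        by (intro norm_triangle_mono norm_triangle_ineq4) auto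
      then show ?thesis using cmod_q_pot_le[of V x] that(1) by (simp add: Q_def)
    qed
    from energy_bound[OF ode_on_sol _ this, of x] that(2)
    have "(cmod (dsol V \<mu> \<alpha> \<beta> x))\<^sup>2 + (cmod (sol V \<mu> \<alpha> \<beta> x))\<^sup>2 \<le> exp (Q * x) * ((cmod \<beta>)\<^sup>2 + (cmod \<alpha>)\<^sup>2)"
      by simp
    also have "\<dots> \<le> exp (Q * pi) * ((cmod \<beta>)\<^sup>2 + (cmod \<alpha>)\<^sup>2)"
      using that(2) by (intro mult_right_mono) (auto simp: Q_def intro!: mult_left_mono)
    finally have "(cmod (dsol V \<mu> \<alpha> \<beta> x))\<^sup>2 + (cmod (sol V \<mu> \<alpha> \<beta> x))\<^sup>2 \<le> M"
      by (simp add: M_def)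
    then show ?thesis
      by (smt (verit) real_le_rsqrt zero_le_power2)
  qed
  then show ?thesis using M by (intro exI[of _ "sqrt M"]) auto
qed

lemma integral_sol_mult:
  assumes "x \<ge> 0"
  shows "(\<nu> - \<mu>) * integral {0..x} (\<lambda>s. sol V \<nu> \<alpha> \<beta> s * sol V \<mu> \<gamma> \<delta> s) =
    (sol V \<nu> \<alpha> \<beta> x * dsol V \<mu> \<gamma> \<delta> x - dsol V \<nu> \<alpha> \<beta> x * sol V \<mu> \<gamma> \<delta> x) - (\<alpha> * \<delta> - \<beta> * \<gamma>)"
proof -
  have "((\<lambda>s. (\<nu> - \<mu>) * (sol V \<nu> \<alpha> \<beta> s * sol V \<mu> \<gamma> \<delta> s)) has_integral
    (sol V \<nu> \<alpha> \<beta> x * dsol V \<mu> \<gamma> \<delta> x - dsol V \<nu> \<alpha> \<beta> x * sol V \<mu> \<gamma> \<delta> x) - (\<alpha> * \<delta> - \<beta> * \<gamma>)) {0..x}"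
    using wronskian_has_integral[OF ode_on_sol[of V \<nu> \<alpha> \<beta>] ode_on_sol[of V \<mu> \<gamma> \<delta>] assms] by simp
  from integral_unique[OF this] show ?thesis by simp
qed

text \<open>The solution at \<nu> is expanded in the fundamental pair at \<mu> by Cramer's rule, its
  Wronskians with that pair coming from \<open>integral_sol_mult\<close>. The explicit factor
  \<open>\<nu> - \<mu>\<close> yields Lipschitz dependence on the parameter and then
  differentiability.\<close>

lemma
  assumes "x \<ge> 0"
  shows sol_diff: "sol V \<nu> \<alpha> \<beta> x - sol V \<mu> \<alpha> \<beta> x =
      (sol V \<mu> 1 0 x * integral {0..x} (\<lambda>s. sol V \<nu> \<alpha> \<beta> s * sol V \<mu> 0 1 s)
      - sol V \<mu> 0 1 x * integral {0..x} (\<lambda>s. sol V \<nu> \<alpha> \<beta> s * sol V \<mu> 1 0 s)) * (\<nu> - \<mu>)" (is ?A)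
    and dsol_diff: "dsol V \<nu> \<alpha> \<beta> x - dsol V \<mu> \<alpha> \<beta> x =
      (dsol V \<mu> 1 0 x * integral {0..x} (\<lambda>s. sol V \<nu> \<alpha> \<beta> s * sol V \<mu> 0 1 s)
      - dsol V \<mu> 0 1 x * integral {0..x} (\<lambda>s. sol V \<nu> \<alpha> \<beta> s * sol V \<mu> 1 0 s)) * (\<nu> - \<mu>)" (is ?B)
proof -
  let ?y = "sol V \<nu> \<alpha> \<beta> x" and ?y1 = "dsol V \<nu> \<alpha> \<beta> x"
  let ?c = "sol V \<mu> 1 0 x" and ?c1 = "dsol V \<mu> 1 0 x" and ?s = "sol V \<mu> 0 1 x" and ?s1 = "dsol V \<mu> 0 1 x"
  let ?I = "integral {0..x} (\<lambda>s. sol V \<nu> \<alpha> \<beta> s * sol V \<mu> 0 1 s)"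
  let ?J = "integral {0..x} (\<lambda>s. sol V \<nu> \<alpha> \<beta> s * sol V \<mu> 1 0 s)"
  have w: "?c * ?s1 - ?c1 * ?s = 1" by (rule wronskian_fundamental)
  have I: "?I * (\<nu> - \<mu>) = (?y * ?s1 - ?y1 * ?s) - \<alpha>"
    using integral_sol_mult[OF assms, of \<nu> \<mu> V \<alpha> \<beta> 0 1] by (simp add: mult.commute)
  have J: "?J * (\<nu> - \<mu>) = (?y * ?c1 - ?y1 * ?c) + \<beta>"
    using integral_sol_mult[OF assms, of \<nu> \<mu> V \<alpha> \<beta> 1 0] by (simp add: mult.commute)
  have "?y - sol V \<mu> \<alpha> \<beta> x = ?y * (?c * ?s1 - ?c1 * ?s) - (\<alpha> * ?c + \<beta> * ?s)"
    unfolding w sol_lincomb[of V \<mu> \<alpha> \<beta>] by simp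
  also have "\<dots> = ?c * (?I * (\<nu> - \<mu>)) - ?s * (?J * (\<nu> - \<mu>))"
    unfolding I J by (simp add: algebra_simps)
  finally show ?A by (simp add: algebra_simps)
  have "?y1 - dsol V \<mu> \<alpha> \<beta> x = ?y1 * (?c * ?s1 - ?c1 * ?s) - (\<alpha> * ?c1 + \<beta> * ?s1)"
    unfolding w dsol_lincomb[of V \<mu> \<alpha> \<beta>] by simp
  also have "\<dots> = ?c1 * (?I * (\<nu> - \<mu>)) - ?s1 * (?J * (\<nu> - \<mu>))"
    unfolding I J by (simp add: algebra_simps)
  finally show ?B by (simp add: algebra_simps)
qed

lemma norm_integral_le:
  fixes f :: "real \<Rightarrow> complex"
  assumes "continuous_on {a..b} f" "a \<le> b" "\<And>x. x \<in> {a..b} \<Longrightarrow> cmod (f x) \<le> B"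
  shows "cmod (integral {a..b} f) \<le> B * (b - a)"
  using assms by (intro integral_bound) auto

lemma sol_lipschitz:
  "\<exists>L. \<forall>\<nu> x. cmod (\<nu> - \<mu>) \<le> 1 \<longrightarrow> x \<in> {0..pi} \<longrightarrow> cmod (sol V \<nu> \<alpha> \<beta> x - sol V \<mu> \<alpha> \<beta> x) \<le> L * cmod (\<nu> - \<mu>)"
proof -
  obtain B where B: "B > 0" "\<And>\<nu> x. cmod \<nu> \<le> cmod \<mu> + 1 \<Longrightarrow> x \<in> {0..pi} \<Longrightarrow> cmod (sol V \<nu> \<alpha> \<beta> x) \<le> B"
    using sol_locally_bounded[of "cmod \<mu> + 1" V \<alpha> \<beta>] by blast
  obtain C where C: "C > 0" "\<And>x. x \<in> {0..pi} \<Longrightarrow> cmod (sol V \<mu> 1 0 x) \<le> C"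
    using sol_locally_bounded[of "cmod \<mu>" V 1 0] by blast
  obtain D where D: "D > 0" "\<And>x. x \<in> {0..pi} \<Longrightarrow> cmod (sol V \<mu> 0 1 x) \<le> D"
    using sol_locally_bounded[of "cmod \<mu>" V 0 1] by blast
  have "cmod (sol V \<nu> \<alpha> \<beta> x - sol V \<mu> \<alpha> \<beta> x) \<le> (C * (B * D * pi) + D * (B * C * pi)) * cmod (\<nu> - \<mu>)"
    if l: "cmod (\<nu> - \<mu>) \<le> 1" and x: "x \<in> {0..pi}" for \<nu> x
  proof -
    have "cmod \<nu> \<le> cmod \<mu> + 1" using l norm_triangle_sub[of \<nu> \<mu>] by linarith
    note B' = B(2)[OF this]
    have i: "cmod (integral {0..x} (\<lambda>s. sol V \<nu> \<alpha> \<beta> s * sol V \<mu> \<gamma> \<delta> s)) \<le> B * A * pi"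
      if A: "A > 0" "\<And>x. x \<in> {0..pi} \<Longrightarrow> cmod (sol V \<mu> \<gamma> \<delta> x) \<le> A" for \<gamma> \<delta> A
    proof -
      have "cmod (integral {0..x} (\<lambda>s. sol V \<nu> \<alpha> \<beta> s * sol V \<mu> \<gamma> \<delta> s)) \<le> B * A * (x - 0)"
        using x B' A B(1) by (intro norm_integral_le continuous_intros) (auto simp: norm_mult intro!: mult_mono)
      also have "\<dots> \<le> B * A * pi" using x A B(1) by (intro mult_left_mono) auto
      finally show ?thesis .
    qed
    have "cmod (sol V \<nu> \<alpha> \<beta> x - sol V \<mu> \<alpha> \<beta> x) =
        cmod (sol V \<mu> 1 0 x * integral {0..x} (\<lambda>s. sol V \<nu> \<alpha> \<beta> s * sol V \<mu> 0 1 s)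
      - sol V \<mu> 0 1 x * integral {0..x} (\<lambda>s. sol V \<nu> \<alpha> \<beta> s * sol V \<mu> 1 0 s)) * cmod (\<nu> - \<mu>)"
      using x by (subst sol_diff) (auto simp: norm_mult)
    also have "\<dots> \<le> (C * (B * D * pi) + D * (B * C * pi)) * cmod (\<nu> - \<mu>)"
      using B(1) C D x
      by (intro mult_right_mono order_trans[OF norm_triangle_ineq4] add_mono)
        (auto simp: norm_mult intro!: mult_mono i)
    finally show ?thesis .
  qed
  then show ?thesis by blast
qed

text \<open>The difference quotients in \<nu> are combinations of such integrals, so their
  continuity at \<mu> is what turns them into derivatives.\<close>

lemma isCont_integral_sol_mult:
  assumes z: "continuous_on {0..pi} z"
  shows "isCont (\<lambda>\<nu>. integral {0..pi} (\<lambda>x. sol V \<nu> \<alpha> \<beta> x * z x)) \<mu>"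
proof -
  let ?G = "\<lambda>\<nu>. integral {0..pi} (\<lambda>x. sol V \<nu> \<alpha> \<beta> x * z x)"
  obtain L where L: "\<And>\<nu> x. cmod (\<nu> - \<mu>) \<le> 1 \<Longrightarrow> x \<in> {0..pi} \<Longrightarrow>
      cmod (sol V \<nu> \<alpha> \<beta> x - sol V \<mu> \<alpha> \<beta> x) \<le> L * cmod (\<nu> - \<mu>)"
    using sol_lipschitz by blast
  obtain B where B: "B > 0" "\<And>x. x \<in> {0..pi} \<Longrightarrow> cmod (z x) \<le> B"
    using compact_imp_bounded[OF compact_continuous_image[OF z]]
    by (auto simp: bounded_pos)
  have b: "cmod (?G \<nu> - ?G \<mu>) \<le> L * cmod (\<nu> - \<mu>) * B * pi" if l: "cmod (\<nu> - \<mu>) \<le> 1" for \<nu>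
  proof -
    have "?G \<nu> - ?G \<mu> = integral {0..pi} (\<lambda>x. sol V \<nu> \<alpha> \<beta> x * z x - sol V \<mu> \<alpha> \<beta> x * z x)"
      by (intro integral_diff[symmetric] integrable_continuous_real continuous_intros z)
    also have "cmod \<dots> \<le> L * cmod (\<nu> - \<mu>) * B * (pi - 0)"
    proof (rule norm_integral_le)
      fix x assume x: "x \<in> {0..pi}"
      have "cmod (sol V \<nu> \<alpha> \<beta> x * z x - sol V \<mu> \<alpha> \<beta> x * z x) = cmod (sol V \<nu> \<alpha> \<beta> x - sol V \<mu> \<alpha> \<beta> x) * cmod (z x)"
        by (simp add: norm_mult flip: left_diff_distrib)
      also have "\<dots> \<le> L * cmod (\<nu> - \<mu>) * B"
        using order_trans[OF norm_ge_zero L[OF l x]] B(1)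
        by (intro mult_mono L[OF l x] B(2) x) auto
      finally show "cmod (sol V \<nu> \<alpha> \<beta> x * z x - sol V \<mu> \<alpha> \<beta> x * z x) \<le> L * cmod (\<nu> - \<mu>) * B" .
    qed (intro continuous_intros z, simp)
    finally show ?thesis by simp
  qed
  have "((\<lambda>\<nu>. ?G \<nu> - ?G \<mu>) \<longlongrightarrow> 0) (at \<mu>)"
  proof (rule Lim_null_comparison)
    show "\<forall>\<^sub>F \<nu> in at \<mu>. norm (?G \<nu> - ?G \<mu>) \<le> L * cmod (\<nu> - \<mu>) * B * pi"
      unfolding eventually_at using b by (intro exI[of _ 1]) (auto simp: dist_norm)
    have "((\<lambda>\<nu>. L * cmod (\<nu> - \<mu>) * B * pi) \<longlongrightarrow> L * cmod (\<mu> - \<mu>) * B * pi) (at \<mu>)"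
      by (intro tendsto_intros)
    then show "((\<lambda>\<nu>. L * cmod (\<nu> - \<mu>) * B * pi) \<longlongrightarrow> 0) (at \<mu>)" by simp
  qed
  then show ?thesis by (simp add: isCont_def LIM_zero_iff)
qed

text \<open>By \<open>sol_diff\<close> and \<open>dsol_diff\<close> the increment of
  \<open>disc V\<close> is \<open>g \<nu> * (\<nu> - \<mu>)\<close> with \<open>g\<close> continuous
  at \<mu>, which is Caratheodory's form of differentiability.\<close>

lemma disc_field_differentiable: "disc V field_differentiable (at \<mu>)"
proof -
  let ?I = "\<lambda>\<nu> \<alpha> \<beta> \<gamma> \<delta>. integral {0..pi} (\<lambda>s. sol V \<nu> \<alpha> \<beta> s * sol V \<mu> \<gamma> \<delta> s)"
  define g where "g \<nu> = (sol V \<mu> 1 0 pi * ?I \<nu> 1 0 0 1 - sol V \<mu> 0 1 pi * ?I \<nu> 1 0 1 0) +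
    (dsol V \<mu> 1 0 pi * ?I \<nu> 0 1 0 1 - dsol V \<mu> 0 1 pi * ?I \<nu> 0 1 1 0)" for \<nu>
  have "disc V \<nu> - disc V \<mu> = (sol V \<nu> 1 0 pi - sol V \<mu> 1 0 pi) + (dsol V \<nu> 0 1 pi - dsol V \<mu> 0 1 pi)" for \<nu>
    by (simp add: disc_def)
  also have "\<dots> \<nu> = g \<nu> * (\<nu> - \<mu>)" for \<nu>
    unfolding sol_diff[OF pi_ge_zero, of V \<nu> _ _ \<mu>] dsol_diff[OF pi_ge_zero, of V \<nu> _ _ \<mu>] g_def
    by (simp add: algebra_simps)
  finally have "\<forall>\<nu>. disc V \<nu> - disc V \<mu> = g \<nu> * (\<nu> - \<mu>)" by simp
  moreover have "isCont g \<mu>"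
    unfolding g_def by (intro continuous_intros isCont_integral_sol_mult)
  ultimately have "(disc V has_field_derivative g \<mu>) (at \<mu>)" by (auto simp: CARAT_DERIV)
  then show ?thesis by (auto simp: field_differentiable_def)
qed

lemma holomorphic_on_disc: "disc V holomorphic_on S"
  by (simp add: holomorphic_on_def disc_field_differentiable field_differentiable_at_within)

text \<open>For \<open>M\<close> the monodromy matrix and vectors \<open>v, w\<close> one has
  \<open>tr M * det (v, w) = det (M v, w) + det (v, M w)\<close>; both determinants on the right are evaluated by
  Lagrange's identity when \<open>v\<close>, \<open>w\<close> are the data of Floquet solutions at \<open>\<mu>\<close>.\<close>

lemma deriv_disc_floquet:
  assumes \<rho>: "\<rho> \<noteq> 0"
    and y: "sol V \<mu> \<alpha> \<beta> pi = \<rho> * \<alpha>" "dsol V \<mu> \<alpha> \<beta> pi = \<rho> * \<beta>"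
    and z: "sol V \<mu> \<gamma> \<delta> pi = \<gamma> / \<rho>" "dsol V \<mu> \<gamma> \<delta> pi = \<delta> / \<rho>"
  shows "deriv (disc V) \<mu> * (\<alpha> * \<delta> - \<beta> * \<gamma>) =
    (\<rho> - 1 / \<rho>) * integral {0..pi} (\<lambda>x. sol V \<mu> \<alpha> \<beta> x * sol V \<mu> \<gamma> \<delta> x)"
proof -
  define A where "A \<nu> = integral {0..pi} (\<lambda>x. sol V \<nu> \<alpha> \<beta> x * sol V \<mu> \<gamma> \<delta> x)" for \<nu>
  define B where "B \<nu> = integral {0..pi} (\<lambda>x. sol V \<nu> \<gamma> \<delta> x * sol V \<mu> \<alpha> \<beta> x)" for \<nu>
  define w where "w = \<alpha> * \<delta> - \<beta> * \<gamma>"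
  have AB: "A \<mu> = B \<mu>" by (simp add: A_def B_def mult.commute)
  \<comment> \<open>In each determinant only the propagated vector depends on \<nu>, its partner
    being read off at \<mu>. The integrals \<open>A\<close> and \<open>B\<close> agree at
    \<open>\<nu> = \<mu>\<close>, whence the factor \<open>\<rho> - 1 / \<rho>\<close> in the
    limit.\<close>
  have tr: "disc V \<nu> * w = (\<rho> + 1 / \<rho>) * w + (\<rho> * A \<nu> - 1 / \<rho> * B \<nu>) * (\<nu> - \<mu>)" for \<nu>
  proof -
    have 1: "\<rho> * ((\<nu> - \<mu>) * A \<nu> + w) = sol V \<nu> \<alpha> \<beta> pi * \<delta> - dsol V \<nu> \<alpha> \<beta> pi * \<gamma>"
      unfolding A_def integral_sol_mult[OF pi_ge_zero] z w_def using \<rho> by (simp add: field_simps)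
    have 2: "1 / \<rho> * (w - (\<nu> - \<mu>) * B \<nu>) = \<alpha> * dsol V \<nu> \<gamma> \<delta> pi - \<beta> * sol V \<nu> \<gamma> \<delta> pi"
      unfolding B_def integral_sol_mult[OF pi_ge_zero] y w_def using \<rho> by (simp add: field_simps)
    have "disc V \<nu> * w = (sol V \<nu> \<alpha> \<beta> pi * \<delta> - dsol V \<nu> \<alpha> \<beta> pi * \<gamma>) +
        (\<alpha> * dsol V \<nu> \<gamma> \<delta> pi - \<beta> * sol V \<nu> \<gamma> \<delta> pi)"
      unfolding disc_def w_def sol_lincomb[of V \<nu> \<alpha> \<beta>] sol_lincomb[of V \<nu> \<gamma> \<delta>]
        dsol_lincomb[of V \<nu> \<alpha> \<beta>] dsol_lincomb[of V \<nu> \<gamma> \<delta>] by (simp add: algebra_simps)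
    then show ?thesis unfolding 1[symmetric] 2[symmetric] by (simp add: algebra_simps diff_divide_distrib)
  qed
  have "\<forall>\<nu>. disc V \<nu> * w - disc V \<mu> * w = (\<rho> * A \<nu> - 1 / \<rho> * B \<nu>) * (\<nu> - \<mu>)"
    using tr by simp
  moreover have "isCont (\<lambda>\<nu>. \<rho> * A \<nu> - 1 / \<rho> * B \<nu>) \<mu>"
    unfolding A_def B_def by (intro continuous_intros isCont_integral_sol_mult)
  ultimately have "((\<lambda>\<nu>. disc V \<nu> * w) has_field_derivative (\<rho> * A \<mu> - 1 / \<rho> * B \<mu>)) (at \<mu>)"
    unfolding CARAT_DERIV by (intro exI[of _ "\<lambda>\<nu>. \<rho> * A \<nu> - 1 / \<rho> * B \<nu>"]) auto
  moreover have "((\<lambda>\<nu>. disc V \<nu> * w) has_field_derivative deriv (disc V) \<mu> * w) (at \<mu>)"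
    by (intro DERIV_cmult_right) (simp add: disc_field_differentiable field_differentiable_derivI)
  ultimately have "deriv (disc V) \<mu> * w = \<rho> * A \<mu> - 1 / \<rho> * B \<mu>"
    using DERIV_unique by blast
  then show ?thesis by (simp add: w_def AB[symmetric] A_def algebra_simps)
qed

section \<open>Floquet solutions as eigenvectors of the monodromy matrix\<close>

lemma floquet_exists:
  assumes "disc V \<mu> = \<rho> + 1 / \<rho>" "\<rho> \<noteq> 0"
  shows "\<exists>\<alpha> \<beta>. (\<alpha> \<noteq> 0 \<or> \<beta> \<noteq> 0) \<and> sol V \<mu> \<alpha> \<beta> pi = \<rho> * \<alpha> \<and> dsol V \<mu> \<alpha> \<beta> pi = \<rho> * \<beta>"
proof -
  define a b c d where "a = sol V \<mu> 1 0 pi" and "b = sol V \<mu> 0 1 pi"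
    and "c = dsol V \<mu> 1 0 pi" and "d = dsol V \<mu> 0 1 pi"
  have det: "a * d - c * b = 1" unfolding a_def b_def c_def d_def by (rule wronskian_fundamental)
  have "(a + d) * \<rho> = \<rho> * \<rho> + 1" using assms by (simp add: disc_def a_def d_def field_simps)
  then have char: "(\<rho> - a) * (\<rho> - d) = b * c"
    using det by (simp add: algebra_simps)
  have s: "sol V \<mu> \<alpha> \<beta> pi = \<alpha> * a + \<beta> * b" "dsol V \<mu> \<alpha> \<beta> pi = \<alpha> * c + \<beta> * d" for \<alpha> \<beta>
    unfolding a_def b_def c_def d_def by (rule sol_lincomb dsol_lincomb)+
  \<comment> \<open>Up to sign, (b, \<rho> - a) and (\<rho> - d, c) are the columns of the adjugate
    of the monodromy matrix minus \<rho>; a nonzero one is an eigenvector, and if both vanish the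
    matrix is \<rho> times the identity.\<close>
  consider "b \<noteq> 0 \<or> \<rho> \<noteq> a" | "c \<noteq> 0 \<or> \<rho> \<noteq> d" | "b = 0" "\<rho> = a" "c = 0" "\<rho> = d" by blast
  then show ?thesis
  proof cases
    case 1
    then show ?thesis using char unfolding s
      by (intro exI[of _ b] exI[of _ "\<rho> - a"]) (auto simp: algebra_simps)
  next
    case 2
    then show ?thesis using char unfolding s
      by (intro exI[of _ "\<rho> - d"] exI[of _ c]) (auto simp: algebra_simps)
  next
    case 3
    then show ?thesis unfolding s by (intro exI[of _ 1] exI[of _ 0]) auto
  qed
qed

lemma floquet_disc:
  assumes "\<alpha> \<noteq> 0 \<or> \<beta> \<noteq> 0" "sol V \<mu> \<alpha> \<beta> pi = \<rho> * \<alpha>" "dsol V \<mu> \<alpha> \<beta> pi = \<rho> * \<beta>" "\<rho> \<noteq> 0"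
  shows "disc V \<mu> = \<rho> + 1 / \<rho>"
proof -
  define a b c d where "a = sol V \<mu> 1 0 pi" and "b = sol V \<mu> 0 1 pi"
    and "c = dsol V \<mu> 1 0 pi" and "d = dsol V \<mu> 0 1 pi"
  have det: "a * d - c * b = 1" unfolding a_def b_def c_def d_def by (rule wronskian_fundamental)
  have "\<alpha> * a + \<beta> * b = \<rho> * \<alpha>" "\<alpha> * c + \<beta> * d = \<rho> * \<beta>"
    using assms(2,3) unfolding a_def b_def c_def d_def by (simp_all add: sol_lincomb[of V \<mu> \<alpha>] dsol_lincomb[of V \<mu> \<alpha>])
  then have e: "\<beta> * b = (\<rho> - a) * \<alpha>" "\<alpha> * c = (\<rho> - d) * \<beta>" by (simp_all add: algebra_simps)
  have "((\<rho> - a) * (\<rho> - d) - b * c) * \<alpha> = (\<rho> - d) * (\<beta> * b) - b * (\<alpha> * c)"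
    unfolding e(1) by (simp add: algebra_simps)
  also have "\<dots> = 0" unfolding e(2) by (simp add: algebra_simps)
  finally have 1: "((\<rho> - a) * (\<rho> - d) - b * c) * \<alpha> = 0" .
  have "((\<rho> - a) * (\<rho> - d) - b * c) * \<beta> = (\<rho> - a) * (\<alpha> * c) - c * (\<beta> * b)"
    unfolding e(2) by (simp add: algebra_simps)
  also have "\<dots> = 0" unfolding e(1) by (simp add: algebra_simps)
  finally have "(\<rho> - a) * (\<rho> - d) - b * c = 0" using 1 assms(1) by auto
  then have "(a + d) * \<rho> = \<rho> * \<rho> + 1" using det by (simp add: algebra_simps)
  then show ?thesis using assms(4) by (simp add: disc_def a_def[symmetric] d_def[symmetric] field_simps)
qed

text \<open>Eigenvectors to distinct eigenvalues are independent: a vanishing determinant would make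
  (\<gamma>, \<delta>) a multiple of (\<alpha>, \<beta>) and force equal multipliers.\<close>

lemma floquet_wronskian:
  assumes "\<rho> \<noteq> 0" "\<rho> \<noteq> 1 / \<rho>"
    and y: "\<alpha> \<noteq> 0 \<or> \<beta> \<noteq> 0" "sol V \<mu> \<alpha> \<beta> pi = \<rho> * \<alpha>" "dsol V \<mu> \<alpha> \<beta> pi = \<rho> * \<beta>"
    and z: "\<gamma> \<noteq> 0 \<or> \<delta> \<noteq> 0" "sol V \<mu> \<gamma> \<delta> pi = \<gamma> / \<rho>" "dsol V \<mu> \<gamma> \<delta> pi = \<delta> / \<rho>"
  shows "\<alpha> * \<delta> - \<beta> * \<gamma> \<noteq> 0"
proof
  assume w: "\<alpha> * \<delta> - \<beta> * \<gamma> = 0"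
  obtain k where k: "\<gamma> = k * \<alpha>" "\<delta> = k * \<beta>"
  proof (cases "\<alpha> = 0")
    case True
    then show ?thesis using that[of "\<delta> / \<beta>"] y(1) w by auto
  next
    case False
    then show ?thesis using that[of "\<gamma> / \<alpha>"] w by (auto simp: field_simps)
  qed
  have "sol V \<mu> \<gamma> \<delta> pi = k * sol V \<mu> \<alpha> \<beta> pi" "dsol V \<mu> \<gamma> \<delta> pi = k * dsol V \<mu> \<alpha> \<beta> pi"
    using sol_combine[of V \<mu> k \<alpha> 0 0 \<beta> 0 pi] dsol_combine[of V \<mu> k \<alpha> 0 0 \<beta> 0 pi] by (simp_all add: k)
  then have "1 / \<rho> * \<gamma> = \<rho> * \<gamma>" "1 / \<rho> * \<delta> = \<rho> * \<delta>"
    unfolding y z by (simp_all add: k algebra_simps)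
  then show False using assms(2) z(1) by (metis mult_right_cancel)
qed

lemma floquet_translate:
  assumes "sol V \<mu> \<alpha> \<beta> pi = \<rho> * \<alpha>" "dsol V \<mu> \<alpha> \<beta> pi = \<rho> * \<beta>"
  shows "sol V \<mu> \<alpha> \<beta> (x + pi) = \<rho> * sol V \<mu> \<alpha> \<beta> x \<and> dsol V \<mu> \<alpha> \<beta> (x + pi) = \<rho> * dsol V \<mu> \<alpha> \<beta> x"
proof -
  have "ode_on UNIV (\<lambda>x. q_pot V x - \<mu>) (\<lambda>_. 0) (\<lambda>x. sol V \<mu> \<alpha> \<beta> (x + pi)) (\<lambda>x. dsol V \<mu> \<alpha> \<beta> (x + pi))"
    by (rule ode_on_shift[OF ode_on_sol]) simp
  from ode_on_eq_sol[OF this, of x]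
  have "sol V \<mu> \<alpha> \<beta> (x + pi) = sol V \<mu> (\<rho> * \<alpha>) (\<rho> * \<beta>) x \<and> dsol V \<mu> \<alpha> \<beta> (x + pi) = dsol V \<mu> (\<rho> * \<alpha>) (\<rho> * \<beta>) x"
    by (simp add: assms)
  then show ?thesis
    using sol_combine[of V \<mu> \<rho> \<alpha> 0 0 \<beta> 0 x] dsol_combine[of V \<mu> \<rho> \<alpha> 0 0 \<beta> 0 x] by simp
qed

section \<open>The discriminant on the real line\<close>

lemma cnj_q_pot: "cnj (q_pot V (- x)) = q_pot V x"
  by (simp add: q_pot_cis cis_cnj)

lemma has_vector_derivative_reflect:
  assumes "(h has_vector_derivative D) (at (- x))"
  shows "((\<lambda>x. h (- x)) has_vector_derivative - D) (at x)"
proof -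
  have "(uminus has_vector_derivative (-1::real)) (at x)"
    by (auto intro!: derivative_eq_intros)
  from vector_diff_chain_at[OF this assms] show ?thesis by (simp add: o_def)
qed

text \<open>PT symmetry: \<open>cnj_q_pot\<close> shows that reflection followed by conjugation maps
  solutions for a real parameter to solutions, and it fixes the data (1, 0).\<close>

lemma sol_reflect: "sol V (of_real s) 1 0 (- x) = cnj (sol V (of_real s) 1 0 x)"
proof -
  let ?y = "sol V (of_real s) 1 0" and ?y1 = "dsol V (of_real s) 1 0"
  have o: "(?y has_vector_derivative ?y1 x) (at x)"
    "(?y1 has_vector_derivative (q_pot V x - of_real s) * ?y x) (at x)" for x
    using ode_on_sol[of V "of_real s" 1 0] by (simp_all add: ode_on_def)
  have "((\<lambda>x. cnj (?y (- x))) has_vector_derivative - cnj (?y1 (- x))) (at x)" for x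
    using has_vector_derivative_cnj[OF has_vector_derivative_reflect[OF o(1)]] by simp
  moreover have "((\<lambda>x. - cnj (?y1 (- x))) has_vector_derivative (q_pot V x - of_real s) * cnj (?y (- x))) (at x)" for x
    using has_vector_derivative_minus[OF has_vector_derivative_cnj[OF has_vector_derivative_reflect[OF o(2)]], of x]
    by (simp add: cnj_q_pot)
  ultimately have "ode_on UNIV (\<lambda>x. q_pot V x - of_real s) (\<lambda>_. 0) (\<lambda>x. cnj (?y (- x))) (\<lambda>x. - cnj (?y1 (- x)))"
    by (simp add: ode_on_def)
  from ode_on_unique(1)[OF this, of 1 0] have "?y = (\<lambda>x. cnj (?y (- x)))" by simp
  from fun_cong[OF this, of "-x"] show ?thesis by simp
qed

text \<open>The Wronskian of the translate \<open>sol V \<mu> 1 0 (x - pi)\<close> with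
  \<open>sol V \<mu> 0 1\<close> is evaluated at pi and at 0. Together with
  \<open>sol_reflect\<close> it presents the trace for a real parameter as a number plus its
  conjugate.\<close>

lemma sol_minus_pi: "sol V \<mu> 1 0 (- pi) = dsol V \<mu> 0 1 pi"
proof -
  have q: "q_pot V (x - pi) = q_pot V x" for x
    using q_pot_periodic[of V "x - pi"] by simp
  have "ode_on UNIV (\<lambda>x. q_pot V x - \<mu>) (\<lambda>_. 0) (\<lambda>x. sol V \<mu> 1 0 (x + - pi)) (\<lambda>x. dsol V \<mu> 1 0 (x + - pi))"
    by (rule ode_on_shift[OF ode_on_sol]) (simp add: q)
  from wronskian_const[OF this ode_on_sol convex_UNIV, of pi 0 0 1] show ?thesis by simp
qed

lemma disc_of_real: "disc V (of_real s) = of_real (Re (disc V (of_real s)))"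
  using complex_add_cnj[of "sol V (of_real s) 1 0 pi"]
  by (simp add: disc_def sol_minus_pi[symmetric] sol_reflect)

section \<open>Exponentials on an interval of length pi and uniqueness of Fourier
  coefficients\<close>

lemma has_vector_derivative_cis_linear:
  "((\<lambda>x. cis (a * x + b)) has_vector_derivative (\<i> * of_real a * cis (a * x + b))) (at x within S)"
proof -
  have "((\<lambda>z. exp (\<i> * (of_real a * z + of_real b))) has_field_derivative
      exp (\<i> * (of_real a * of_real x + of_real b)) * (\<i> * of_real a)) (at (of_real x))"
    by (auto intro!: derivative_eq_intros)
  from has_vector_derivative_real_field[OF this] show ?thesis
    by (simp add: cis_conv_exp mult.commute)
qed

lemma continuous_on_cis_linear [continuous_intros]:
  "continuous_on S (\<lambda>x. cis (a * x + b))"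
  unfolding continuous_on_eq_continuous_within
  using has_vector_derivative_continuous[OF has_vector_derivative_cis_linear] by blast

lemma integral_cis_period:
  "integral {0..pi} (\<lambda>x. cis (2 * of_int k * x + b)) = (if k = 0 then of_real pi * cis b else 0)"
proof (cases "k = 0")
  case False
  have "((\<lambda>x. cis (2 * of_int k * x + b)) has_integral
      cis (2 * of_int k * pi + b) / (\<i> * of_real (2 * of_int k)) - cis (2 * of_int k * 0 + b) / (\<i> * of_real (2 * of_int k))) {0..pi}"
  proof (rule fundamental_theorem_of_calculus)
    fix x :: real
    have "((\<lambda>x. cis (2 * of_int k * x + b) * (1 / (\<i> * of_real (2 * of_int k)))) has_vector_derivative
       \<i> * of_real (2 * of_int k) * cis (2 * of_int k * x + b) * (1 / (\<i> * of_real (2 * of_int k)))) (at x within {0..pi})"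
      by (intro has_vector_derivative_mult_left has_vector_derivative_cis_linear)
    then show "((\<lambda>x. cis (2 * of_int k * x + b) / (\<i> * of_real (2 * of_int k))) has_vector_derivative
        cis (2 * of_int k * x + b)) (at x within {0..pi})"
      using False by simp
  qed simp
  moreover have "cis (2 * of_int k * pi + b) = cis b"
  proof -
    have "cis (2 * of_int k * pi) = 1"
      using cis_multiple_2pi[of "of_int k"] by (simp add: mult.commute mult.left_commute)
    then show ?thesis by (simp flip: cis_mult)
  qed
  ultimately show ?thesis using False by (simp add: integral_unique)
qed (simp add: scaleR_conv_of_real)

lemma has_vector_derivative_imp_slope:
  fixes f :: "real \<Rightarrow> complex"
  assumes "(f has_vector_derivative d) (at x)"
  shows "((\<lambda>u. (f u - f x) / of_real (u - x)) \<longlongrightarrow> d) (at x)"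
  using assms unfolding has_vector_derivative_complex_iff has_field_derivative_iff
  by (simp add: tendsto_complex_iff)

text \<open>Bessel's inequality for the orthogonal exponentials \<open>cis (2 * k * x - b k)\<close>
  when all coefficients equal \<gamma>. With \<open>K\<close> arbitrarily large it forces \<gamma> =
  0; this is the form in which the decay of Fourier coefficients enters.\<close>

lemma bessel_constant:
  assumes g: "continuous_on {0..pi} g" and K: "finite K"
    and G: "\<And>k. k \<in> K \<Longrightarrow> integral {0..pi} (\<lambda>x. g x * cis (2 * of_int (- k) * x + b k)) = \<gamma>"
  shows "real (card K) * (cmod \<gamma>)\<^sup>2 \<le> pi * integral {0..pi} (\<lambda>x. (cmod (g x))\<^sup>2)"
proof -
  \<comment> \<open>The orthogonal projection of \<open>g\<close> onto these exponentials, each of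
    squared norm pi; the inequality is the nonnegativity of the integral of
    \<open>(cmod (g x - S x))\<^sup>2\<close>.\<close>
  define S where "S x = (\<gamma> / of_real pi) * (\<Sum>k\<in>K. cis (2 * of_int k * x + - b k))" for x
  have cS: "continuous_on {0..pi} S" unfolding S_def by (intro continuous_intros)
  note ii = integrable_continuous_real
  have cnjS: "cnj (S x) = (cnj \<gamma> / of_real pi) * (\<Sum>k\<in>K. cis (2 * of_int (- k) * x + b k))" for x
    by (simp add: S_def cis_cnj algebra_simps)
  define c where "c = complex_of_real (real (card K) * (cmod \<gamma>)\<^sup>2 / pi)"
  have \<gamma>: "of_nat (card K) * (\<gamma> * cnj \<gamma>) / of_real pi = c"
    by (simp add: c_def complex_norm_square[symmetric])
  have 1: "((\<lambda>x. g x * cnj (S x)) has_integral c) {0..pi}"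
  proof -
    have gk: "((\<lambda>x. g x * cis (2 * of_int (- k) * x + b k)) has_integral \<gamma>) {0..pi}" if "k \<in> K" for k
      unfolding G[OF that, symmetric] by (intro integrable_integral ii continuous_intros g)
    have "((\<lambda>x. (cnj \<gamma> / of_real pi) * (\<Sum>k\<in>K. g x * cis (2 * of_int (- k) * x + b k))) has_integral
        (cnj \<gamma> / of_real pi) * (\<Sum>k\<in>K. \<gamma>)) {0..pi}"
      by (intro has_integral_mult_right has_integral_sum K gk)
    moreover have "(cnj \<gamma> / of_real pi) * (\<Sum>k\<in>K. \<gamma>) = c" using \<gamma> by (simp add: mult_ac)
    moreover have "g x * cnj (S x) = (cnj \<gamma> / of_real pi) * (\<Sum>k\<in>K. g x * cis (2 * of_int (- k) * x + b k))" for x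
      unfolding cnjS sum_distrib_left by (simp only: mult_ac)
    ultimately show ?thesis by (simp only:)
  qed
  have 2: "((\<lambda>x. S x * cnj (S x)) has_integral c) {0..pi}"
  proof -
    have e: "((\<lambda>x. cis (2 * of_int j * x + - b j) * cis (2 * of_int (- k) * x + b k)) has_integral
      (if j = k then of_real pi else 0)) {0..pi}" for j k
    proof -
      have "cis (2 * of_int j * x + - b j) * cis (2 * of_int (- k) * x + b k) = cis (2 * of_int (j - k) * x + (b k - b j))" for x
        by (simp add: cis_mult algebra_simps)
      moreover have "((\<lambda>x. cis (2 * of_int (j - k) * x + (b k - b j))) has_integral
         integral {0..pi} (\<lambda>x. cis (2 * of_int (j - k) * x + (b k - b j)))) {0..pi}"
        by (intro integrable_integral ii continuous_intros)
      ultimately show ?thesis unfolding integral_cis_period by (simp split: if_splits)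
    qed
    have "((\<lambda>x. (\<gamma> / of_real pi) * (cnj \<gamma> / of_real pi) *
         (\<Sum>j\<in>K. \<Sum>k\<in>K. cis (2 * of_int j * x + - b j) * cis (2 * of_int (- k) * x + b k))) has_integral
       (\<gamma> / of_real pi) * (cnj \<gamma> / of_real pi) * (\<Sum>j\<in>K. \<Sum>k\<in>K. if j = k then of_real pi else 0)) {0..pi}"
      by (intro has_integral_mult_right has_integral_sum K e)
    moreover have "(\<gamma> / of_real pi) * (cnj \<gamma> / of_real pi) * (\<Sum>j\<in>K. \<Sum>k\<in>K. if j = k then of_real pi else 0) = c"
      unfolding \<gamma>[symmetric] using K by (simp add: sum.delta)
    moreover have "S x * cnj (S x) = (\<gamma> / of_real pi) * (cnj \<gamma> / of_real pi) *
         (\<Sum>j\<in>K. \<Sum>k\<in>K. cis (2 * of_int j * x + - b j) * cis (2 * of_int (- k) * x + b k))" for x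
      unfolding cnjS unfolding S_def sum_product[symmetric] by (simp only: mult_ac)
    ultimately show ?thesis by (simp only:)
  qed
  have 3: "((\<lambda>x. (cmod (g x))\<^sup>2) has_integral integral {0..pi} (\<lambda>x. (cmod (g x))\<^sup>2)) {0..pi}"
    by (intro integrable_integral ii continuous_intros g)
  have 4: "((\<lambda>x. (cmod (g x - S x))\<^sup>2) has_integral integral {0..pi} (\<lambda>x. (cmod (g x - S x))\<^sup>2)) {0..pi}"
    by (intro integrable_integral ii continuous_intros g cS)
  have "((\<lambda>x. cnj (g x * cnj (S x))) has_integral cnj c) {0..pi}"
    using 1 has_integral_cnj[of "\<lambda>x. g x * cnj (S x)" c] by (simp add: o_def)
  then have 5: "((\<lambda>x. of_real ((cmod (g x))\<^sup>2) - g x * cnj (S x) - (cnj (g x * cnj (S x)) - S x * cnj (S x))) has_integral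
     of_real (integral {0..pi} (\<lambda>x. (cmod (g x))\<^sup>2)) - c - (cnj c - c)) {0..pi}"
    by (intro has_integral_diff has_integral_of_real 1 2 3)
  have e: "of_real ((cmod (g x))\<^sup>2) - g x * cnj (S x) - (cnj (g x * cnj (S x)) - S x * cnj (S x)) =
     of_real ((cmod (g x - S x))\<^sup>2)" for x
    unfolding complex_norm_square by (simp add: algebra_simps)
  have "complex_of_real (integral {0..pi} (\<lambda>x. (cmod (g x - S x))\<^sup>2)) =
     of_real (integral {0..pi} (\<lambda>x. (cmod (g x))\<^sup>2)) - c - (cnj c - c)"
    by (rule has_integral_unique[OF has_integral_of_real[OF 4] 5[unfolded e]])
  also have "\<dots> = of_real (integral {0..pi} (\<lambda>x. (cmod (g x))\<^sup>2) - real (card K) * (cmod \<gamma>)\<^sup>2 / pi)"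
    by (simp add: c_def)
  finally have "integral {0..pi} (\<lambda>x. (cmod (g x - S x))\<^sup>2) =
      integral {0..pi} (\<lambda>x. (cmod (g x))\<^sup>2) - real (card K) * (cmod \<gamma>)\<^sup>2 / pi"
    by (simp only: of_real_eq_iff)
  moreover have "0 \<le> integral {0..pi} (\<lambda>x. (cmod (g x - S x))\<^sup>2)"
    by (intro Henstock_Kurzweil_Integration.integral_nonneg ii continuous_intros g cS) auto
  ultimately have "0 \<le> pi * (integral {0..pi} (\<lambda>x. (cmod (g x))\<^sup>2) - real (card K) * (cmod \<gamma>)\<^sup>2 / pi)"
    by simp
  then show ?thesis by (simp add: right_diff_distrib)
qed

text \<open>Dividing \<open>h - h x0\<close> by \<open>cis (2 * (x - x0)) - 1\<close> turns the Fourier coefficients of \<open>h - h x0\<close>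
  into differences of consecutive coefficients of a continuous function \<open>g\<close>, which tend to zero.\<close>

lemma fourier_zero:
  assumes h: "continuous_on {0..pi} h" and x0: "x0 \<in> {0<..<pi}"
    and d: "(h has_vector_derivative d) (at x0)"
    and c: "\<And>k::int. integral {0..pi} (\<lambda>x. h x * cis (2 * of_int (- k) * x)) = 0"
  shows "h x0 = 0"
proof -
  define e where "e x = cis (2 * x + - 2 * x0) - 1" for x
  \<comment> \<open>The value at \<open>x0\<close> is the limit of the quotient, as \<open>e\<close>
    has derivative \<open>2 * \<i>\<close> there; elsewhere on \<open>{0..pi}\<close> the function
    \<open>e\<close> has no zero because \<open>x0\<close> is interior.\<close>
  define g where "g x = (if x = x0 then d / (2 * \<i>) else (h x - h x0) / e x)" for x
  have e0: "e x \<noteq> 0" if "x \<in> {0..pi}" "x \<noteq> x0" for x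
  proof
    assume "e x = 0"
    then have "cos (2 * x - 2 * x0) = 1" by (simp add: e_def complex_eq_iff)
    then obtain n :: int where n: "2 * x - 2 * x0 = of_int n * 2 * pi" by (auto simp: cos_one_2pi_int)
    then have "x - x0 = of_int n * pi" by simp
    moreover have "\<bar>x - x0\<bar> < 1 * pi" using that x0 by auto
    ultimately have "\<bar>of_int n :: real\<bar> < 1" by (simp add: abs_mult)
    then have "n = 0" by linarith
    then show False using n that by simp
  qed
  have ce: "continuous_on S e" for S unfolding e_def by (intro continuous_intros)
  have gc: "continuous_on {0..pi} g"
    unfolding continuous_on
  proof
    fix x assume x: "x \<in> {0..pi}"
    show "(g \<longlongrightarrow> g x) (at x within {0..pi})"
    proof (cases "x = x0")
      case True
      have "(e has_vector_derivative (\<i> * of_real 2 * cis (2 * x0 + - 2 * x0) - 0)) (at x0)"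
        unfolding e_def
        by (intro has_vector_derivative_diff has_vector_derivative_const has_vector_derivative_cis_linear)
      from has_vector_derivative_imp_slope[OF this]
      have "((\<lambda>u. e u / of_real (u - x0)) \<longlongrightarrow> 2 * \<i>) (at x0)" by (simp add: e_def mult.commute)
      from tendsto_divide[OF has_vector_derivative_imp_slope[OF d] this]
      have "((\<lambda>u. ((h u - h x0) / of_real (u - x0)) / (e u / of_real (u - x0))) \<longlongrightarrow> d / (2 * \<i>)) (at x0)"
        by simp
      then have "(g \<longlongrightarrow> d / (2 * \<i>)) (at x0)"
        by (rule Lim_transform_eventually) (auto simp: eventually_at g_def intro!: exI[of _ 1])
      then show ?thesis using True by (simp add: g_def Lim_at_imp_Lim_at_within)
    next
      case False
      have "((\<lambda>x. (h x - h x0) / e x) \<longlongrightarrow> (h x - h x0) / e x) (at x within {0..pi})"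
        using h ce[of "{0..pi}"] x e0[OF x False] by (intro tendsto_intros) (auto simp: continuous_on)
      then have "(g \<longlongrightarrow> (h x - h x0) / e x) (at x within {0..pi})"
        by (rule Lim_transform_eventually)
          (use False in \<open>auto simp: eventually_at g_def dist_commute intro!: exI[of _ "dist x x0"]\<close>)
      then show ?thesis using False by (simp add: g_def)
    qed
  qed
  \<comment> \<open>The phase \<open>2 * k * x0\<close> makes multiplication by \<open>e\<close> the
    difference of neighbouring exponentials, so \<open>G (k - 1) - G k\<close> is, up to a phase, a
    Fourier coefficient of \<open>h - h x0\<close>; only the constant survives, at
    \<open>k = 0\<close>.\<close>
  define G where "G k = integral {0..pi} (\<lambda>x. g x * cis (2 * of_int (- k) * x + 2 * of_int k * x0))" for k
  have step: "G (k - 1) - G k = (if k = 0 then - h x0 * of_real pi else 0)" for k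
  proof -
    have "G (k - 1) - G k = integral {0..pi} (\<lambda>x. g x * cis (2 * of_int (- (k - 1)) * x + 2 * of_int (k - 1) * x0)
         - g x * cis (2 * of_int (- k) * x + 2 * of_int k * x0))"
      unfolding G_def by (rule integral_diff[symmetric]) (intro integrable_continuous_real continuous_intros gc)+
    also have "\<dots> = integral {0..pi} (\<lambda>x. (h x * cis (2 * of_int (- k) * x)) * cis (2 * of_int k * x0)
       - h x0 * cis (2 * of_int (- k) * x + 2 * of_int k * x0))"
    proof (rule integral_cong)
      fix x assume x: "x \<in> {0..pi}"
      have "cis (2 * of_int (- (k - 1)) * x + 2 * of_int (k - 1) * x0) =
          cis (2 * x + - 2 * x0) * cis (2 * of_int (- k) * x + 2 * of_int k * x0)"
        by (simp add: cis_mult algebra_simps)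
      then have "g x * cis (2 * of_int (- (k - 1)) * x + 2 * of_int (k - 1) * x0)
         - g x * cis (2 * of_int (- k) * x + 2 * of_int k * x0) =
         g x * e x * cis (2 * of_int (- k) * x + 2 * of_int k * x0)"
        by (simp add: e_def algebra_simps)
      also have "g x * e x = h x - h x0" using e0[OF x] by (auto simp: g_def e_def)
      also have "(h x - h x0) * cis (2 * of_int (- k) * x + 2 * of_int k * x0) =
         (h x * cis (2 * of_int (- k) * x)) * cis (2 * of_int k * x0) - h x0 * cis (2 * of_int (- k) * x + 2 * of_int k * x0)"
        by (simp add: left_diff_distrib cis_mult)
      finally show "g x * cis (2 * of_int (- (k - 1)) * x + 2 * of_int (k - 1) * x0)
         - g x * cis (2 * of_int (- k) * x + 2 * of_int k * x0) =
         (h x * cis (2 * of_int (- k) * x)) * cis (2 * of_int k * x0) - h x0 * cis (2 * of_int (- k) * x + 2 * of_int k * x0)" .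
    qed
    also have "\<dots> = integral {0..pi} (\<lambda>x. h x * cis (2 * of_int (- k) * x)) * cis (2 * of_int k * x0) -
       h x0 * integral {0..pi} (\<lambda>x. cis (2 * of_int (- k) * x + 2 * of_int k * x0))"
    proof -
      have "continuous_on {0..pi} (\<lambda>x. h x * cis (2 * of_int (- k) * x))"
        using continuous_on_mult[OF h continuous_on_cis_linear[of _ "2 * of_int (- k)" 0]] by simp
      then have "(\<lambda>x. (h x * cis (2 * of_int (- k) * x)) * cis (2 * of_int k * x0)) integrable_on {0..pi}"
        by (rule integrable_continuous_real[OF continuous_on_mult[OF _ continuous_on_const]])
      moreover have "(\<lambda>x. h x0 * cis (2 * of_int (- k) * x + 2 * of_int k * x0)) integrable_on {0..pi}"
        by (intro integrable_continuous_real continuous_intros)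
      ultimately show ?thesis by (simp only: integral_diff integral_mult_left integral_mult_right)
    qed
    also have "\<dots> = (if k = 0 then - h x0 * of_real pi else 0)"
      unfolding c integral_cis_period by simp
    finally show ?thesis .
  qed
  \<comment> \<open>Hence \<open>G\<close> is constant on \<open>k \<ge> 0\<close> and on
    \<open>k \<le> -1\<close>. Bessel's inequality makes both constants zero, while the jump between
    them is \<open>- h x0 * pi\<close>.\<close>
  have up: "G (int n) = G 0" for n
  proof (induction n)
    case (Suc n)
    then show ?case using step[of "int n + 1"] by (simp add: algebra_simps)
  qed simp
  have down: "G (- 1 - int n) = G (-1)" for n
  proof (induction n)
    case (Suc n)
    then show ?case using step[of "- 1 - int n"] by (simp add: algebra_simps)
  qed simp
  define I where "I = pi * integral {0..pi} (\<lambda>x. (cmod (g x))\<^sup>2)"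
  have small: "\<gamma> = 0" if "\<And>n::nat. real n * (cmod \<gamma>)\<^sup>2 \<le> I" for \<gamma>
  proof (rule ccontr)
    assume "\<gamma> \<noteq> 0"
    then obtain n :: nat where "I / (cmod \<gamma>)\<^sup>2 < real n" using reals_Archimedean2 by blast
    then show False using that[of n] \<open>\<gamma> \<noteq> 0\<close> by (simp add: divide_less_eq)
  qed
  have "G 0 = 0"
  proof (rule small)
    fix n :: nat
    have "real (card (int ` {..<n})) * (cmod (G 0))\<^sup>2 \<le> I"
      unfolding I_def by (rule bessel_constant[OF gc, where b = "\<lambda>k. 2 * of_int k * x0"])
        (use up in \<open>auto simp only: G_def[symmetric] finite_imageI finite_lessThan\<close>)
    then show "real n * (cmod (G 0))\<^sup>2 \<le> I" by (simp add: card_image)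
  qed
  moreover have "G (-1) = 0"
  proof (rule small)
    fix n :: nat
    have "card ((\<lambda>n. - 1 - int n) ` {..<n}) = n" by (subst card_image) (auto simp: inj_on_def)
    moreover have "real (card ((\<lambda>n. - 1 - int n) ` {..<n})) * (cmod (G (-1)))\<^sup>2 \<le> I"
      unfolding I_def by (rule bessel_constant[OF gc, where b = "\<lambda>k. 2 * of_int k * x0"])
        (use down in \<open>auto simp only: G_def[symmetric] finite_imageI finite_lessThan\<close>)
    ultimately show "real n * (cmod (G (-1)))\<^sup>2 \<le> I" by simp
  qed
  ultimately show ?thesis using step[of 0] by simp
qed

text \<open>The quantity \<open>T k\<close> below is the Casoratian of \<open>c\<close> and of its image under the antiunitary
  symmetry of the recurrence; the symmetry squares to a negative operator as \<open>a / b < 0\<close>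
  (Kramers degeneracy), which makes \<open>T (-1)\<close> definite.\<close>

lemma recurrence_kramers:
  fixes c :: "int \<Rightarrow> complex" and a b s :: real
  assumes rec: "\<And>k. of_real (s - (2 * of_int k + 1)\<^sup>2) * c k = of_real b * c (k - 1) + of_real a * c (k + 1)"
    and b: "b > 0" and a: "a < 0"
    and lim: "(\<lambda>n. c (int n)) \<longlonglongrightarrow> 0" and bdd: "\<And>k. cmod (c k) \<le> B"
  shows "c k = 0"
proof -
  define T where "T k = of_real (b / a) * c k * cnj (c (- 2 - k)) - c (k + 1) * cnj (c (- 1 - k))" for k
  define m where "m k = complex_of_real (s - (2 * of_int k + 1)\<^sup>2)" for k :: int
  have cnjm: "cnj (m k) = m k" for k by (simp add: m_def)
  \<comment> \<open>The reflection \<open>k \<mapsto> -1 - k\<close> sends \<open>2 * k + 1\<close>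
    to its negative. As \<open>m\<close> is also real, the conjugated recurrence at the reflected
    index has the same diagonal coefficient, and the diagonal terms cancel in the proof that
    \<open>T\<close> is constant.\<close>
  have m_sym: "m (- 1 - k) = m k" for k
  proof -
    have "(2 * of_int (- 1 - k) + 1)\<^sup>2 = (2 * of_int k + 1 :: real)\<^sup>2" by (simp add: power2_eq_square algebra_simps)
    then show ?thesis by (simp only: m_def)
  qed
  have a0: "complex_of_real a \<noteq> 0" "complex_of_real b \<noteq> 0" using a b by auto
  have step: "T k = T (k - 1)" for k
  proof -
    have r1: "of_real a * c (k + 1) = m k * c k - of_real b * c (k - 1)"
      using rec[of k] by (simp add: m_def algebra_simps)
    have "m k * cnj (c (- 1 - k)) = of_real b * cnj (c (- 2 - k)) + of_real a * cnj (c (- k))"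
      using arg_cong[OF rec[of "- 1 - k"], of cnj] unfolding m_def[symmetric] m_sym
      by (simp add: cnjm)
    then have r2: "of_real b * cnj (c (- 2 - k)) = m k * cnj (c (- 1 - k)) - of_real a * cnj (c (- k))"
      by (simp add: algebra_simps)
    have "of_real a * T k = c k * (of_real b * cnj (c (- 2 - k))) - (of_real a * c (k + 1)) * cnj (c (- 1 - k))"
      using a0 by (simp add: T_def algebra_simps)
    also have "\<dots> = of_real a * T (k - 1)"
      unfolding r1 r2 using a0 by (simp add: T_def algebra_simps)
    finally show ?thesis using a0 by simp
  qed
  have T: "T (int n) = T (-1)" for n
  proof (induction n)
    case 0 show ?case using step[of 0] by simp
  next
    case (Suc n) then show ?case using step[of "int n + 1"] by (simp add: add.commute)
  qed
  \<comment> \<open>Each product in \<open>T\<close> has one factor far to the right, which tends to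
    zero, and one far to the left, for which the bound \<open>B\<close> suffices.\<close>
  have "(\<lambda>n. T (int n)) \<longlonglongrightarrow> 0"
  proof -
    have bl: "(\<lambda>n. c (int (n + m)) * cnj (c (l - int n))) \<longlonglongrightarrow> 0" for m l
    proof (rule Lim_null_comparison)
      show "\<forall>\<^sub>F n in sequentially. norm (c (int (n + m)) * cnj (c (l - int n))) \<le> norm (c (int (n + m))) * B"
        by (simp add: norm_mult mult_left_mono bdd)
      have "(\<lambda>n. norm (c (int (n + m))) * B) \<longlonglongrightarrow> norm (0 :: complex) * B"
        by (intro tendsto_intros LIMSEQ_ignore_initial_segment[OF lim])
      then show "(\<lambda>n. norm (c (int (n + m))) * B) \<longlonglongrightarrow> 0" by simp
    qed
    have "(\<lambda>n. of_real (b / a) * (c (int (n + 0)) * cnj (c (- 2 - int n))) - c (int (n + 1)) * cnj (c (- 1 - int n)))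
       \<longlonglongrightarrow> of_real (b / a) * 0 - 0"
      by (intro tendsto_intros bl)
    then show ?thesis by (simp add: T_def mult.assoc add.commute)
  qed
  then have "T (-1) = 0" using T LIMSEQ_unique[OF tendsto_const] by simp
  \<comment> \<open>At the centre of the reflection both products become squared moduli:
    \<open>T (-1)\<close> is \<open>b / a\<close> times that of \<open>c (-1)\<close>, minus that of
    \<open>c 0\<close>, so both terms are nonpositive and must vanish.\<close>
  then have "of_real (b / a) * (c (-1) * cnj (c (-1))) = c 0 * cnj (c 0)"
    by (simp add: T_def mult.assoc)
  then have "b / a * (cmod (c (-1)))\<^sup>2 = (cmod (c 0))\<^sup>2"
    unfolding complex_norm_square[symmetric] of_real_mult[symmetric] of_real_eq_iff .
  moreover have "b / a < 0" using a b by (simp add: divide_pos_neg)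
  moreover have "b / a * (cmod (c (-1)))\<^sup>2 \<le> 0" using calculation(2) by (intro mult_nonpos_nonneg) auto
  ultimately have z: "c 0 = 0" "c (-1) = 0"
    using zero_le_power2[of "cmod (c 0)"] by auto
  \<comment> \<open>Two adjacent zeros propagate in both directions, since neither \<open>a\<close>
    nor \<open>b\<close> is zero.\<close>
  have "c (int n) = 0 \<and> c (int n - 1) = 0 \<and> c (- int n) = 0 \<and> c (- int n - 1) = 0" for n
  proof (induction n)
    case 0 then show ?case using z by simp
  next
    case (Suc n)
    have "c (int n + 1) = 0" using rec[of "int n"] Suc a0 by simp
    moreover have "c (- int n - 1 - 1) = 0" using rec[of "- int n - 1"] Suc a0 by simp
    moreover have "- int (Suc n) = - int n - 1" "- int (Suc n) - 1 = - int n - 1 - 1" "int (Suc n) - 1 = int n"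
      "int (Suc n) = int n + 1" by simp_all
    ultimately show ?case using Suc by metis
  qed
  then show ?thesis by (cases k rule: int_cases2) auto
qed

text \<open>The coefficients of the solution against the odd exponentials satisfy the hypotheses of
  \<open>recurrence_kramers\<close>, with \<open>1 - 2 * V\<close> as the negative coefficient. They
  all vanish, so the solution vanishes on the open interval, and with it its data at 0.\<close>

lemma no_antiperiodic:
  assumes V: "V > 1/2"
    and y: "sol V (of_real s) \<alpha> \<beta> pi = - \<alpha>" "dsol V (of_real s) \<alpha> \<beta> pi = - \<beta>"
  shows "\<alpha> = 0 \<and> \<beta> = 0"
proof -
  let ?y = "sol V (of_real s) \<alpha> \<beta>" and ?y1 = "dsol V (of_real s) \<alpha> \<beta>"
  define e where "e k x = cis (- (2 * of_int k + 1) * x + 0)" for k :: int and x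
  define c where "c k = integral {0..pi} (\<lambda>x. ?y x * e k x)" for k
  define a b where "a = 1 - 2 * V" and "b = 1 + 2 * V"
  have ce: "continuous_on S (e k)" for S k unfolding e_def by (intro continuous_intros)
  have i: "(\<lambda>x. ?y x * e k x) integrable_on {0..pi}" for k
    by (intro integrable_continuous_real continuous_intros ce)
  have rec: "of_real (s - (2 * of_int k + 1)\<^sup>2) * c k = of_real b * c (k - 1) + of_real a * c (k + 1)" for k
  proof -
    define n where "n = - (2 * of_int k + 1 :: real)"
    have ed: "(e k has_vector_derivative \<i> * of_real n * e k x) (at x)" for x
      unfolding e_def[abs_def] n_def by (rule has_vector_derivative_cis_linear)
    have "\<i> * of_real n * (\<i> * of_real n * e k x) = (\<i> * \<i>) * (of_real n * of_real n) * e k x" for x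
      by (simp only: mult_ac)
    then have "\<i> * of_real n * (\<i> * of_real n * e k x) = - of_real (n\<^sup>2) * e k x" for x
      by (simp add: power2_eq_square)
    then have "((\<lambda>x. \<i> * of_real n * e k x) has_vector_derivative - of_real (n\<^sup>2) * e k x) (at x)" for x
      using has_vector_derivative_mult_right[OF ed[of x], of "\<i> * of_real n"] by (simp only:)
    with ed have oe: "ode_on UNIV (\<lambda>_. - of_real (n\<^sup>2)) (\<lambda>_. 0) (e k) (\<lambda>x. \<i> * of_real n * e k x)"
      unfolding ode_on_def diff_0_right by blast
    have "e k pi = -1"
    proof -
      have "e k pi = cis (2 * pi * of_int (- k)) * cis (- pi)"
        by (simp add: e_def cis_mult algebra_simps)
      then show ?thesis by (simp only: cis_multiple_2pi Ints_of_int) (simp add: complex_eq_iff)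
    qed
    moreover have "e k 0 = 1" by (simp add: e_def)
    \<comment> \<open>Both functions and their derivatives change sign over a period, so the
      Wronskian takes the same value at both ends and no boundary term remains.\<close>
    ultimately have "((\<lambda>x. (- of_real (n\<^sup>2) - (q_pot V x - of_real s)) * (?y x * e k x)) has_integral 0) {0..pi}"
      using wronskian_has_integral[OF ode_on_sol[of V "of_real s" \<alpha> \<beta>] oe pi_ge_zero] by (simp add: y)
    moreover have "(- of_real (n\<^sup>2) - (q_pot V x - of_real s)) * (?y x * e k x) =
        of_real (s - n\<^sup>2) * (?y x * e k x) - (of_real b * (?y x * e (k - 1) x) + of_real a * (?y x * e (k + 1) x))" for x
    proof -
      \<comment> \<open>The two exponentials of the potential shift the index down and up, which
        produces the three-term form.\<close>
      have "cis (2 * x) * e k x = e (k - 1) x" "cis (- 2 * x) * e k x = e (k + 1) x"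
        by (simp_all add: e_def cis_mult algebra_simps)
      then have "q_pot V x * e k x = of_real b * e (k - 1) x + of_real a * e (k + 1) x"
        by (simp add: q_pot_cis a_def b_def distrib_right mult.assoc)
      then have "?y x * (q_pot V x * e k x) = ?y x * (of_real b * e (k - 1) x + of_real a * e (k + 1) x)" by simp
      then show ?thesis by (simp add: algebra_simps)
    qed
    moreover have "((\<lambda>x. of_real (s - n\<^sup>2) * (?y x * e k x) - (of_real b * (?y x * e (k - 1) x) + of_real a * (?y x * e (k + 1) x)))
      has_integral of_real (s - n\<^sup>2) * c k - (of_real b * c (k - 1) + of_real a * c (k + 1))) {0..pi}"
      unfolding c_def by (intro has_integral_diff has_integral_add has_integral_mult_right integrable_integral i)
    ultimately have "of_real (s - n\<^sup>2) * c k - (of_real b * c (k - 1) + of_real a * c (k + 1)) = 0"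
      by (simp only: has_integral_unique)
    then show ?thesis by (simp add: n_def power2_eq_square algebra_simps)
  qed
  obtain B where B: "B > 0" "\<And>x. x \<in> {0..pi} \<Longrightarrow> cmod (?y x) \<le> B"
    using sol_locally_bounded[of "cmod (of_real s)" V \<alpha> \<beta>] by blast
  have bdd: "cmod (c k) \<le> B * pi" for k
  proof -
    have "cmod (c k) \<le> B * (pi - 0)"
      unfolding c_def using B by (intro norm_integral_le continuous_intros ce) (auto simp: norm_mult e_def)
    then show ?thesis by simp
  qed
  \<comment> \<open>In the recurrence the growing factor \<open>s - (2 * n + 1)\<^sup>2\<close>
    stands against bounded neighbours, which gives decay of order \<open>1 / n\<close>.\<close>
  have lim: "(\<lambda>n. c (int n)) \<longlonglongrightarrow> 0"
  proof (rule Lim_null_comparison)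
    define C where "C = (\<bar>b\<bar> + \<bar>a\<bar>) * (B * pi)"
    obtain N :: nat where N: "\<bar>s\<bar> < real N" using reals_Archimedean2 by blast
    have ev: "\<forall>\<^sub>F n in sequentially. real n > 0 \<and> (2 * real n + 1)\<^sup>2 - s \<ge> real n"
      using eventually_gt_at_top[of 0] eventually_ge_at_top[of N]
    proof eventually_elim
      case (elim n)
      have "(2 * real n + 1)\<^sup>2 = 4 * (real n)\<^sup>2 + 4 * real n + 1" by (simp add: power2_eq_square algebra_simps)
      then have "(2 * real n + 1)\<^sup>2 \<ge> 4 * real n" by simp
      then show ?case using elim N by simp
    qed
    show "\<forall>\<^sub>F n in sequentially. cmod (c (int n)) \<le> C / real n"
      using ev
    proof eventually_elim
      case (elim n)
      have "cmod (of_real (s - (2 * of_int (int n) + 1)\<^sup>2) * c (int n)) \<le> \<bar>b\<bar> * (B * pi) + \<bar>a\<bar> * (B * pi)"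
        unfolding rec by (intro norm_triangle_le add_mono) (auto simp: norm_mult intro!: mult_left_mono bdd)
      moreover have "cmod (of_real (s - (2 * of_int (int n) + 1)\<^sup>2)) = (2 * real n + 1)\<^sup>2 - s"
        using elim unfolding norm_of_real by simp
      ultimately have "((2 * real n + 1)\<^sup>2 - s) * cmod (c (int n)) \<le> C"
        unfolding norm_mult C_def by (simp add: distrib_right)
      moreover have "real n * cmod (c (int n)) \<le> ((2 * real n + 1)\<^sup>2 - s) * cmod (c (int n))"
        using elim by (intro mult_right_mono) auto
      ultimately show ?case using elim by (simp add: pos_le_divide_eq mult.commute)
    qed
    show "(\<lambda>n. C / real n) \<longlonglongrightarrow> 0" by (rule lim_const_over_n)
  qed
  have c0: "c k = 0" for k
    by (rule recurrence_kramers[OF rec _ _ lim bdd]) (use V in \<open>auto simp: a_def b_def\<close>)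
  have y0: "?y x = 0" if x: "x \<in> {0<..<pi}" for x
  proof -
    have "(?y has_vector_derivative ?y1 x) (at x)" using ode_on_sol by (auto simp: ode_on_def)
    \<comment> \<open>The factor \<open>cis (- x)\<close> turns the odd exponents into even ones, as
      \<open>fourier_zero\<close> expects.\<close>
    from has_vector_derivative_mult[OF this has_vector_derivative_cis_linear[of "-1" 0 x]]
    have "((\<lambda>x. ?y x * cis (- x)) has_vector_derivative ?y x * (- \<i> * cis (- x)) + ?y1 x * cis (- x)) (at x)"
      by simp
    moreover have "continuous_on {0..pi} (\<lambda>x. ?y x * cis (- x))"
      using continuous_on_mult[OF continuous_on_sol(1) continuous_on_cis_linear[of _ "-1" 0]] by simp
    moreover have "integral {0..pi} (\<lambda>x. ?y x * cis (- x) * cis (2 * of_int (- k) * x)) = 0" for k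
    proof -
      have "?y x * cis (- x) * cis (2 * of_int (- k) * x) = ?y x * e k x" for x
        by (simp add: e_def mult.assoc cis_mult algebra_simps)
      then show ?thesis using c0[of k] unfolding c_def by (simp only:)
    qed
    ultimately have "?y x * cis (- x) = 0"
      using fourier_zero[where h = "\<lambda>x. ?y x * cis (- x)", OF _ x] by blast
    then show ?thesis by simp
  qed
  have y10: "?y1 x = 0" if x: "x \<in> {0<..<pi}" for x
  proof -
    have "(?y has_vector_derivative ?y1 x) (at x)" using ode_on_sol by (auto simp: ode_on_def)
    moreover have "(?y has_vector_derivative 0) (at x)"
      by (rule has_vector_derivative_transform_within_open[OF has_vector_derivative_const[of 0] open_greaterThanLessThan x])
        (use y0 in auto)
    ultimately show ?thesis by (rule vector_derivative_unique_at)
  qed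
  have x: "pi / 2 \<in> {0<..<pi}" by simp
  have "\<alpha> * \<delta> - \<beta> * \<gamma> = 0" for \<gamma> \<delta>
    using wronskian_const[OF ode_on_sol[of V "of_real s" \<alpha> \<beta>] ode_on_sol[of V "of_real s" \<gamma> \<delta>] convex_UNIV, of 0 "pi/2"]
    by (simp add: y0[OF x] y10[OF x])
  from this[of 1 0] this[of 0 1] show ?thesis by simp
qed

lemma disc_real_ne_minus_2:
  assumes "V > 1/2"
  shows "disc V (of_real s) \<noteq> - 2"
proof
  assume "disc V (of_real s) = - 2"
  then obtain \<alpha> \<beta> where "\<alpha> \<noteq> 0 \<or> \<beta> \<noteq> 0" "sol V (of_real s) \<alpha> \<beta> pi = - 1 * \<alpha>" "dsol V (of_real s) \<alpha> \<beta> pi = - 1 * \<beta>"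
    using floquet_exists[of V "of_real s" "- 1"] by auto
  then show False using no_antiperiodic[OF assms, of s \<alpha> \<beta>] by simp
qed

text \<open>At \<open>\<mu> = k\<^sup>2\<close> Lagrange's identity compares the solutions with
  \<open>cos (k x)\<close> and \<open>sin (k x)\<close> and leaves an integral in which the
  parameter has cancelled against \<open>k\<^sup>2\<close>. By the energy bound
  \<open>sol V \<mu> 1 0\<close> is bounded and \<open>sol V \<mu> 0 1\<close> is of order
  \<open>1 / k\<close>, uniformly in \<open>k\<close>.\<close>

lemma disc_square_asymptotics:
  "\<exists>C. \<forall>k::nat. k > 0 \<longrightarrow> cmod ((-1) ^ k * disc V (of_real ((real k)\<^sup>2)) - 2) \<le> C / real k"
proof -
  define Q where "Q = \<bar>1 + 2 * V\<bar> + \<bar>1 - 2 * V\<bar>"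
  define A where "A = exp (Q * pi)"
  have Q0: "Q \<ge> 0" by (simp add: Q_def)
  have A1: "A \<ge> 1" using Q0 by (simp add: A_def)
  have "cmod ((-1) ^ k * disc V (of_real ((real k)\<^sup>2)) - 2) \<le> (2 * Q * A * pi) / real k" if k: "k > 0" for k :: nat
  proof -
    define \<mu> where "\<mu> = complex_of_real ((real k)\<^sup>2)"
    have k0: "real k > 0" "real k \<ge> 1" using k by auto
    have en: "(cmod (dsol V \<mu> \<alpha> \<beta> x))\<^sup>2 + (real k)\<^sup>2 * (cmod (sol V \<mu> \<alpha> \<beta> x))\<^sup>2 \<le> A * ((cmod \<beta>)\<^sup>2 + (real k)\<^sup>2 * (cmod \<alpha>)\<^sup>2)"
      if "x \<in> {0..pi}" for x \<alpha> \<beta>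
    proof -
      have "cmod (q_pot V x - \<mu> + of_real ((real k)\<^sup>2)) \<le> Q" for x
        using cmod_q_pot_le by (simp add: \<mu>_def Q_def)
      from energy_bound[OF ode_on_sol k0(1) this] that
      have "(cmod (dsol V \<mu> \<alpha> \<beta> x))\<^sup>2 + (real k)\<^sup>2 * (cmod (sol V \<mu> \<alpha> \<beta> x))\<^sup>2
         \<le> exp (Q / real k * x) * ((cmod \<beta>)\<^sup>2 + (real k)\<^sup>2 * (cmod \<alpha>)\<^sup>2)" by simp
      also have "\<dots> \<le> A * ((cmod \<beta>)\<^sup>2 + (real k)\<^sup>2 * (cmod \<alpha>)\<^sup>2)"
      proof (rule mult_right_mono)
        have "Q / real k * x \<le> Q * pi"
          using that k0 Q0 by (intro mult_mono) (auto simp: divide_le_eq mult_le_cancel_left1)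
        then show "exp (Q / real k * x) \<le> A" by (simp add: A_def)
      qed simp
      finally show ?thesis .
    qed
    have AA: "A \<le> A\<^sup>2" using A1 by (simp add: power2_eq_square)
    have c: "cmod (sol V \<mu> 1 0 x) \<le> A" if "x \<in> {0..pi}" for x
    proof (rule power2_le_imp_le)
      have "(real k)\<^sup>2 * (cmod (sol V \<mu> 1 0 x))\<^sup>2 \<le> (real k)\<^sup>2 * A"
        using en[OF that, of 1 0] by (simp add: mult.commute) (smt (verit) zero_le_power2)
      then have "(cmod (sol V \<mu> 1 0 x))\<^sup>2 \<le> A" using k0 by simp
      then show "(cmod (sol V \<mu> 1 0 x))\<^sup>2 \<le> A\<^sup>2" using AA by simp
    qed (use A1 in simp)
    have s: "real k * cmod (sol V \<mu> 0 1 x) \<le> A" if "x \<in> {0..pi}" for x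
    proof (rule power2_le_imp_le)
      have "(real k)\<^sup>2 * (cmod (sol V \<mu> 0 1 x))\<^sup>2 \<le> A"
        using en[OF that, of 0 1] by simp (smt (verit) zero_le_power2)
      then show "(real k * cmod (sol V \<mu> 0 1 x))\<^sup>2 \<le> A\<^sup>2" using AA by (simp add: power_mult_distrib)
    qed (use A1 in simp)
    have trig: "((\<lambda>x. complex_of_real (cos (real k * x))) has_vector_derivative of_real (- real k * sin (real k * x))) (at x)"
      "((\<lambda>x. complex_of_real (sin (real k * x))) has_vector_derivative of_real (real k * cos (real k * x))) (at x)" for x
      by (intro has_vector_derivative_of_real, auto intro!: derivative_eq_intros)+
    have oc: "ode_on UNIV (\<lambda>_. - \<mu>) (\<lambda>_. 0) (\<lambda>x. of_real (cos (real k * x))) (\<lambda>x. of_real (- real k * sin (real k * x)))"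
      using trig(1) has_vector_derivative_mult_right[OF trig(2), of "- of_real (real k)"]
      by (simp add: ode_on_def \<mu>_def power2_eq_square mult.assoc)
    have os: "ode_on UNIV (\<lambda>_. - \<mu>) (\<lambda>_. 0) (\<lambda>x. of_real (sin (real k * x))) (\<lambda>x. of_real (real k * cos (real k * x)))"
      using trig(2) has_vector_derivative_mult_right[OF trig(1), of "of_real (real k)"]
      by (simp add: ode_on_def \<mu>_def power2_eq_square mult.assoc)
    have p: "cos (real k * pi) = (-1) ^ k" "sin (real k * pi) = 0" by (simp_all add: cos_npi sin_npi)
    have 1: "cmod ((-1) ^ k * sol V \<mu> 1 0 pi - 1) \<le> Q * A * pi / real k"
    proof -
      \<comment> \<open>As \<open>sin (k * pi) = 0\<close>, the Wronskian with the sine retains only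
        the value of the solution at pi; the one with the cosine, used next, retains only the
        derivative.\<close>
      have "((\<lambda>x. - (q_pot V x) * (sol V \<mu> 1 0 x * of_real (sin (real k * x)))) has_integral
          of_real (real k) * ((-1) ^ k * sol V \<mu> 1 0 pi - 1)) {0..pi}"
        using wronskian_has_integral[OF ode_on_sol[of V \<mu> 1 0] os pi_ge_zero] p by (simp add: algebra_simps)
      from integral_unique[OF this]
      have "cmod (of_real (real k) * ((-1) ^ k * sol V \<mu> 1 0 pi - 1)) =
        cmod (integral {0..pi} (\<lambda>x. - (q_pot V x) * (sol V \<mu> 1 0 x * of_real (sin (real k * x)))))" by simp
      also have "\<dots> \<le> Q * A * (pi - 0)"
      proof (rule norm_integral_le)
        fix x assume x: "x \<in> {0..pi}"
        have "cmod (- (q_pot V x) * (sol V \<mu> 1 0 x * of_real (sin (real k * x)))) = cmod (q_pot V x) * (cmod (sol V \<mu> 1 0 x) * \<bar>sin (real k * x)\<bar>)"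
          by (simp add: norm_mult)
        also have "\<dots> \<le> Q * (A * 1)"
          using Q0 A1 c[OF x] cmod_q_pot_le[of V x] by (intro mult_mono) (auto simp: Q_def)
        finally show "cmod (- (q_pot V x) * (sol V \<mu> 1 0 x * of_real (sin (real k * x)))) \<le> Q * A" by simp
      qed (intro continuous_intros, simp)
      finally show ?thesis using k0 by (simp add: norm_mult pos_le_divide_eq mult.commute)
    qed
    have 2: "cmod ((-1) ^ k * dsol V \<mu> 0 1 pi - 1) \<le> Q * A * pi / real k"
    proof -
      have "((\<lambda>x. - (q_pot V x) * (sol V \<mu> 0 1 x * of_real (cos (real k * x)))) has_integral
          - ((-1) ^ k * dsol V \<mu> 0 1 pi - 1)) {0..pi}"
        using wronskian_has_integral[OF ode_on_sol[of V \<mu> 0 1] oc pi_ge_zero] p by (simp add: algebra_simps)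
      from integral_unique[OF this]
      have "cmod ((-1) ^ k * dsol V \<mu> 0 1 pi - 1) =
        cmod (integral {0..pi} (\<lambda>x. - (q_pot V x) * (sol V \<mu> 0 1 x * of_real (cos (real k * x)))))"
        by (metis norm_minus_cancel)
      also have "\<dots> \<le> Q * (A / real k) * (pi - 0)"
      proof (rule norm_integral_le)
        fix x assume x: "x \<in> {0..pi}"
        have "cmod (- (q_pot V x) * (sol V \<mu> 0 1 x * of_real (cos (real k * x)))) = cmod (q_pot V x) * (cmod (sol V \<mu> 0 1 x) * \<bar>cos (real k * x)\<bar>)"
          by (simp add: norm_mult)
        also have "\<dots> \<le> Q * ((A / real k) * 1)"
          using Q0 A1 s[OF x] cmod_q_pot_le[of V x] k0
          by (intro mult_mono) (auto simp: Q_def pos_le_divide_eq mult.commute)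
        finally show "cmod (- (q_pot V x) * (sol V \<mu> 0 1 x * of_real (cos (real k * x)))) \<le> Q * (A / real k)" by simp
      qed (intro continuous_intros, simp)
      finally show ?thesis by (simp add: mult.commute mult.left_commute)
    qed
    have "(-1) ^ k * disc V \<mu> - 2 = ((-1) ^ k * sol V \<mu> 1 0 pi - 1) + ((-1) ^ k * dsol V \<mu> 0 1 pi - 1)"
      by (simp add: disc_def distrib_left)
    then have "cmod ((-1) ^ k * disc V \<mu> - 2) \<le> Q * A * pi / real k + Q * A * pi / real k"
      using norm_triangle_mono[OF 1 2] by simp
    then show ?thesis by (simp add: \<mu>_def mult_ac)
  qed
  then show ?thesis by blast
qed

section \<open>The discriminant as a real function and its critical points\<close>

definition rdisc :: "real \<Rightarrow> real \<Rightarrow> real" where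
  "rdisc V s = Re (disc V (of_real s))"

lemma disc_eq_rdisc: "disc V (of_real s) = of_real (rdisc V s)"
  unfolding rdisc_def by (rule disc_of_real)

text \<open>A function that is real on the real line has a real derivative there, so a critical
  point of \<open>rdisc\<close> is a zero of \<open>deriv (disc V)\<close>.\<close>

lemma has_real_derivative_rdisc:
  "(rdisc V has_real_derivative Re (deriv (disc V) (of_real s))) (at s)"
  and Im_deriv_disc: "Im (deriv (disc V) (of_real s)) = 0"
proof -
  have "((\<lambda>s. disc V (of_real s)) has_vector_derivative deriv (disc V) (of_real s)) (at s)"
    by (intro has_vector_derivative_real_field) (simp add: disc_field_differentiable field_differentiable_derivI)
  then have *: "((\<lambda>s. complex_of_real (rdisc V s)) has_vector_derivative deriv (disc V) (of_real s)) (at s)"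
    by (simp add: disc_eq_rdisc)
  then show "(rdisc V has_real_derivative Re (deriv (disc V) (of_real s))) (at s)"
    unfolding has_vector_derivative_complex_iff by simp
  have "((\<lambda>s. 0) has_real_derivative Im (deriv (disc V) (of_real s))) (at s)"
    using * unfolding has_vector_derivative_complex_iff by simp
  then show "Im (deriv (disc V) (of_real s)) = 0"
    using DERIV_unique DERIV_const by blast
qed

lemma continuous_on_rdisc: "continuous_on S (rdisc V)"
  using has_real_derivative_rdisc DERIV_isCont continuous_at_imp_continuous_on by metis

lemma rdisc_sign:
  "\<exists>N. \<forall>k\<ge>N. (even k \<longrightarrow> rdisc V ((real k)\<^sup>2) > 0) \<and> (odd k \<longrightarrow> rdisc V ((real k)\<^sup>2) < 0)"
proof -
  obtain C where C: "\<And>k::nat. k > 0 \<Longrightarrow> cmod ((-1) ^ k * disc V (of_real ((real k)\<^sup>2)) - 2) \<le> C / real k"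
    using disc_square_asymptotics by blast
  obtain N :: nat where N: "C < real N" using reals_Archimedean2 by blast
  have "(even k \<longrightarrow> rdisc V ((real k)\<^sup>2) > 0) \<and> (odd k \<longrightarrow> rdisc V ((real k)\<^sup>2) < 0)" if k: "k \<ge> Suc N" for k
  proof -
    have "C / real k < 1" using N k by (simp add: divide_less_eq)
    then have "cmod ((-1) ^ k * of_real (rdisc V ((real k)\<^sup>2)) - 2) < 1"
      using order_le_less_trans[OF C[of k]] k by (simp only: disc_eq_rdisc)
    then have "cmod (of_real ((-1) ^ k * rdisc V ((real k)\<^sup>2) - 2)) < 1" by simp
    then have "\<bar>(-1) ^ k * rdisc V ((real k)\<^sup>2) - 2\<bar> < 1" unfolding norm_of_real .
    then show ?thesis by (auto simp: abs_less_iff)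
  qed
  then show ?thesis by blast
qed

text \<open>Intermediate value theorem: \<open>rdisc\<close> is positive at the squares of large
  even integers and never attains -2.\<close>

lemma rdisc_gt_minus_2:
  assumes "V > 1/2"
  shows "rdisc V s > - 2"
proof (rule ccontr)
  assume "\<not> rdisc V s > - 2"
  obtain N where N: "\<And>k. k \<ge> N \<Longrightarrow> even k \<Longrightarrow> rdisc V ((real k)\<^sup>2) > 0"
    using rdisc_sign[of V] by auto
  have "connected (rdisc V ` UNIV)"
    by (intro connected_continuous_image continuous_on_rdisc connected_UNIV)
  then have "{rdisc V s..rdisc V ((real (2 * N))\<^sup>2)} \<subseteq> rdisc V ` UNIV"
    by (rule connected_contains_Icc) auto
  moreover have "- 2 \<in> {rdisc V s..rdisc V ((real (2 * N))\<^sup>2)}"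
    using \<open>\<not> rdisc V s > - 2\<close> N[of "2 * N"] by simp
  ultimately have "- 2 \<in> rdisc V ` UNIV" by blast
  then obtain u where "rdisc V u = - 2" by auto
  then show False using disc_real_ne_minus_2[OF assms, of u] by (simp add: disc_eq_rdisc)
qed

lemma critical_points:
  assumes V: "V > 1/2"
  shows "\<exists>N. \<forall>j\<ge>N. \<exists>s. (real (2 * j))\<^sup>2 < s \<and> s < (real (2 * j + 2))\<^sup>2 \<and>
     - 2 < rdisc V s \<and> rdisc V s < 2 \<and> deriv (disc V) (of_real s) = 0"
proof -
  obtain N where N: "\<And>k. k \<ge> N \<Longrightarrow> even k \<Longrightarrow> rdisc V ((real k)\<^sup>2) > 0" "\<And>k. k \<ge> N \<Longrightarrow> odd k \<Longrightarrow> rdisc V ((real k)\<^sup>2) < 0"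
    using rdisc_sign[of V] by auto
  have "\<exists>s. (real (2 * j))\<^sup>2 < s \<and> s < (real (2 * j + 2))\<^sup>2 \<and>
     - 2 < rdisc V s \<and> rdisc V s < 2 \<and> deriv (disc V) (of_real s) = 0" if j: "j \<ge> N" for j
  proof -
    define l m r where "l = (real (2 * j))\<^sup>2" and "m = (real (2 * j + 1))\<^sup>2" and "r = (real (2 * j + 2))\<^sup>2"
    have lm: "l < m" "m < r" unfolding l_def m_def r_def by (intro power_strict_mono; simp)+
    have f: "rdisc V l > 0" "rdisc V m < 0" "rdisc V r > 0"
      unfolding l_def m_def r_def using j N(1)[of "2 * j"] N(2)[of "2 * j + 1"] N(1)[of "2 * j + 2"] by auto
    obtain s where s: "s \<in> {l..r}" "\<And>u. u \<in> {l..r} \<Longrightarrow> rdisc V s \<le> rdisc V u"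
      using continuous_attains_inf[of "{l..r}" "rdisc V"] continuous_on_rdisc lm by auto
    have fs: "rdisc V s < 0" using s(2)[of m] lm f by auto
    then have "s \<noteq> l" "s \<noteq> r" using f by auto
    then have slr: "l < s" "s < r" using s(1) by auto
    have "Re (deriv (disc V) (of_real s)) = 0"
    proof (rule DERIV_local_min[OF has_real_derivative_rdisc])
      show "0 < min (s - l) (r - s)" using slr by simp
      show "\<forall>y. \<bar>s - y\<bar> < min (s - l) (r - s) \<longrightarrow> rdisc V s \<le> rdisc V y"
        by (intro allI impI s(2)) (auto simp: abs_less_iff)
    qed
    then have "deriv (disc V) (of_real s) = 0" using Im_deriv_disc by (simp add: complex_eq_iff)
    then show ?thesis using slr fs rdisc_gt_minus_2[OF V, of s] unfolding l_def r_def by (intro exI[of _ s]) auto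
  qed
  then show ?thesis by blast
qed

text \<open>Zeros of an entire function are isolated unless it vanishes identically, and
  \<open>deriv (disc V)\<close> does not, because \<open>rdisc_sign\<close> gives the discriminant
  both signs.\<close>

lemma deriv_disc_nonzero_right:
  "\<exists>\<delta>>0. \<forall>u. s < u \<and> u < s + \<delta> \<longrightarrow> deriv (disc V) (of_real u) \<noteq> 0"
proof -
  have hol: "deriv (disc V) holomorphic_on UNIV"
    by (intro holomorphic_deriv holomorphic_on_disc) simp
  obtain z where z: "deriv (disc V) z \<noteq> 0"
  proof (rule ccontr)
    assume "\<not> thesis"
    then have "\<And>z. deriv (disc V) z = 0" using that by blast
    then have "(disc V has_field_derivative 0) (at z)" for z
      by (metis disc_field_differentiable field_differentiable_derivI)
    then obtain c where c: "\<And>z. disc V z = c"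
      using has_field_derivative_zero_constant[of UNIV "disc V"] by auto
    obtain N where N: "\<And>k. k \<ge> N \<Longrightarrow> even k \<Longrightarrow> rdisc V ((real k)\<^sup>2) > 0" "\<And>k. k \<ge> N \<Longrightarrow> odd k \<Longrightarrow> rdisc V ((real k)\<^sup>2) < 0"
      using rdisc_sign[of V] by auto
    show False using N(1)[of "2 * N"] N(2)[of "2 * N + 1"] by (simp add: rdisc_def c)
  qed
  show ?thesis
  proof (cases "deriv (disc V) (of_real s) = 0")
    case True
    obtain r where r: "0 < r" "\<And>z. z \<in> ball (of_real s) r - {of_real s} \<Longrightarrow> deriv (disc V) z \<noteq> 0"
      using isolated_zeros[OF hol _ _ _ True _ z] by auto
    have "deriv (disc V) (of_real u) \<noteq> 0" if "s < u" "u < s + r" for u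
    proof (rule r(2))
      have "dist (complex_of_real s) (of_real u) < r"
        using that by (simp add: dist_real_def)
      then show "of_real u \<in> ball (of_real s) r - {complex_of_real s}" using that by auto
    qed
    then show ?thesis using r(1) by blast
  next
    case False
    have "isCont (deriv (disc V)) (of_real s)"
      using holomorphic_on_imp_continuous_on[OF hol] by (simp add: continuous_on_eq_continuous_at)
    then obtain r where r: "r > 0" "\<And>z. dist (of_real s) z < r \<Longrightarrow> deriv (disc V) z \<noteq> 0"
      using continuous_at_avoid[of "of_real s" "deriv (disc V)" 0] False by blast
    have "deriv (disc V) (of_real u) \<noteq> 0" if "s < u" "u < s + r" for u
      using that by (intro r(2)) (simp add: dist_real_def)
    then show ?thesis using r(1) by blast
  qed
qed

section \<open>Square integrable functions\<close>

lemma lebesgue_on_continuous: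
  fixes f :: "real \<Rightarrow> 'a :: euclidean_space"
  assumes "continuous_on {a..b} f"
  shows "f \<in> borel_measurable (lebesgue_on {a..b})" "integrable (lebesgue_on {a..b}) f"
    "integral\<^sup>L (lebesgue_on {a..b}) f = integral {a..b} f"
proof -
  show "f \<in> borel_measurable (lebesgue_on {a..b})"
    using assms by (intro continuous_imp_measurable_on_sets_lebesgue) auto
  show i: "integrable (lebesgue_on {a..b}) f"
    using assms by (rule continuous_imp_integrable_real)
  show "integral\<^sup>L (lebesgue_on {a..b}) f = integral {a..b} f"
    using i by (rule lebesgue_integral_eq_integral) simp
qed

lemma continuous_imp_Ltwo:
  assumes "continuous_on {a..b} f"
  shows "f \<in> Ltwo {a..b}"
  unfolding Ltwo_def using assms by (auto intro!: lebesgue_on_continuous continuous_intros)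

lemma Ltwo_inner_continuous:
  assumes "continuous_on {a..b} f" "continuous_on {a..b} g"
  shows "Ltwo_inner {a..b} f g = integral {a..b} (\<lambda>x. f x * cnj (g x))"
  unfolding Ltwo_inner_def by (intro lebesgue_on_continuous continuous_intros assms)

lemma Ltwo_norm_continuous:
  assumes "continuous_on {a..b} f"
  shows "Ltwo_norm {a..b} f = sqrt (integral {a..b} (\<lambda>x. (cmod (f x))\<^sup>2))"
  unfolding Ltwo_norm_def by (subst lebesgue_on_continuous) (auto intro!: continuous_intros assms)

lemma Ltwo_integrable_mult:
  assumes f: "f \<in> Ltwo S" and g: "g \<in> Ltwo S"
  shows "integrable (lebesgue_on S) (\<lambda>x. f x * cnj (g x))"
    and "integrable (lebesgue_on S) (\<lambda>x. cmod (f x) * cmod (g x))"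
proof -
  have m: "f \<in> borel_measurable (lebesgue_on S)" "g \<in> borel_measurable (lebesgue_on S)"
    and i: "integrable (lebesgue_on S) (\<lambda>x. (cmod (f x))\<^sup>2 + (cmod (g x))\<^sup>2)"
    using f g by (auto simp: Ltwo_def)
  have mc: "(\<lambda>x. cnj (g x)) \<in> borel_measurable (lebesgue_on S)"
    using m(2) by (rule measurable_compose) (intro borel_measurable_continuous_onI continuous_intros)
  have le: "cmod (f x) * cmod (g x) \<le> (cmod (f x))\<^sup>2 + (cmod (g x))\<^sup>2" for x
    using sum_squares_bound[of "cmod (f x)" "cmod (g x)"] mult_nonneg_nonneg[OF norm_ge_zero[of "f x"] norm_ge_zero[of "g x"]]
    by linarith
  show "integrable (lebesgue_on S) (\<lambda>x. f x * cnj (g x))"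
    by (rule Bochner_Integration.integrable_bound[OF i])
      (use le m mc in \<open>auto simp: norm_mult intro!: borel_measurable_times\<close>)
  show "integrable (lebesgue_on S) (\<lambda>x. cmod (f x) * cmod (g x))"
    by (rule Bochner_Integration.integrable_bound[OF i])
      (use le m in \<open>auto intro!: borel_measurable_times borel_measurable_norm\<close>)
qed

lemma Ltwo_cauchy_schwarz:
  assumes f: "f \<in> Ltwo S" and g: "g \<in> Ltwo S"
  shows "cmod (Ltwo_inner S f g) \<le> Ltwo_norm S f * Ltwo_norm S g"
proof -
  let ?M = "lebesgue_on S"
  define A where "A = (LINT x|?M. (cmod (f x))\<^sup>2)"
  define B where "B = (LINT x|?M. (cmod (g x))\<^sup>2)"
  define m where "m = (LINT x|?M. cmod (f x) * cmod (g x))"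
  have i: "integrable ?M (\<lambda>x. (cmod (f x))\<^sup>2)" "integrable ?M (\<lambda>x. (cmod (g x))\<^sup>2)"
    using f g by (auto simp: Ltwo_def)
  note ifg = Ltwo_integrable_mult[OF f g]
  have quad: "0 \<le> s\<^sup>2 * A - 2 * s * m + B" for s
  proof -
    have "0 \<le> (LINT x|?M. (s * cmod (f x) - cmod (g x))\<^sup>2)" by simp
    also have "(\<lambda>x. (s * cmod (f x) - cmod (g x))\<^sup>2) =
        (\<lambda>x. s\<^sup>2 * (cmod (f x))\<^sup>2 - 2 * s * (cmod (f x) * cmod (g x)) + (cmod (g x))\<^sup>2)"
      by (rule ext) (simp add: power2_diff power_mult_distrib)
    also have "(LINT x|?M. s\<^sup>2 * (cmod (f x))\<^sup>2 - 2 * s * (cmod (f x) * cmod (g x)) + (cmod (g x))\<^sup>2) =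
        s\<^sup>2 * A - 2 * s * m + B"
      using i ifg by (simp add: A_def B_def m_def)
    finally show ?thesis .
  qed
  have m0: "m \<ge> 0" and A0: "A \<ge> 0" by (auto simp: m_def A_def)
  have "m\<^sup>2 \<le> A * B"
  proof (cases "A = 0")
    case True
    have "m = 0"
    proof (rule ccontr)
      assume "m \<noteq> 0"
      \<comment> \<open>For \<open>A = 0\<close> the quadratic is affine in \<open>s\<close>, and
        this witness would give it the value -1.\<close>
      then show False using quad[of "(B + 1) / (2 * m)"] True by (simp add: field_simps)
    qed
    then show ?thesis using True by simp
  next
    case False
    then show ?thesis using quad[of "m / A"] A0 by (simp add: field_simps power2_eq_square)
  qed
  then have "m \<le> sqrt A * sqrt B" using real_le_rsqrt by (simp flip: real_sqrt_mult)
  moreover have "cmod (Ltwo_inner S f g) \<le> m"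
    using integral_norm_bound[of ?M "\<lambda>x. f x * cnj (g x)"] by (simp add: Ltwo_inner_def m_def norm_mult)
  ultimately show ?thesis by (simp add: Ltwo_norm_def A_def B_def)
qed

lemma integral_cauchy_schwarz:
  assumes "continuous_on {a..b} f" "continuous_on {a..b} g"
  shows "cmod (integral {a..b} (\<lambda>x. f x * g x)) \<le> Ltwo_norm {a..b} f * Ltwo_norm {a..b} g"
proof -
  have "Ltwo_norm {a..b} (\<lambda>x. cnj (g x)) = Ltwo_norm {a..b} g" by (simp add: Ltwo_norm_def)
  then show ?thesis
    using Ltwo_cauchy_schwarz[OF continuous_imp_Ltwo[OF assms(1)] continuous_imp_Ltwo[OF continuous_on_cnj[OF assms(2)]]]
      Ltwo_inner_continuous[OF assms(1) continuous_on_cnj[OF assms(2)]] by simp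
qed

section \<open>The Bloch operators in classical terms\<close>

definition multiplier :: "real \<Rightarrow> complex" where
  "multiplier t = exp (\<i> * of_real (pi * t))"

lemma multiplier_nonzero [simp]: "multiplier t \<noteq> 0" by (simp add: multiplier_def)

lemma multiplier_diff_inverse: "multiplier t - 1 / multiplier t = 2 * \<i> * of_real (sin (pi * t))"
  and multiplier_add_inverse: "multiplier t + 1 / multiplier t = of_real (2 * cos (pi * t))"
proof -
  have "multiplier t = cis (pi * t)" by (simp add: multiplier_def cis_conv_exp)
  then have "multiplier t = cis (pi * t)" "1 / multiplier t = cis (- (pi * t))"
    by (simp_all add: divide_inverse cis_inverse)
  then show "multiplier t - 1 / multiplier t = 2 * \<i> * of_real (sin (pi * t))"
    "multiplier t + 1 / multiplier t = of_real (2 * cos (pi * t))"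
    by (simp_all only:) (simp_all add: complex_eq_iff)
qed

text \<open>Elements of the domain in \<open>L_bloch\<close> vanish off \<open>{0..pi}\<close>, so a
  solution on the line has to be cut off before it can be one.\<close>

definition restr :: "(real \<Rightarrow> complex) \<Rightarrow> real \<Rightarrow> complex" where
  "restr y x = (if x \<in> {0..pi} then y x else 0)"

lemma ode_on_cong:
  assumes "ode_on S p f y y1" "\<And>x. x \<in> S \<Longrightarrow> y x = z x" "\<And>x. x \<in> S \<Longrightarrow> y1 x = z1 x"
  shows "ode_on S p f z z1"
  unfolding ode_on_def
proof (intro ballI conjI)
  fix x assume x: "x \<in> S"
  show "(z has_vector_derivative z1 x) (at x within S)"
    using assms x has_vector_derivative_transform[OF x, of z y] by (auto simp: ode_on_def)
  show "(z1 has_vector_derivative p x * z x - f x) (at x within S)"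
    using assms x has_vector_derivative_transform[OF x, of z1 y1] by (auto simp: ode_on_def)
qed

text \<open>With coefficient \<open>q_pot V x - \<mu>\<close>, the predicate \<open>ode_on\<close>
  reads \<open>- y'' + q y - \<mu> y = f\<close>. For continuous \<open>f\<close> this is the
  classical form of membership in \<open>shift (L_bloch V t) \<mu>\<close>.\<close>

definition bloch_solution :: "real \<Rightarrow> real \<Rightarrow> complex \<Rightarrow> (real \<Rightarrow> complex) \<Rightarrow> (real \<Rightarrow> complex) \<Rightarrow> (real \<Rightarrow> complex) \<Rightarrow> bool" where
  "bloch_solution V t \<mu> f y y1 \<longleftrightarrow> ode_on {0..pi} (\<lambda>x. q_pot V x - \<mu>) f y y1 \<and>
     y pi = multiplier t * y 0 \<and> y1 pi = multiplier t * y1 0 \<and> (\<forall>x. x \<notin> {0..pi} \<longrightarrow> y x = 0)"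

lemma AE_lebesgue_on_negligible:
  assumes "AE x in lebesgue_on S. P x" "S \<in> sets lebesgue"
  shows "\<exists>N. negligible N \<and> (\<forall>x\<in>S - N. P x)"
proof -
  have "AE x in lebesgue. x \<in> S \<longrightarrow> P x"
    using assms by (simp add: AE_restrict_space_iff)
  then obtain N where "N \<in> null_sets lebesgue" "{x \<in> space lebesgue. \<not> (x \<in> S \<longrightarrow> P x)} \<subseteq> N"
    unfolding eventually_ae_filter by blast
  then show ?thesis by (intro exI[of _ N]) (auto simp: negligible_iff_null_sets)
qed

text \<open>Regularity: the equation identifies \<open>y2\<close> almost everywhere with the
  continuous function \<open>h\<close>, so \<open>y1\<close> is an integral of \<open>h\<close> and
  the derivatives exist at every point.\<close>

lemma shift_bloch_imp_classical:
  assumes f: "continuous_on {0..pi} f" and yf: "(y, f) \<in> shift (L_bloch V t) \<mu>"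
  shows "\<exists>y1. bloch_solution V t \<mu> f y y1"
proof -
  obtain g where g: "(y, g) \<in> L_bloch V t" and fg: "f = (\<lambda>x. g x - \<mu> * y x)"
    using yf by (auto simp: shift_def)
  obtain y1 y2 where s: "sobolev22 {0..pi} y y1 y2" and bc: "y pi = multiplier t * y 0" "y1 pi = multiplier t * y1 0"
    and ae: "AE x in lebesgue_on {0..pi}. g x = - y2 x + q_pot V x * y x"
    using g by (auto simp: L_bloch_def multiplier_def)
  have i: "(y1 has_integral (y x - y 0)) {0..x}" "(y2 has_integral (y1 x - y1 0)) {0..x}" if "x \<in> {0..pi}" for x
    using s that by (auto simp: sobolev22_def)
  have ii: "y1 integrable_on {0..pi}" "y2 integrable_on {0..pi}"
    using i[of pi] by (auto simp: integrable_on_def)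
  have e: "y x = y 0 + integral {0..x} y1" "y1 x = y1 0 + integral {0..x} y2" if "x \<in> {0..pi}" for x
    using integral_unique[OF i(1)[OF that]] integral_unique[OF i(2)[OF that]] by simp_all
  have "continuous_on {0..pi} (\<lambda>x. y 0 + integral {0..x} y1)" "continuous_on {0..pi} (\<lambda>x. y1 0 + integral {0..x} y2)"
    by (intro continuous_intros indefinite_integral_continuous_1 ii)+
  note this[THEN continuous_on_eq]
  from this(1)[OF e(1)[symmetric]] this(2)[OF e(2)[symmetric]]
  have cy: "continuous_on {0..pi} y" and cy1: "continuous_on {0..pi} y1" by blast+
  define h where "h x = (q_pot V x - \<mu>) * y x - f x" for x
  have ch: "continuous_on {0..pi} h" unfolding h_def by (intro continuous_intros cy f)
  obtain N where N: "negligible N" "\<And>x. x \<in> {0..pi} - N \<Longrightarrow> g x = - y2 x + q_pot V x * y x"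
    using AE_lebesgue_on_negligible[OF ae] by auto
  have hy2: "h x = y2 x" if "x \<in> {0..pi} - N" for x
    using N(2)[OF that] by (simp add: h_def fg algebra_simps)
  have eh: "y1 x = y1 0 + integral {0..x} h" if "x \<in> {0..pi}" for x
  proof -
    have "(h has_integral (y1 x - y1 0)) {0..x}"
      by (rule has_integral_spike[OF N(1) _ i(2)[OF that]]) (use that in \<open>auto intro!: hy2\<close>)
    then show ?thesis by (simp add: integral_unique)
  qed
  have "ode_on {0..pi} (\<lambda>x. q_pot V x - \<mu>) f y y1"
    unfolding ode_on_def
  proof (intro ballI conjI)
    fix x assume x: "x \<in> {0..pi}"
    have "((\<lambda>x. y 0 + integral {0..x} y1) has_vector_derivative (0 + y1 x)) (at x within {0..pi})"
      by (intro has_vector_derivative_add has_vector_derivative_const integral_has_vector_derivative cy1 x)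
    then show "(y has_vector_derivative y1 x) (at x within {0..pi})"
      using has_vector_derivative_transform[OF x, of y "\<lambda>x. y 0 + integral {0..x} y1"] e(1) by (simp only: add_0)
    have "((\<lambda>x. y1 0 + integral {0..x} h) has_vector_derivative (0 + h x)) (at x within {0..pi})"
      by (intro has_vector_derivative_add has_vector_derivative_const integral_has_vector_derivative ch x)
    then show "(y1 has_vector_derivative (q_pot V x - \<mu>) * y x - f x) (at x within {0..pi})"
      using has_vector_derivative_transform[OF x, of y1 "\<lambda>x. y1 0 + integral {0..x} h"] eh by (simp only: add_0 h_def)
  qed
  then show ?thesis using s bc by (auto simp: bloch_solution_def sobolev22_def)
qed

lemma classical_imp_shift_bloch:
  assumes f: "continuous_on {0..pi} f" and b: "bloch_solution V t \<mu> f y y1"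
  shows "(y, f) \<in> shift (L_bloch V t) \<mu>"
proof -
  have o: "ode_on {0..pi} (\<lambda>x. q_pot V x - \<mu>) f y y1" using b by (simp add: bloch_solution_def)
  note c = ode_on_continuous[OF o]
  define y2 where "y2 x = (q_pot V x - \<mu>) * y x - f x" for x
  have c2: "continuous_on {0..pi} y2" unfolding y2_def by (intro continuous_intros c f)
  have "sobolev22 {0..pi} y y1 y2"
    unfolding sobolev22_def
  proof (intro conjI allI impI)
    show "y x = 0" if "x \<notin> {0..pi}" for x using b that by (simp add: bloch_solution_def)
    fix a c :: real assume ac: "a \<le> c \<and> {a..c} \<subseteq> {0..pi}"
    have "ode_on {a..c} (\<lambda>x. q_pot V x - \<mu>) f y y1" using ode_on_subset[OF o] ac by blast
    then show "(y1 has_integral y c - y a) {a..c}" "(y2 has_integral y1 c - y1 a) {a..c}"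
      using ac by (auto intro!: fundamental_theorem_of_calculus simp: ode_on_def y2_def)
  qed (intro continuous_imp_Ltwo c c2)+
  moreover have "(\<lambda>x. f x + \<mu> * y x) \<in> Ltwo {0..pi}"
    by (intro continuous_imp_Ltwo continuous_intros f c)
  moreover have "AE x in lebesgue_on {0..pi}. f x + \<mu> * y x = - y2 x + q_pot V x * y x"
    by (rule AE_I2) (simp add: y2_def algebra_simps)
  ultimately have "(y, \<lambda>x. f x + \<mu> * y x) \<in> L_bloch V t"
    using b unfolding L_bloch_def bloch_solution_def multiplier_def by blast
  then show ?thesis unfolding shift_def by force
qed

section \<open>Floquet data, kernel and range of the shifted Bloch operators\<close>

definition floquet :: "real \<Rightarrow> complex \<Rightarrow> complex \<Rightarrow> complex \<Rightarrow> complex \<Rightarrow> bool" where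
  "floquet V \<mu> \<rho> \<alpha> \<beta> \<longleftrightarrow> sol V \<mu> \<alpha> \<beta> pi = \<rho> * \<alpha> \<and> dsol V \<mu> \<alpha> \<beta> pi = \<rho> * \<beta>"

lemma floquet_pair_wronskian:
  assumes "\<rho> \<noteq> 0" "\<rho> \<noteq> 1 / \<rho>" "\<alpha> \<noteq> 0 \<or> \<beta> \<noteq> 0" "floquet V \<mu> \<rho> \<alpha> \<beta>"
    "\<gamma> \<noteq> 0 \<or> \<delta> \<noteq> 0" "floquet V \<mu> (1 / \<rho>) \<gamma> \<delta>"
  shows "\<alpha> * \<delta> - \<beta> * \<gamma> \<noteq> 0"
  by (rule floquet_wronskian[of \<rho> \<alpha> \<beta> V \<mu> \<gamma> \<delta>]) (use assms in \<open>auto simp: floquet_def\<close>)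

text \<open>The range annihilates the Floquet solution with the reciprocal multiplier, in the
  bilinear pairing without conjugation: the multipliers cancel in the Wronskian, whose values at 0
  and pi therefore agree.\<close>

lemma bloch_solution_orthogonal:
  assumes f: "continuous_on {0..pi} f" and b: "bloch_solution V t \<mu> f y y1"
    and z: "floquet V \<mu> (1 / multiplier t) \<gamma> \<delta>"
  shows "integral {0..pi} (\<lambda>x. f x * sol V \<mu> \<gamma> \<delta> x) = 0"
proof -
  have "((\<lambda>x. f x * sol V \<mu> \<gamma> \<delta> x) has_integral
     (y pi * dsol V \<mu> \<gamma> \<delta> pi - y1 pi * sol V \<mu> \<gamma> \<delta> pi) - (y 0 * \<delta> - y1 0 * \<gamma>)) {0..pi}"
    using wronskian_has_integral[of "{0..pi}" "\<lambda>x. q_pot V x - \<mu>" f y y1, OF _ ode_on_subset[OF ode_on_sol[of V \<mu> \<gamma> \<delta>]], of 0 pi] b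
    by (simp add: bloch_solution_def)
  moreover have "(y pi * dsol V \<mu> \<gamma> \<delta> pi - y1 pi * sol V \<mu> \<gamma> \<delta> pi) - (y 0 * \<delta> - y1 0 * \<gamma>) = 0"
    using b z by (simp add: bloch_solution_def floquet_def)
  ultimately show ?thesis by (simp add: integral_unique)
qed

text \<open>Variation of constants. The first coefficient is periodic because \<open>f\<close> is orthogonal to the
  second Floquet solution, and the constant in the second one is fixed by \<open>multiplier t \<noteq> 1 / multiplier t\<close>.\<close>

lemma bloch_solvable:
  assumes f: "continuous_on {0..pi} f" and t: "multiplier t \<noteq> 1 / multiplier t"
    and y: "\<alpha> \<noteq> 0 \<or> \<beta> \<noteq> 0" "floquet V \<mu> (multiplier t) \<alpha> \<beta>"
    and z: "\<gamma> \<noteq> 0 \<or> \<delta> \<noteq> 0" "floquet V \<mu> (1 / multiplier t) \<gamma> \<delta>"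
    and orth: "integral {0..pi} (\<lambda>x. f x * sol V \<mu> \<gamma> \<delta> x) = 0"
  shows "\<exists>u u1. bloch_solution V t \<mu> f u u1"
proof -
  let ?y = "sol V \<mu> \<alpha> \<beta>" and ?y1 = "dsol V \<mu> \<alpha> \<beta>" and ?z = "sol V \<mu> \<gamma> \<delta>" and ?z1 = "dsol V \<mu> \<gamma> \<delta>"
  define \<rho> where "\<rho> = multiplier t"
  have \<rho>: "\<rho> \<noteq> 0" "\<rho> * \<rho> \<noteq> 1" using t by (auto simp: \<rho>_def field_simps)
  define w where "w = \<alpha> * \<delta> - \<beta> * \<gamma>"
  have w0: "w \<noteq> 0"
    unfolding w_def by (rule floquet_pair_wronskian[OF multiplier_nonzero t y z])
  have w: "?y x * ?z1 x - ?y1 x * ?z x = w" for x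
    using wronskian_const[OF ode_on_sol[of V \<mu> \<alpha> \<beta>] ode_on_sol[of V \<mu> \<gamma> \<delta>] convex_UNIV, of x 0] by (simp add: w_def)
  define P where "P x = integral {0..x} (\<lambda>x. f x * ?z x)" for x
  define R where "R x = integral {0..x} (\<lambda>x. f x * ?y x)" for x
  \<comment> \<open>The solution of \<open>B0 - R pi / w = \<rho> * \<rho> * B0\<close>, which is
    the boundary condition for the component along the second Floquet solution, whose own multiplier
    is \<open>1 / \<rho>\<close>.\<close>
  define B0 where "B0 = - (R pi / w) / (\<rho> * \<rho> - 1)"
  define A where "A x = P x / w" for x
  define B where "B x = B0 - R x / w" for x
  define u where "u x = A x * ?y x + B x * ?z x" for x
  define u1 where "u1 x = A x * ?y1 x + B x * ?z1 x" for x
  have "ode_on {0..pi} (\<lambda>x. q_pot V x - \<mu>) f u u1"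
    unfolding ode_on_def
  proof (intro ballI conjI)
    fix x assume x: "x \<in> {0..pi}"
    have dP: "(P has_vector_derivative f x * ?z x) (at x within {0..pi})"
      unfolding P_def by (intro integral_has_vector_derivative continuous_intros f x)
    have dR: "(R has_vector_derivative f x * ?y x) (at x within {0..pi})"
      unfolding R_def by (intro integral_has_vector_derivative continuous_intros f x)
    have dA: "(A has_vector_derivative f x * ?z x / w) (at x within {0..pi})"
      unfolding A_def using has_vector_derivative_mult_left[OF dP, of "1 / w"] by simp
    have dB: "(B has_vector_derivative 0 - f x * ?y x / w) (at x within {0..pi})"
      unfolding B_def using has_vector_derivative_mult_left[OF dR, of "1 / w"]
      by (intro has_vector_derivative_diff has_vector_derivative_const) simp
    have o: "(?y has_vector_derivative ?y1 x) (at x within {0..pi})" "(?z has_vector_derivative ?z1 x) (at x within {0..pi})"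
      "(?y1 has_vector_derivative (q_pot V x - \<mu>) * ?y x) (at x within {0..pi})"
      "(?z1 has_vector_derivative (q_pot V x - \<mu>) * ?z x) (at x within {0..pi})"
      using ode_on_sol[of V \<mu> \<alpha> \<beta>] ode_on_sol[of V \<mu> \<gamma> \<delta>]
      by (auto simp: ode_on_def intro: has_vector_derivative_at_within)
    have "(u has_vector_derivative (A x * ?y1 x + f x * ?z x / w * ?y x) + (B x * ?z1 x + (0 - f x * ?y x / w) * ?z x))
        (at x within {0..pi})"
      unfolding u_def by (intro has_vector_derivative_add has_vector_derivative_mult dA dB o)
    then show "(u has_vector_derivative u1 x) (at x within {0..pi})"
      by (simp add: u1_def mult_ac)
    have "(u1 has_vector_derivative (A x * ((q_pot V x - \<mu>) * ?y x) + f x * ?z x / w * ?y1 x) +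
       (B x * ((q_pot V x - \<mu>) * ?z x) + (0 - f x * ?y x / w) * ?z1 x)) (at x within {0..pi})"
      unfolding u1_def by (intro has_vector_derivative_add has_vector_derivative_mult dA dB o)
    moreover have "(A x * ((q_pot V x - \<mu>) * ?y x) + f x * ?z x / w * ?y1 x) +
       (B x * ((q_pot V x - \<mu>) * ?z x) + (0 - f x * ?y x / w) * ?z1 x) =
       (q_pot V x - \<mu>) * u x - f x / w * (?y x * ?z1 x - ?y1 x * ?z x)"
      by (simp add: u_def algebra_simps)
    ultimately show "(u1 has_vector_derivative (q_pot V x - \<mu>) * u x - f x) (at x within {0..pi})"
      unfolding w using w0 by simp
  qed
  then have "ode_on {0..pi} (\<lambda>x. q_pot V x - \<mu>) f (restr u) u1"
    by (rule ode_on_cong) (auto simp: restr_def)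
  moreover have A: "A 0 = 0" "A pi = 0" using orth by (simp_all add: A_def P_def)
  moreover have B: "B 0 = B0" "B pi / \<rho> = \<rho> * B0"
  proof -
    show "B 0 = B0" by (simp add: B_def R_def)
    have "B0 * (\<rho> * \<rho> - 1) = - (R pi / w)" using \<rho> by (simp add: B0_def)
    then have "R pi / w = B0 - B0 * (\<rho> * \<rho>)" by (simp add: algebra_simps)
    then show "B pi / \<rho> = \<rho> * B0" unfolding B_def using \<rho> by (simp add: field_simps)
  qed
  moreover have Bc: "B pi * c / \<rho> = \<rho> * (B0 * c)" for c
    using arg_cong[OF B(2), of "\<lambda>v. v * c"] by (simp add: mult.assoc)
  moreover have "restr u pi = \<rho> * restr u 0"
    using B z(2) Bc by (simp add: restr_def u_def A floquet_def \<rho>_def[symmetric])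
  moreover have "u1 pi = \<rho> * u1 0"
    using B z(2) Bc by (simp add: u1_def A floquet_def \<rho>_def[symmetric])
  ultimately have "bloch_solution V t \<mu> f (restr u) u1"
    by (auto simp: bloch_solution_def restr_def \<rho>_def)
  then show ?thesis by blast
qed

lemma kernel_iff:
  "(y, \<lambda>_. 0) \<in> shift (L_bloch V t) \<mu> \<longleftrightarrow> (\<exists>\<alpha> \<beta>. y = restr (sol V \<mu> \<alpha> \<beta>) \<and> floquet V \<mu> (multiplier t) \<alpha> \<beta>)"
proof
  assume "(y, \<lambda>_. 0) \<in> shift (L_bloch V t) \<mu>"
  then obtain y1 where b: "bloch_solution V t \<mu> (\<lambda>_. 0) y y1"
    using shift_bloch_imp_classical[OF continuous_on_const] by blast
  define \<alpha> \<beta> where "\<alpha> = y 0" and "\<beta> = y1 0"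
  have e: "y x = sol V \<mu> \<alpha> \<beta> x" "y1 x = dsol V \<mu> \<alpha> \<beta> x" if "x \<in> {0..pi}" for x
    using ode_on_eq_sol[of "{0..pi}" V \<mu> y y1 x] that b unfolding bloch_solution_def \<alpha>_def \<beta>_def by auto
  have "y x = restr (sol V \<mu> \<alpha> \<beta>) x" for x
    using b e(1)[of x] unfolding restr_def bloch_solution_def by (cases "x \<in> {0..pi}") auto
  then have "y = restr (sol V \<mu> \<alpha> \<beta>)" by (rule ext)
  moreover have "floquet V \<mu> (multiplier t) \<alpha> \<beta>"
    using e[of pi] b by (simp add: floquet_def bloch_solution_def \<alpha>_def \<beta>_def)
  ultimately show "\<exists>\<alpha> \<beta>. y = restr (sol V \<mu> \<alpha> \<beta>) \<and> floquet V \<mu> (multiplier t) \<alpha> \<beta>" by blast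
next
  assume "\<exists>\<alpha> \<beta>. y = restr (sol V \<mu> \<alpha> \<beta>) \<and> floquet V \<mu> (multiplier t) \<alpha> \<beta>"
  then obtain \<alpha> \<beta> where y: "y = restr (sol V \<mu> \<alpha> \<beta>)" and fl: "floquet V \<mu> (multiplier t) \<alpha> \<beta>" by blast
  have "ode_on {0..pi} (\<lambda>x. q_pot V x - \<mu>) (\<lambda>_. 0) y (dsol V \<mu> \<alpha> \<beta>)"
    by (rule ode_on_cong[OF ode_on_subset[OF ode_on_sol]]) (auto simp: y restr_def)
  then have "bloch_solution V t \<mu> (\<lambda>_. 0) y (dsol V \<mu> \<alpha> \<beta>)"
    using fl by (simp add: bloch_solution_def floquet_def y restr_def)
  then show "(y, \<lambda>_. 0) \<in> shift (L_bloch V t) \<mu>"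
    by (rule classical_imp_shift_bloch[OF continuous_on_const])
qed

lemma restr_sol_eq_0_iff: "restr (sol V \<mu> \<alpha> \<beta>) = (\<lambda>_. 0) \<longleftrightarrow> \<alpha> = 0 \<and> \<beta> = 0"
proof
  assume r: "restr (sol V \<mu> \<alpha> \<beta>) = (\<lambda>_. 0)"
  have y0: "sol V \<mu> \<alpha> \<beta> x = 0" if "x \<in> {0..pi}" for x
    using fun_cong[OF r, of x] that by (simp add: restr_def)
  have x: "pi / 2 \<in> {0<..<pi}" by simp
  have "(sol V \<mu> \<alpha> \<beta> has_vector_derivative dsol V \<mu> \<alpha> \<beta> (pi/2)) (at (pi/2))"
    using ode_on_sol[of V \<mu> \<alpha> \<beta>] unfolding ode_on_def by blast
  moreover have "(sol V \<mu> \<alpha> \<beta> has_vector_derivative 0) (at (pi/2))"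
    by (rule has_vector_derivative_transform_within_open[OF has_vector_derivative_const[of 0] open_greaterThanLessThan x])
      (use y0 in auto)
  ultimately have y1: "dsol V \<mu> \<alpha> \<beta> (pi/2) = 0" by (rule vector_derivative_unique_at)
  have "\<alpha> * \<delta> - \<beta> * \<gamma> = 0" for \<gamma> \<delta>
    using wronskian_const[OF ode_on_sol[of V \<mu> \<alpha> \<beta>] ode_on_sol[of V \<mu> \<gamma> \<delta>] convex_UNIV, of 0 "pi/2"]
    by (simp add: y1 y0)
  from this[of 1 0] this[of 0 1] show "\<alpha> = 0 \<and> \<beta> = 0" by simp
next
  assume "\<alpha> = 0 \<and> \<beta> = 0"
  moreover have "sol V \<mu> 0 0 x = 0" for x
    using sol_lincomb[of V \<mu> 0 0 x] by simp
  ultimately show "restr (sol V \<mu> \<alpha> \<beta>) = (\<lambda>_. 0)"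
    unfolding restr_def by auto
qed

text \<open>By \<open>deriv_disc_floquet\<close> a nonzero derivative of the discriminant keeps the
  pairing of two nontrivial Floquet solutions nonzero. This is what rules out Jordan chains.\<close>

lemma integral_floquet_zero_imp:
  assumes t: "multiplier t \<noteq> 1 / multiplier t" and d: "deriv (disc V) \<mu> \<noteq> 0"
    and y: "floquet V \<mu> (multiplier t) \<alpha> \<beta>" and z: "\<gamma> \<noteq> 0 \<or> \<delta> \<noteq> 0" "floquet V \<mu> (1 / multiplier t) \<gamma> \<delta>"
    and i: "integral {0..pi} (\<lambda>x. sol V \<mu> \<alpha> \<beta> x * sol V \<mu> \<gamma> \<delta> x) = 0"
  shows "\<alpha> = 0 \<and> \<beta> = 0"
proof (rule ccontr)
  assume "\<not> (\<alpha> = 0 \<and> \<beta> = 0)"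
  then have "\<alpha> * \<delta> - \<beta> * \<gamma> \<noteq> 0"
    using floquet_pair_wronskian[OF multiplier_nonzero t _ y z] by blast
  moreover have "deriv (disc V) \<mu> * (\<alpha> * \<delta> - \<beta> * \<gamma>) = 0"
    using deriv_disc_floquet[OF multiplier_nonzero[of t], of V \<mu> \<alpha> \<beta> \<gamma> \<delta>] y z(2) i by (simp add: floquet_def)
  ultimately show False using d by simp
qed

lemma floquet_pair:
  assumes "disc V \<mu> = multiplier t + 1 / multiplier t"
  obtains \<alpha> \<beta> \<gamma> \<delta> where "\<alpha> \<noteq> 0 \<or> \<beta> \<noteq> 0" "floquet V \<mu> (multiplier t) \<alpha> \<beta>" "\<gamma> \<noteq> 0 \<or> \<delta> \<noteq> 0" "floquet V \<mu> (1 / multiplier t) \<gamma> \<delta>"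
proof -
  obtain \<alpha> \<beta> where 1: "\<alpha> \<noteq> 0 \<or> \<beta> \<noteq> 0" "floquet V \<mu> (multiplier t) \<alpha> \<beta>"
    using floquet_exists[OF assms multiplier_nonzero] unfolding floquet_def by blast
  have "disc V \<mu> = 1 / multiplier t + 1 / (1 / multiplier t)" using assms by simp
  then obtain \<gamma> \<delta> where "\<gamma> \<noteq> 0 \<or> \<delta> \<noteq> 0" "floquet V \<mu> (1 / multiplier t) \<gamma> \<delta>"
    using floquet_exists[of V \<mu> "1 / multiplier t"] unfolding floquet_def by auto
  with 1 show ?thesis by (rule that)
qed

text \<open>Distinct multipliers leave a single Floquet direction in the kernel. A longer Jordan
  chain would put a nonzero kernel element into the range; its pairing with the reciprocal Floquet
  solution would vanish, which the nonzero derivative forbids.\<close>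

lemma simple_eigenvalueI:
  assumes t: "multiplier t \<noteq> 1 / multiplier t" and disc: "disc V \<mu> = multiplier t + 1 / multiplier t" and d: "deriv (disc V) \<mu> \<noteq> 0"
  shows "simple_eigenvalue V t \<mu>"
proof -
  obtain \<alpha> \<beta> \<gamma> \<delta> where y: "\<alpha> \<noteq> 0 \<or> \<beta> \<noteq> 0" "floquet V \<mu> (multiplier t) \<alpha> \<beta>"
    and z: "\<gamma> \<noteq> 0 \<or> \<delta> \<noteq> 0" "floquet V \<mu> (1 / multiplier t) \<gamma> \<delta>"
    using floquet_pair[OF disc] by blast
  let ?R = "shift (L_bloch V t) \<mu>" and ?v = "restr (sol V \<mu> \<alpha> \<beta>)"
  have w0: "\<alpha> * \<delta> - \<beta> * \<gamma> \<noteq> 0"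
    by (rule floquet_pair_wronskian[OF multiplier_nonzero t y z])
  have range: "f = (\<lambda>_. 0)" if yf: "(u, f) \<in> ?R" and f: "(f, \<lambda>_. 0) \<in> ?R" for u f
  proof -
    obtain a b where ab: "f = restr (sol V \<mu> a b)" "floquet V \<mu> (multiplier t) a b"
      using f unfolding kernel_iff by blast
    have fx: "f x = sol V \<mu> a b x" if "x \<in> {0..pi}" for x using that ab(1) by (simp add: restr_def)
    have cf: "continuous_on {0..pi} f"
      by (rule continuous_on_eq[OF continuous_on_sol(1)]) (use fx in auto)
    obtain u1 where "bloch_solution V t \<mu> f u u1" using shift_bloch_imp_classical[OF cf yf] by blast
    from bloch_solution_orthogonal[OF cf this z(2)]
    have "integral {0..pi} (\<lambda>x. f x * sol V \<mu> \<gamma> \<delta> x) = 0" .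
    also have "integral {0..pi} (\<lambda>x. f x * sol V \<mu> \<gamma> \<delta> x) = integral {0..pi} (\<lambda>x. sol V \<mu> a b x * sol V \<mu> \<gamma> \<delta> x)"
      by (rule integral_cong) (simp add: fx)
    finally have "a = 0 \<and> b = 0" using integral_floquet_zero_imp[OF t d ab(2) z] by blast
    then show ?thesis using ab(1) restr_sol_eq_0_iff by blast
  qed
  \<comment> \<open>Chains collapse: the second element of a chain lies in the range and, by
    induction, in the kernel, so it is zero.\<close>
  have "(u, \<lambda>_. 0) \<in> ?R ^^ k \<Longrightarrow> (u, \<lambda>_. 0) \<in> ?R" for u k
  proof (induction k arbitrary: u)
    case 0
    then have "u = (\<lambda>_. 0)" by simp
    then have "u = restr (sol V \<mu> 0 0)" using restr_sol_eq_0_iff[of V \<mu> 0 0] by simp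
    moreover have "floquet V \<mu> (multiplier t) 0 0"
      by (simp add: floquet_def sol_lincomb[of V \<mu> 0 0] dsol_lincomb[of V \<mu> 0 0])
    ultimately show ?case unfolding kernel_iff by (intro exI conjI)
  next
    case (Suc k)
    obtain f where f: "(u, f) \<in> ?R" "(f, \<lambda>_. 0) \<in> ?R ^^ k"
      using relpow_Suc_D2[OF Suc.prems] by blast
    show ?case using f(1) unfolding range[OF f(1) Suc.IH[OF f(2)]] .
  qed
  moreover have "(u, \<lambda>_. 0) \<in> ?R \<Longrightarrow> (u, \<lambda>_. 0) \<in> ?R ^^ 1" for u
    by (simp only: relpow_1)
  ultimately have "root_space (L_bloch V t) \<mu> = {u. (u, \<lambda>_. 0) \<in> ?R}"
    unfolding root_space_def by blast
  also have "\<dots> = cfun.span {?v}"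
  proof -
    have scale: "restr (sol V \<mu> (k * \<alpha>) (k * \<beta>)) = (\<lambda>x. k * ?v x)" for k
      by (rule ext) (simp add: restr_def sol_combine[of V \<mu> k \<alpha> 0 0 \<beta> 0, simplified])
    have "(u, \<lambda>_. 0) \<in> ?R \<longleftrightarrow> (\<exists>k. u = (\<lambda>x. k * ?v x))" for u
    proof
      assume "(u, \<lambda>_. 0) \<in> ?R"
      then obtain a b where ab: "u = restr (sol V \<mu> a b)" "floquet V \<mu> (multiplier t) a b"
        unfolding kernel_iff by blast
      \<comment> \<open>Chosen so that subtracting \<open>k\<close> times the first Floquet datum
        leaves determinant zero with the second; independence then forces the remainder to
        vanish.\<close>
      define k where "k = (a * \<delta> - b * \<gamma>) / (\<alpha> * \<delta> - \<beta> * \<gamma>)"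
      have "floquet V \<mu> (multiplier t) (a - k * \<alpha>) (b - k * \<beta>)"
        using ab(2) y(2) sol_combine[of V \<mu> 1 a "- k" \<alpha> b \<beta> pi] dsol_combine[of V \<mu> 1 a "- k" \<alpha> b \<beta> pi]
        by (simp add: floquet_def algebra_simps)
      moreover have "(a - k * \<alpha>) * \<delta> - (b - k * \<beta>) * \<gamma> = (a * \<delta> - b * \<gamma>) - k * (\<alpha> * \<delta> - \<beta> * \<gamma>)"
        by (simp add: algebra_simps)
      then have "(a - k * \<alpha>) * \<delta> - (b - k * \<beta>) * \<gamma> = 0" using w0 by (simp add: k_def)
      ultimately have "a - k * \<alpha> = 0 \<and> b - k * \<beta> = 0"
        using floquet_pair_wronskian[OF multiplier_nonzero t _ _ z] by blast
      then have "u = (\<lambda>x. k * ?v x)" unfolding scale[symmetric] ab(1) by simp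
      then show "\<exists>k. u = (\<lambda>x. k * ?v x)" by blast
    next
      assume "\<exists>k. u = (\<lambda>x. k * ?v x)"
      then obtain k where "u = (\<lambda>x. k * ?v x)" by blast
      then have "u = restr (sol V \<mu> (k * \<alpha>) (k * \<beta>))" by (simp only: scale)
      moreover have "floquet V \<mu> (multiplier t) (k * \<alpha>) (k * \<beta>)"
        using y(2) sol_combine[of V \<mu> k \<alpha> 0 0 \<beta> 0 pi] dsol_combine[of V \<mu> k \<alpha> 0 0 \<beta> 0 pi]
        by (simp add: floquet_def)
      ultimately show "(u, \<lambda>_. 0) \<in> ?R" unfolding kernel_iff by (intro exI conjI)
    qed
    moreover have "cfun.span {?v} = {u. \<exists>k. u = (\<lambda>x. k * ?v x)}"
      unfolding cfun.span_singleton by blast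
    ultimately show ?thesis by (simp only:)
  qed
  finally have "root_space (L_bloch V t) \<mu> = cfun.span {?v}" .
  moreover have "?v \<noteq> 0"
    using y(1) restr_sol_eq_0_iff[of V \<mu> \<alpha> \<beta>] by (auto simp: zero_fun_def)
  ultimately have "algebraic_multiplicity (L_bloch V t) \<mu> = 1"
    unfolding algebraic_multiplicity_def
    using cfun.dim_span_eq_card_independent[of "{?v}"] by simp
  then show ?thesis by (simp add: simple_eigenvalue_def)
qed

text \<open>A nonzero root vector starts a chain whose last nonzero element is an eigenfunction, and
  its data form an eigenvector of the monodromy matrix. This is how the multiplicity count in the
  numbering leads back to the discriminant.\<close>

lemma algebraic_multiplicity_nonzero_imp:
  assumes "algebraic_multiplicity (L_bloch V t) \<mu> \<noteq> 0"
  shows "disc V \<mu> = multiplier t + 1 / multiplier t"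
proof -
  let ?R = "shift (L_bloch V t) \<mu>"
  have "\<exists>u\<in>root_space (L_bloch V t) \<mu>. u \<noteq> (\<lambda>_. 0)"
  proof (rule ccontr)
    assume "\<not> ?thesis"
    then have "u = (\<lambda>_. 0)" if "u \<in> root_space (L_bloch V t) \<mu>" for u using that by blast
    then have "root_space (L_bloch V t) \<mu> \<subseteq> {\<lambda>_. 0}" by (intro subsetI singletonI) simp
    then have "root_space (L_bloch V t) \<mu> \<subseteq> {0}" by (simp only: zero_fun_def)
    from cfun.span_mono[OF this] have "cfun.span (root_space (L_bloch V t) \<mu>) \<subseteq> {0}"
      by (simp only: cfun.span_insert_0 cfun.span_empty)
    moreover have "{0} \<subseteq> cfun.span (root_space (L_bloch V t) \<mu>)"
      by (intro subsetI) (simp only: singleton_iff cfun.span_zero)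
    ultimately have "cfun.span {} = cfun.span (root_space (L_bloch V t) \<mu>)"
      unfolding cfun.span_empty by (rule subset_antisym[rotated])
    from cfun.dim_eq_card[OF this cfun.independent_empty]
    have "cfun.dim (root_space (L_bloch V t) \<mu>) = 0" by (simp only: card.empty)
    then show False using assms by (simp add: algebraic_multiplicity_def)
  qed
  then obtain u k where "(u, \<lambda>_. 0) \<in> ?R ^^ k" "u \<noteq> (\<lambda>_. 0)" unfolding root_space_def by blast
  then have "\<exists>v. v \<noteq> (\<lambda>_. 0) \<and> (v, \<lambda>_. 0) \<in> ?R"
  proof (induction k arbitrary: u)
    case (Suc k)
    obtain f where f: "(u, f) \<in> ?R" "(f, \<lambda>_. 0) \<in> ?R ^^ k"
      using relpow_Suc_D2[OF Suc.prems(1)] by blast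
    show ?case
    proof (cases "f = (\<lambda>_. 0)")
      case True
      then show ?thesis using f(1) Suc.prems(2) by blast
    next
      case False
      then show ?thesis using Suc.IH[OF f(2)] by blast
    qed
  qed simp
  then obtain \<alpha> \<beta> where "restr (sol V \<mu> \<alpha> \<beta>) \<noteq> (\<lambda>_. 0)" "floquet V \<mu> (multiplier t) \<alpha> \<beta>"
    unfolding kernel_iff by blast
  then have "\<alpha> \<noteq> 0 \<or> \<beta> \<noteq> 0" unfolding restr_sol_eq_0_iff by blast
  then show ?thesis
    using floquet_disc[of \<alpha> \<beta> V \<mu> "multiplier t"] \<open>floquet V \<mu> (multiplier t) \<alpha> \<beta>\<close> by (simp add: floquet_def)
qed


section \<open>The bound for \<open>d\<close> in terms of the derivative of the discriminant\<close>

lemma Ltwo_norm_cong: "(\<And>x. x \<in> S \<Longrightarrow> f x = g x) \<Longrightarrow> Ltwo_norm S f = Ltwo_norm S g"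
  unfolding Ltwo_norm_def by (intro arg_cong[where f = sqrt] Bochner_Integration.integral_cong) auto

lemma Ltwo_norm_nonneg [simp]: "Ltwo_norm S f \<ge> 0"
  by (simp add: Ltwo_norm_def)

lemma Ltwo_norm_le:
  assumes f: "continuous_on {a..b} f" and "a \<le> b" and le: "\<And>x. x \<in> {a..b} \<Longrightarrow> cmod (f x) \<le> G"
  shows "Ltwo_norm {a..b} f \<le> G * sqrt (b - a)"
proof -
  have G: "G \<ge> 0" using order_trans[OF norm_ge_zero le[of a]] \<open>a \<le> b\<close> by simp
  have "integral {a..b} (\<lambda>x. (cmod (f x))\<^sup>2) \<le> integral {a..b} (\<lambda>x. G\<^sup>2)"
    by (intro integral_le integrable_continuous_real continuous_intros f power_mono le) auto
  then have "sqrt (integral {a..b} (\<lambda>x. (cmod (f x))\<^sup>2)) \<le> sqrt (G\<^sup>2 * (b - a))"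
    using \<open>a \<le> b\<close> by (intro real_sqrt_le_mono) (simp add: mult.commute)
  then show ?thesis using G by (simp add: Ltwo_norm_continuous[OF f] real_sqrt_mult)
qed

lemma continuous_on_Icc_bounded:
  fixes f :: "real \<Rightarrow> complex"
  assumes "continuous_on {a..b} f"
  shows "\<exists>B. \<forall>x\<in>{a..b}. cmod (f x) \<le> B"
  using compact_imp_bounded[OF compact_continuous_image[OF assms compact_Icc]] by (auto simp: bounded_iff)

text \<open>Testing the equation against \<open>\<eta>\<close> and integrating by parts leaves only boundary terms at \<open>0\<close>.\<close>

lemma test_function_bound:
  assumes \<eta>: "\<And>x. (\<eta> has_vector_derivative \<eta>1 x) (at x)" "\<And>x. (\<eta>1 has_vector_derivative \<eta>2 x) (at x)"
    and c2: "continuous_on {0..pi} \<eta>2" and z: "\<eta> pi = 0" "\<eta>1 pi = 0"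
  shows "\<exists>C\<ge>0. \<forall>\<mu> \<alpha> \<beta>. cmod \<mu> \<le> R \<longrightarrow>
    cmod (\<alpha> * \<eta>1 0 - \<beta> * \<eta> 0) \<le> C * Ltwo_norm {0..pi} (sol V \<mu> \<alpha> \<beta>)"
proof -
  have c: "continuous_on {0..pi} \<eta>"
    using \<eta>(1) has_vector_derivative_continuous by (blast intro: continuous_at_imp_continuous_on)
  obtain E where E: "\<And>x. x \<in> {0..pi} \<Longrightarrow> cmod (\<eta> x) \<le> E"
    using continuous_on_Icc_bounded[OF c] by blast
  obtain E2 where E2: "\<And>x. x \<in> {0..pi} \<Longrightarrow> cmod (\<eta>2 x) \<le> E2"
    using continuous_on_Icc_bounded[OF c2] by blast
  define Q where "Q = \<bar>1 + 2 * V\<bar> + \<bar>1 - 2 * V\<bar>"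
  define G where "G = (Q + R) * E + E2"
  have "cmod (\<alpha> * \<eta>1 0 - \<beta> * \<eta> 0) \<le> \<bar>G * sqrt pi\<bar> * Ltwo_norm {0..pi} (sol V \<mu> \<alpha> \<beta>)"
    if R: "cmod \<mu> \<le> R" for \<mu> \<alpha> \<beta>
  proof -
    let ?y = "sol V \<mu> \<alpha> \<beta>"
    define g where "g x = (q_pot V x - \<mu>) * \<eta> x - \<eta>2 x" for x
    have cg: "continuous_on {0..pi} g" unfolding g_def by (intro continuous_intros c c2)
    have "ode_on {0..pi} (\<lambda>x. q_pot V x - \<mu>) g \<eta> \<eta>1"
      unfolding ode_on_def g_def using \<eta> by (auto intro: has_vector_derivative_at_within)
    from wronskian_has_integral[OF ode_on_subset[OF ode_on_sol[of V \<mu> \<alpha> \<beta>]] this, of 0 pi]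
    have "((\<lambda>x. - (?y x * g x)) has_integral - (\<alpha> * \<eta>1 0 - \<beta> * \<eta> 0)) {0..pi}"
      by (simp add: z)
    from arg_cong[OF integral_unique[OF this], of uminus] have "\<alpha> * \<eta>1 0 - \<beta> * \<eta> 0 = integral {0..pi} (\<lambda>x. ?y x * g x)"
      by simp
    then have "cmod (\<alpha> * \<eta>1 0 - \<beta> * \<eta> 0) \<le> Ltwo_norm {0..pi} ?y * Ltwo_norm {0..pi} g"
      using integral_cauchy_schwarz[OF continuous_on_sol(1) cg] by simp
    also have "Ltwo_norm {0..pi} g \<le> G * sqrt (pi - 0)"
    proof (rule Ltwo_norm_le[OF cg])
      fix x assume x: "x \<in> {0..pi}"
      have "cmod (q_pot V x - \<mu>) \<le> Q + R"
        using norm_triangle_ineq4[of "q_pot V x" \<mu>] cmod_q_pot_le[of V x] R by (simp add: Q_def)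
      then have "cmod ((q_pot V x - \<mu>) * \<eta> x) \<le> (Q + R) * E"
        unfolding norm_mult using E[OF x] by (intro mult_mono) (auto intro: order_trans[OF norm_ge_zero])
      then show "cmod (g x) \<le> G"
        unfolding g_def G_def using E2[OF x] norm_triangle_ineq4[of "(q_pot V x - \<mu>) * \<eta> x" "\<eta>2 x"] by linarith
    qed simp
    then have "Ltwo_norm {0..pi} ?y * Ltwo_norm {0..pi} g \<le> Ltwo_norm {0..pi} ?y * \<bar>G * sqrt pi\<bar>"
      by (intro mult_left_mono) auto
    finally show ?thesis by (simp add: mult.commute)
  qed
  then show ?thesis by (intro exI[of _ "\<bar>G * sqrt pi\<bar>"]) auto
qed

text \<open>Turns normalization in the mean square into control of the Wronskian of two Floquet
  solutions, with one constant for all \<mu> in a disc.\<close>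

lemma initial_data_bound:
  "\<exists>C\<ge>0. \<forall>\<mu> \<alpha> \<beta>. cmod \<mu> \<le> R \<longrightarrow> cmod \<alpha> \<le> C * Ltwo_norm {0..pi} (sol V \<mu> \<alpha> \<beta>) \<and>
     cmod \<beta> \<le> C * Ltwo_norm {0..pi} (sol V \<mu> \<alpha> \<beta>)"
proof -
  define c where "c = complex_of_real (1 / pi)"
  have cp: "c * of_real pi = 1" by (simp add: c_def)
  have d: "((\<lambda>x. f (of_real x)) has_vector_derivative f' (of_real x)) (at x)"
    if "\<And>z. (f has_field_derivative f' z) (at z)" for f f' :: "complex \<Rightarrow> complex" and x
    using has_vector_derivative_real_field[OF that] by simp
  \<comment> \<open>\<open>p\<close> and \<open>r\<close> are cubic Hermite polynomials on
    \<open>{0..pi}\<close>: both have a double zero at pi, and their values and slopes at 0 are (0,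
    1) and (1, 0), which isolates \<alpha> and \<beta>.\<close>
  define p where "p z = z * (1 - c * z)\<^sup>2" for z
  define p1 where "p1 z = (1 - c * z)\<^sup>2 - 2 * c * z * (1 - c * z)" for z
  define p2 where "p2 z = - 4 * c * (1 - c * z) + 2 * c * c * z" for z
  define r where "r z = (1 - c * z)\<^sup>2 * (1 + 2 * c * z)" for z
  define r1 where "r1 z = - 6 * c * c * z * (1 - c * z)" for z
  define r2 where "r2 z = - 6 * c * c * (1 - 2 * c * z)" for z
  have dp: "(p has_field_derivative p1 z) (at z)" for z
    unfolding p_def[abs_def] p1_def
    by (auto intro!: derivative_eq_intros simp: algebra_simps power2_eq_square)
  have dp1: "(p1 has_field_derivative p2 z) (at z)" for z
    unfolding p1_def[abs_def] p2_def
    by (auto intro!: derivative_eq_intros simp: algebra_simps power2_eq_square)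
  have dr: "(r has_field_derivative r1 z) (at z)" for z
    unfolding r_def[abs_def] r1_def
    by (auto intro!: derivative_eq_intros) (simp add: algebra_simps power2_eq_square)
  have dr1: "(r1 has_field_derivative r2 z) (at z)" for z
    unfolding r1_def[abs_def] r2_def
    by (auto intro!: derivative_eq_intros simp: algebra_simps)
  have "\<exists>C\<ge>0. \<forall>\<mu> \<alpha> \<beta>. cmod \<mu> \<le> R \<longrightarrow>
    cmod (\<alpha> * p1 (of_real 0) - \<beta> * p (of_real 0)) \<le> C * Ltwo_norm {0..pi} (sol V \<mu> \<alpha> \<beta>)"
    by (rule test_function_bound[OF d[OF dp] d[OF dp1]])
      (auto simp: p_def p1_def p2_def cp intro!: continuous_intros)
  then obtain C where C: "C \<ge> 0" "\<And>\<mu> \<alpha> \<beta>. cmod \<mu> \<le> R \<Longrightarrow> cmod \<alpha> \<le> C * Ltwo_norm {0..pi} (sol V \<mu> \<alpha> \<beta>)"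
    by (auto simp: p_def p1_def)
  have "\<exists>C\<ge>0. \<forall>\<mu> \<alpha> \<beta>. cmod \<mu> \<le> R \<longrightarrow>
    cmod (\<alpha> * r1 (of_real 0) - \<beta> * r (of_real 0)) \<le> C * Ltwo_norm {0..pi} (sol V \<mu> \<alpha> \<beta>)"
    by (rule test_function_bound[OF d[OF dr] d[OF dr1]])
      (auto simp: r_def r1_def r2_def cp intro!: continuous_intros)
  then obtain D where D: "D \<ge> 0" "\<And>\<mu> \<alpha> \<beta>. cmod \<mu> \<le> R \<Longrightarrow> cmod \<beta> \<le> D * Ltwo_norm {0..pi} (sol V \<mu> \<alpha> \<beta>)"
    by (auto simp: r_def r1_def)
  have "cmod \<alpha> \<le> max C D * Ltwo_norm {0..pi} (sol V \<mu> \<alpha> \<beta>) \<and> cmod \<beta> \<le> max C D * Ltwo_norm {0..pi} (sol V \<mu> \<alpha> \<beta>)"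
    if "cmod \<mu> \<le> R" for \<mu> \<alpha> \<beta>
    using C(2)[OF that, of \<alpha> \<beta>] D(2)[OF that, of \<beta> \<alpha>] mult_right_mono[OF max.cobounded1[of C D] Ltwo_norm_nonneg[of "{0..pi}" "sol V \<mu> \<alpha> \<beta>"]]
      mult_right_mono[OF max.cobounded2[of D C] Ltwo_norm_nonneg[of "{0..pi}" "sol V \<mu> \<alpha> \<beta>"]]
    by linarith
  then show ?thesis using C(1) by (intro exI[of _ "max C D"]) (auto simp: le_max_iff_disj)
qed

lemma Ltwo_norm_sol_pos:
  assumes "\<alpha> \<noteq> 0 \<or> \<beta> \<noteq> 0"
  shows "Ltwo_norm {0..pi} (sol V \<mu> \<alpha> \<beta>) > 0"
proof (rule ccontr)
  assume "\<not> ?thesis"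
  then have "Ltwo_norm {0..pi} (sol V \<mu> \<alpha> \<beta>) = 0" using Ltwo_norm_nonneg[of "{0..pi}" "sol V \<mu> \<alpha> \<beta>"] by linarith
  moreover obtain C where "cmod \<alpha> \<le> C * Ltwo_norm {0..pi} (sol V \<mu> \<alpha> \<beta>)" "cmod \<beta> \<le> C * Ltwo_norm {0..pi} (sol V \<mu> \<alpha> \<beta>)"
    using initial_data_bound[of "cmod \<mu>" V] by blast
  ultimately show False using assms by simp
qed

text \<open>Up to a small multiple \<open>\<epsilon>\<close> of the conjugate of the second Floquet solution, the eigenfunction
  lies in the range of \<open>L\<^sub>t(V) - \<mu>\<close>, hence is almost orthogonal to the adjoint eigenfunction.\<close>

lemma d_bound:
  "\<exists>C. \<forall>\<mu> t u v. cmod \<mu> \<le> R \<longrightarrow> multiplier t \<noteq> 1 / multiplier t \<longrightarrow>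
    normalized_eigenfunction {0..pi} (L_bloch V t) \<mu> u \<longrightarrow>
    normalized_eigenfunction {0..pi} (adjoint_graph {0..pi} (L_bloch V t)) (cnj \<mu>) v \<longrightarrow>
    cmod (Ltwo_inner {0..pi} u v) * cmod (multiplier t - 1 / multiplier t) \<le> C * cmod (deriv (disc V) \<mu>)"
proof -
  let ?S = "{0..pi}"
  obtain C where C: "C \<ge> 0" "\<And>\<mu> \<alpha> \<beta>. cmod \<mu> \<le> R \<Longrightarrow> cmod \<alpha> \<le> C * Ltwo_norm ?S (sol V \<mu> \<alpha> \<beta>)"
    "\<And>\<mu> \<alpha> \<beta>. cmod \<mu> \<le> R \<Longrightarrow> cmod \<beta> \<le> C * Ltwo_norm ?S (sol V \<mu> \<alpha> \<beta>)"
    using initial_data_bound[of R V] by blast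
  have "cmod (Ltwo_inner ?S u v) * cmod (multiplier t - 1 / multiplier t) \<le> 2 * C * C * cmod (deriv (disc V) \<mu>)"
    if R: "cmod \<mu> \<le> R" and t: "multiplier t \<noteq> 1 / multiplier t"
      and u: "normalized_eigenfunction ?S (L_bloch V t) \<mu> u"
      and v: "normalized_eigenfunction ?S (adjoint_graph ?S (L_bloch V t)) (cnj \<mu>) v" for \<mu> t u v
  proof -
    have "(u, \<lambda>x. \<mu> * u x) \<in> L_bloch V t" and u1: "Ltwo_norm ?S u = 1"
      using u by (auto simp: normalized_eigenfunction_def)
    then have "(u, \<lambda>_. 0) \<in> shift (L_bloch V t) \<mu>"
      unfolding shift_def by force
    then obtain \<alpha> \<beta> where ur: "u = restr (sol V \<mu> \<alpha> \<beta>)" and y: "floquet V \<mu> (multiplier t) \<alpha> \<beta>"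
      unfolding kernel_iff by blast
    have us: "u x = sol V \<mu> \<alpha> \<beta> x" if "x \<in> ?S" for x using that by (simp add: ur restr_def)
    have cu: "continuous_on ?S u"
      by (rule continuous_on_eq[OF continuous_on_sol(1)]) (use us in auto)
    have y1: "Ltwo_norm ?S (sol V \<mu> \<alpha> \<beta>) = 1" using u1 Ltwo_norm_cong[of ?S u "sol V \<mu> \<alpha> \<beta>"] us by simp
    have "\<not> (\<alpha> = 0 \<and> \<beta> = 0)"
    proof
      assume "\<alpha> = 0 \<and> \<beta> = 0"
      then have "u = (\<lambda>_. 0)" unfolding ur restr_sol_eq_0_iff .
      then show False using u1 by (simp add: Ltwo_norm_def)
    qed
    then have y0: "\<alpha> \<noteq> 0 \<or> \<beta> \<noteq> 0" by blast
    have "disc V \<mu> = multiplier t + 1 / multiplier t"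
      using floquet_disc[OF y0, of V \<mu> "multiplier t"] y by (simp add: floquet_def)
    then obtain \<gamma> \<delta> where z: "\<gamma> \<noteq> 0 \<or> \<delta> \<noteq> 0" "floquet V \<mu> (1 / multiplier t) \<gamma> \<delta>"
      by (rule floquet_pair)
    let ?z = "sol V \<mu> \<gamma> \<delta>"
    define N where "N = Ltwo_norm ?S ?z"
    have N: "N > 0" unfolding N_def by (rule Ltwo_norm_sol_pos[OF z(1)])
    have NN: "complex_of_real (N\<^sup>2) = integral ?S (\<lambda>x. cnj (?z x) * ?z x)"
    proof -
      have "integral ?S (\<lambda>x. (cmod (?z x))\<^sup>2) \<ge> 0"
        by (intro Henstock_Kurzweil_Integration.integral_nonneg integrable_continuous_real continuous_intros) auto
      then have "N\<^sup>2 = integral ?S (\<lambda>x. (cmod (?z x))\<^sup>2)"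
        by (simp add: N_def Ltwo_norm_continuous[OF continuous_on_sol(1)])
      moreover have "((\<lambda>x. complex_of_real ((cmod (?z x))\<^sup>2)) has_integral of_real (integral ?S (\<lambda>x. (cmod (?z x))\<^sup>2))) ?S"
        by (intro has_integral_of_real integrable_integral integrable_continuous_real continuous_intros)
      ultimately show ?thesis
        unfolding complex_norm_square by (simp only: integral_unique mult.commute)
    qed
    define \<epsilon> where "\<epsilon> = integral ?S (\<lambda>x. sol V \<mu> \<alpha> \<beta> x * ?z x)"
    \<comment> \<open>The coefficient that makes \<open>f\<close> orthogonal to the second Floquet
      solution, so that \<open>bloch_solvable\<close> applies.\<close>
    define k where "k = \<epsilon> / of_real (N\<^sup>2)"
    define f where "f x = u x - k * cnj (?z x)" for x
    have cz: "continuous_on ?S (\<lambda>x. k * cnj (?z x))" "continuous_on ?S (\<lambda>x. cnj (?z x))" by (intro continuous_intros)+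
    have cf: "continuous_on ?S f" unfolding f_def by (intro continuous_intros cu)
    have "integral ?S (\<lambda>x. f x * ?z x) = integral ?S (\<lambda>x. sol V \<mu> \<alpha> \<beta> x * ?z x - k * (cnj (?z x) * ?z x))"
      by (rule integral_cong) (simp add: f_def us algebra_simps)
    also have "\<dots> = \<epsilon> - k * integral ?S (\<lambda>x. cnj (?z x) * ?z x)"
      unfolding \<epsilon>_def by (subst integral_diff) (auto intro!: integrable_continuous_real continuous_intros)
    also have "\<dots> = 0" unfolding NN[symmetric] using N by (simp add: k_def)
    finally have orth: "integral ?S (\<lambda>x. f x * ?z x) = 0" .
    obtain w w1 where w: "bloch_solution V t \<mu> f w w1"
      using bloch_solvable[OF cf t y0 y z orth] by blast
    have cw: "continuous_on ?S w" using w ode_on_continuous by (auto simp: bloch_solution_def)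
    have "(w, f) \<in> shift (L_bloch V t) \<mu>" by (rule classical_imp_shift_bloch[OF cf w])
    then obtain g where g: "(w, g) \<in> L_bloch V t" "f = (\<lambda>x. g x - \<mu> * w x)" by (auto simp: shift_def)
    have v2: "v \<in> Ltwo ?S" "Ltwo_norm ?S v = 1"
      and adj: "Ltwo_inner ?S g v = Ltwo_inner ?S w (\<lambda>x. cnj \<mu> * v x)"
      using v g(1) by (auto simp: normalized_eigenfunction_def adjoint_graph_def)
    note ii = Ltwo_integrable_mult(1)[OF continuous_imp_Ltwo v2(1)]
    \<comment> \<open>The adjoint relation is tested on \<open>w\<close>. As
      \<open>g = f + \<mu> * w\<close> and \<open>v\<close> belongs to the eigenvalue
      \<open>cnj \<mu>\<close>, what remains is that \<open>v\<close> is orthogonal to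
      \<open>f\<close>.\<close>
    have "Ltwo_inner ?S g v = (LINT x|lebesgue_on ?S. f x * cnj (v x) + \<mu> * (w x * cnj (v x)))"
      unfolding Ltwo_inner_def by (rule Bochner_Integration.integral_cong) (auto simp: g(2) algebra_simps)
    also have "\<dots> = Ltwo_inner ?S f v + \<mu> * Ltwo_inner ?S w v"
      unfolding Ltwo_inner_def using ii[OF cf] ii[OF cw] by simp
    also have "Ltwo_inner ?S w (\<lambda>x. cnj \<mu> * v x) = \<mu> * Ltwo_inner ?S w v"
      unfolding Ltwo_inner_def using ii[OF cw] by (simp add: mult.left_commute)
    then have "Ltwo_inner ?S g v = \<mu> * Ltwo_inner ?S w v" using adj by simp
    finally have f0: "Ltwo_inner ?S f v = 0" by simp
    have "Ltwo_inner ?S f v = (LINT x|lebesgue_on ?S. u x * cnj (v x) - k * (cnj (?z x) * cnj (v x)))"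
      unfolding Ltwo_inner_def by (rule Bochner_Integration.integral_cong) (auto simp: f_def algebra_simps)
    also have "\<dots> = Ltwo_inner ?S u v - k * Ltwo_inner ?S (\<lambda>x. cnj (?z x)) v"
      unfolding Ltwo_inner_def using ii[OF cu] ii[OF cz(2)] by simp
    finally have "Ltwo_inner ?S u v = k * Ltwo_inner ?S (\<lambda>x. cnj (?z x)) v" using f0 by simp
    then have "cmod (Ltwo_inner ?S u v) = cmod k * cmod (Ltwo_inner ?S (\<lambda>x. cnj (?z x)) v)" by (simp add: norm_mult)
    also have "\<dots> \<le> cmod k * (N * 1)"
      using Ltwo_cauchy_schwarz[OF continuous_imp_Ltwo[OF cz(2)] v2(1)] v2(2)
      by (intro mult_left_mono) (auto simp: N_def Ltwo_norm_def)
    also have "\<dots> = cmod \<epsilon> / N" using N by (simp add: k_def norm_divide norm_mult power2_eq_square)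
    finally have d: "cmod (Ltwo_inner ?S u v) \<le> cmod \<epsilon> / N" .
    \<comment> \<open>The derivative formula trades \<epsilon> for the derivative of the
      discriminant; the norm \<open>N\<close> of the second solution cancels against the Wronskian
      bound that follows.\<close>
    have "deriv (disc V) \<mu> * (\<alpha> * \<delta> - \<beta> * \<gamma>) = (multiplier t - 1 / multiplier t) * \<epsilon>"
      unfolding \<epsilon>_def using y z(2) by (intro deriv_disc_floquet) (simp_all add: floquet_def)
    then have e: "cmod (deriv (disc V) \<mu>) * cmod (\<alpha> * \<delta> - \<beta> * \<gamma>) = cmod (multiplier t - 1 / multiplier t) * cmod \<epsilon>"
      by (metis norm_mult)
    have "cmod (\<alpha> * \<delta> - \<beta> * \<gamma>) \<le> cmod \<alpha> * cmod \<delta> + cmod \<beta> * cmod \<gamma>"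
      using norm_triangle_ineq4[of "\<alpha> * \<delta>" "\<beta> * \<gamma>"] by (simp add: norm_mult)
    also have "\<dots> \<le> C * (C * N) + C * (C * N)"
      using C(2)[OF R, of \<alpha> \<beta>] C(3)[OF R, of \<beta> \<alpha>] C(2)[OF R, of \<gamma> \<delta>] C(3)[OF R, of \<delta> \<gamma>] C(1) y1
      by (intro add_mono mult_mono) (auto simp: N_def)
    finally have w: "cmod (\<alpha> * \<delta> - \<beta> * \<gamma>) \<le> 2 * C * C * N" by simp
    have "cmod (Ltwo_inner ?S u v) * cmod (multiplier t - 1 / multiplier t) \<le> cmod \<epsilon> / N * cmod (multiplier t - 1 / multiplier t)"
      by (intro mult_right_mono d) simp
    also have "\<dots> = cmod (deriv (disc V) \<mu>) * cmod (\<alpha> * \<delta> - \<beta> * \<gamma>) / N" unfolding e by simp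
    also have "\<dots> \<le> cmod (deriv (disc V) \<mu>) * (2 * C * C * N) / N"
      using N w by (intro divide_right_mono mult_left_mono) auto
    also have "\<dots> = 2 * C * C * cmod (deriv (disc V) \<mu>)" using N by simp
    finally show ?thesis .
  qed
  then show ?thesis by blast
qed

section \<open>The spectrum of the operator on the line\<close>

lemma periodic_bounded:
  fixes g :: "real \<Rightarrow> real"
  assumes g: "continuous_on {0..pi} g" and p: "\<And>x. g (x + pi) = g x"
  shows "\<exists>B. \<forall>x. g x \<le> B"
proof -
  obtain B where B: "\<And>x. x \<in> {0..pi} \<Longrightarrow> g x \<le> B"
    using continuous_attains_sup[OF compact_Icc _ g] pi_ge_zero by fastforce
  have n: "g (x + real n * pi) = g x" for x n
  proof (induction n)
    case (Suc n)
    have "g (x + real (Suc n) * pi) = g ((x + real n * pi) + pi)" by (simp add: algebra_simps)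
    then show ?case using p Suc by simp
  qed simp
  have i: "g (x - of_int k * pi) = g x" for x k
  proof (cases k rule: int_cases2)
    case (nonneg m) then show ?thesis using n[of "x - of_int k * pi" m] by simp
  next
    case (nonpos m) then show ?thesis using n[of x m] by simp
  qed
  have "g x \<le> B" for x
  proof -
    have "of_int \<lfloor>x / pi\<rfloor> \<le> x / pi" "x / pi < of_int \<lfloor>x / pi\<rfloor> + 1" by linarith+
    then have "of_int \<lfloor>x / pi\<rfloor> * pi \<le> x" "x < (of_int \<lfloor>x / pi\<rfloor> + 1) * pi"
      by (simp_all only: pos_le_divide_eq pos_divide_less_eq pi_gt_zero)
    then have "x - of_int \<lfloor>x / pi\<rfloor> * pi \<in> {0..pi}" by (simp add: distrib_right)
    from B[OF this] show ?thesis by (simp only: i)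
  qed
  then show ?thesis by blast
qed

lemma
  assumes f: "continuous_on UNIV f" and z: "\<And>x. x \<notin> {a..b} \<Longrightarrow> f x = 0"
  shows Ltwo_compact_support: "f \<in> Ltwo UNIV"
    and Ltwo_norm_compact_support: "Ltwo_norm UNIV f = Ltwo_norm {a..b} f"
proof -
  have c: "continuous_on {a..b} f" using f continuous_on_subset by blast
  have e: "(\<lambda>x. (cmod (f x))\<^sup>2) = (\<lambda>x. if x \<in> {a..b} then (cmod (f x))\<^sup>2 else 0)"
    using z by auto
  have "integrable (lebesgue_on {a..b}) (\<lambda>x. (cmod (f x))\<^sup>2)"
    using continuous_imp_Ltwo[OF c] by (simp add: Ltwo_def)
  then have "integrable lebesgue (\<lambda>x. if x \<in> {a..b} then (cmod (f x))\<^sup>2 else 0)"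
    by (subst Lebesgue_Measure.integrable_restrict_UNIV) auto
  then have "integrable lebesgue (\<lambda>x. (cmod (f x))\<^sup>2)" by (simp only: e[symmetric])
  moreover have "f \<in> borel_measurable (lebesgue_on UNIV)"
    using f by (intro continuous_imp_measurable_on_sets_lebesgue) auto
  ultimately show "f \<in> Ltwo UNIV" unfolding Ltwo_def by (simp add: lebesgue_on_UNIV_eq)
  have "integral\<^sup>L lebesgue (\<lambda>x. (cmod (f x))\<^sup>2) = integral\<^sup>L (lebesgue_on {a..b}) (\<lambda>x. (cmod (f x))\<^sup>2)"
    using Lebesgue_Measure.integral_restrict_UNIV[of "{a..b}" "\<lambda>x. (cmod (f x))\<^sup>2"] by (simp only: e[symmetric]) simp
  then show "Ltwo_norm UNIV f = Ltwo_norm {a..b} f"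
    unfolding Ltwo_norm_def by (simp add: lebesgue_on_UNIV_eq)
qed

text \<open>At the corner 0 Caratheodory's quotient is the next lower truncated power, which is
  continuous and vanishes there.\<close>

lemma has_real_derivative_max_power:
  "((\<lambda>t. max 0 t ^ (n + 2)) has_real_derivative real (n + 2) * max 0 t ^ (n + 1)) (at t)"
proof -
  consider "t > 0" | "t < 0" | "t = 0" by linarith
  then show ?thesis
  proof cases
    case 1
    have "((\<lambda>t. t ^ (n + 2)) has_real_derivative real (n + 2) * t ^ (n + 1)) (at t)"
      using DERIV_pow[of "n + 2" t] by simp
    then have "((\<lambda>t. max 0 t ^ (n + 2)) has_real_derivative real (n + 2) * t ^ (n + 1)) (at t)"
      by (rule has_field_derivative_transform_within_open[where S = "{0<..}"]) (use 1 in auto)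
    then show ?thesis using 1 by simp
  next
    case 2
    have "((\<lambda>t. 0) has_real_derivative 0) (at t)" by simp
    then have "((\<lambda>t. max 0 t ^ (n + 2)) has_real_derivative 0) (at t)"
      by (rule has_field_derivative_transform_within_open[where S = "{..<0}"]) (use 2 in auto)
    then show ?thesis using 2 by simp
  next
    case 3
    have "isCont (\<lambda>t. max 0 t ^ (n + 1)) (0::real)" by (intro continuous_intros)
    moreover have "max 0 z ^ (n + 2) - max 0 0 ^ (n + 2) = max 0 z ^ (n + 1) * (z - 0)" for z :: real
      by (simp add: max_def)
    ultimately have "((\<lambda>t. max 0 t ^ (n + 2)) has_real_derivative 0) (at (0::real))"
      unfolding CARAT_DERIV by (intro exI[of _ "\<lambda>t. max 0 t ^ (n + 1)"]) auto
    then show ?thesis using 3 by simp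
  qed
qed

text \<open>The function itself has corners at \<open>- N\<close> and \<open>N\<close>. Its third
  power, used below, is twice continuously differentiable, as a multiplier preserving the domain has
  to be.\<close>

definition cutoff :: "real \<Rightarrow> real \<Rightarrow> real" where
  "cutoff N x = max 0 (1 - (x / N)\<^sup>2)"

lemma cutoff_deriv:
  assumes "N \<noteq> 0"
  shows "((\<lambda>x. cutoff N x ^ (n + 2)) has_real_derivative real (n + 2) * cutoff N x ^ (n + 1) * (- 2 * x / N\<^sup>2)) (at x)"
proof -
  have "((\<lambda>x. 1 - (x / N)\<^sup>2) has_real_derivative - 2 * x / N\<^sup>2) (at x)"
    using assms by (auto intro!: derivative_eq_intros simp: power2_eq_square)
  from DERIV_chain2[OF has_real_derivative_max_power this] show ?thesis by (simp add: cutoff_def)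
qed

lemma continuous_on_cutoff [continuous_intros]: "continuous_on S (cutoff N)"
  unfolding cutoff_def by (cases "N = 0") (auto intro!: continuous_intros)

lemma cutoff_bounds: "0 \<le> cutoff N x" "cutoff N x \<le> 1"
  by (simp_all add: cutoff_def)

lemma cutoff_outside:
  assumes "N > 0" "x \<notin> {-N..N}"
  shows "cutoff N x = 0"
proof -
  have "\<bar>x / N\<bar> \<ge> 1" using assms by (auto simp: abs_if field_simps)
  from power_mono[OF this, of 2] have "(x / N)\<^sup>2 \<ge> 1" unfolding power2_abs by simp
  then show ?thesis by (simp add: cutoff_def)
qed

text \<open>Weyl's criterion with the bounded Floquet solution multiplied by slowly varying cutoffs.\<close>

lemma weyl_sequence:
  assumes fl: "floquet V \<mu> \<rho> \<alpha> \<beta>" and \<rho>: "cmod \<rho> = 1" and nz: "\<alpha> \<noteq> 0 \<or> \<beta> \<noteq> 0"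
  shows "\<exists>c>0. \<exists>K\<ge>0. \<forall>N\<ge>8. \<exists>y f. (y, f) \<in> shift (L_line V) \<mu> \<and> c \<le> Ltwo_norm UNIV y \<and>
    Ltwo_norm UNIV f \<le> K / sqrt N"
proof -
  let ?y = "sol V \<mu> \<alpha> \<beta>" and ?y1 = "dsol V \<mu> \<alpha> \<beta>"
  have tr: "?y (x + pi) = \<rho> * ?y x" "?y1 (x + pi) = \<rho> * ?y1 x" for x
    using floquet_translate[of V \<mu> \<alpha> \<beta> \<rho> x] fl by (auto simp: floquet_def)
  obtain B1 where B1: "\<And>x. cmod (?y x) \<le> B1"
    using periodic_bounded[of "\<lambda>x. cmod (?y x)"] tr \<rho> by (auto simp: norm_mult intro!: continuous_intros)
  obtain B2 where B2: "\<And>x. cmod (?y1 x) \<le> B2"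
    using periodic_bounded[of "\<lambda>x. cmod (?y1 x)"] tr \<rho> by (auto simp: norm_mult intro!: continuous_intros)
  define B where "B = max B1 B2"
  have B: "cmod (?y x) \<le> B" "cmod (?y1 x) \<le> B" for x
    using B1[of x] B2[of x] by (simp_all add: B_def)
  have B0: "B \<ge> 0" using order_trans[OF norm_ge_zero B(1)] .
  \<comment> \<open>On \<open>{0..pi}\<close> and for \<open>N \<ge> 8\<close> the quotient
    \<open>x / N\<close> is at most 1/2, so the cutoff is at least 3/4 and its cube at least
    1/4.\<close>
  define c where "c = 1 / 4 * Ltwo_norm {0..pi} ?y"
  have c: "c > 0" using Ltwo_norm_sol_pos[OF nz] by (simp add: c_def)
  \<comment> \<open>Here \<open>42 = 2 * 6 + 30\<close> collects the bounds \<open>6 / N\<close> and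
    \<open>30 / N\<close> for the first two derivatives of the cubed cutoff, and
    \<open>sqrt 2\<close> comes from the length \<open>2 * N\<close> of its support.\<close>
  define K where "K = 42 * B * sqrt 2"
  have "\<exists>y f. (y, f) \<in> shift (L_line V) \<mu> \<and> c \<le> Ltwo_norm UNIV y \<and> Ltwo_norm UNIV f \<le> K / sqrt N"
    if N: "N \<ge> 8" for N
  proof -
    have N0: "N > 0" "N \<noteq> 0" using N by auto
    define d where "d x = - 2 * x / N\<^sup>2" for x
    define h where "h x = cutoff N x ^ 3" for x
    define h1 where "h1 x = 3 * cutoff N x ^ 2 * d x" for x
    define h2 where "h2 x = 6 * cutoff N x * (d x)\<^sup>2 + 3 * cutoff N x ^ 2 * (- 2 / N\<^sup>2)" for x
    have dh: "(h has_real_derivative h1 x) (at x)" for x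
      using cutoff_deriv[OF N0(2), of 1 x] by (simp add: h_def[abs_def] h1_def d_def numeral_3_eq_3 numeral_2_eq_2)
    have dd: "(d has_real_derivative - 2 / N\<^sup>2) (at x)" for x
      using DERIV_cdivide[OF DERIV_cmult_Id[of "- 2" x UNIV], of "N\<^sup>2"] by (simp add: d_def[abs_def])
    have dh1: "(h1 has_real_derivative h2 x) (at x)" for x
    proof -
      have "((\<lambda>x. cutoff N x ^ 2) has_real_derivative 2 * cutoff N x * d x) (at x)"
        using cutoff_deriv[OF N0(2), of 0 x] by (simp add: d_def numeral_2_eq_2)
      from DERIV_mult[OF DERIV_cmult[OF this, of 3] dd] show ?thesis
        unfolding h1_def[abs_def] by (simp add: h2_def power2_eq_square algebra_simps)
    qed
    define y where "y x = of_real (h x) * ?y x" for x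
    define y1 where "y1 x = of_real (h x) * ?y1 x + of_real (h1 x) * ?y x" for x
    \<comment> \<open>The image of \<open>h * ?y\<close> under the shifted operator: only the
      commutator terms, which contain derivatives of \<open>h\<close>, remain.\<close>
    define f where "f x = - (of_real (2 * h1 x) * ?y1 x + of_real (h2 x) * ?y x)" for x
    define y2 where "y2 x = (q_pot V x - \<mu>) * y x - f x" for x
    have o: "(?y has_vector_derivative ?y1 x) (at x)" "(?y1 has_vector_derivative (q_pot V x - \<mu>) * ?y x) (at x)" for x
      using ode_on_sol[of V \<mu> \<alpha> \<beta>] by (simp_all add: ode_on_def)
    have dy: "(y has_vector_derivative y1 x) (at x)" for x
      unfolding y_def[abs_def] y1_def by (intro has_vector_derivative_mult has_vector_derivative_of_real dh o)
    have dy1: "(y1 has_vector_derivative y2 x) (at x)" for x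
    proof -
      have "(y1 has_vector_derivative (of_real (h x) * ((q_pot V x - \<mu>) * ?y x) + of_real (h1 x) * ?y1 x) +
          (of_real (h1 x) * ?y1 x + of_real (h2 x) * ?y x)) (at x)"
        unfolding y1_def[abs_def]
        by (intro has_vector_derivative_add has_vector_derivative_mult has_vector_derivative_of_real dh dh1 o)
      then show ?thesis by (simp add: y2_def f_def y_def algebra_simps)
    qed
    have ch: "continuous_on S h" "continuous_on S h1" "continuous_on S h2" for S
      unfolding h_def h1_def h2_def d_def using N0 by (intro continuous_intros; simp)+
    have cy: "continuous_on S y" "continuous_on S y1" "continuous_on S y2" "continuous_on S f" for S
      unfolding y2_def f_def y_def y1_def by (intro continuous_intros ch)+
    have out: "y x = 0" "y1 x = 0" "y2 x = 0" "f x = 0" if "x \<notin> {-N..N}" for x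
      using cutoff_outside[OF N0(1) that] by (simp_all add: y_def y1_def y2_def f_def h_def h1_def h2_def)
    have "continuous_on UNIV (\<lambda>x. f x + \<mu> * y x)" by (intro continuous_intros cy)
    then have "(\<lambda>x. f x + \<mu> * y x) \<in> Ltwo UNIV"
      by (rule Ltwo_compact_support[where a = "-N" and b = N]) (simp add: out del: atLeastAtMost_iff)
    with Ltwo_compact_support[OF cy(1) out(1)] Ltwo_compact_support[OF cy(2) out(2)] Ltwo_compact_support[OF cy(3) out(3)]
    have L: "y \<in> Ltwo UNIV" "y1 \<in> Ltwo UNIV" "y2 \<in> Ltwo UNIV" "(\<lambda>x. f x + \<mu> * y x) \<in> Ltwo UNIV"
      by blast+
    have "sobolev22 UNIV y y1 y2"
      unfolding sobolev22_def
    proof (intro conjI allI impI)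
      fix a b :: real assume "a \<le> b \<and> {a..b} \<subseteq> UNIV"
      then show "(y1 has_integral y b - y a) {a..b}" "(y2 has_integral y1 b - y1 a) {a..b}"
        using fundamental_theorem_of_calculus[OF _ has_vector_derivative_at_within[OF dy]]
          fundamental_theorem_of_calculus[OF _ has_vector_derivative_at_within[OF dy1]] by blast+
    qed (use L in auto)
    moreover have "AE x in lebesgue. f x + \<mu> * y x = - y2 x + q_pot V x * y x"
      by (rule AE_I2) (simp add: y2_def algebra_simps)
    ultimately have "(y, \<lambda>x. f x + \<mu> * y x) \<in> L_line V" using L(4) unfolding L_line_def by blast
    then have mem: "(y, f) \<in> shift (L_line V) \<mu>" unfolding shift_def by force
    have "Ltwo_norm UNIV f = Ltwo_norm {-N..N} f"
      by (rule Ltwo_norm_compact_support) (auto intro: cy out)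
    also have "\<dots> \<le> (42 * B / N) * sqrt (N - (- N))"
    proof (rule Ltwo_norm_le)
      fix x assume x: "x \<in> {-N..N}"
      have N1: "1 / N \<le> 1" "0 \<le> 1 / N" using N by auto
      have c01: "\<bar>cutoff N x\<bar> \<le> 1" using cutoff_bounds[of N x] by simp
      have "\<bar>x\<bar> \<le> N" using x by auto
      then have dx: "\<bar>d x\<bar> \<le> 2 / N" using N0 by (simp add: d_def abs_mult power2_eq_square field_simps)
      have c2: "\<bar>cutoff N x ^ 2\<bar> \<le> 1" using power_mono[OF c01, of 2] by simp
      have h1: "\<bar>h1 x\<bar> \<le> 6 / N"
      proof -
        have "\<bar>cutoff N x ^ 2\<bar> * \<bar>d x\<bar> \<le> 1 * (2 / N)" by (intro mult_mono c2 dx) auto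
        then show ?thesis by (simp add: h1_def abs_mult)
      qed
      have NN: "1 / N\<^sup>2 \<le> 1 / N" using N by (simp add: power2_eq_square field_simps)
      have h2: "\<bar>h2 x\<bar> \<le> 30 / N"
      proof -
        have "\<bar>cutoff N x\<bar> * \<bar>d x\<bar>\<^sup>2 \<le> 1 * (2 / N)\<^sup>2" using N0 by (intro mult_mono c01 power_mono dx) auto
        then have 1: "\<bar>6 * cutoff N x * (d x)\<^sup>2\<bar> \<le> 24 * (1 / N\<^sup>2)" by (simp add: abs_mult power_divide)
        have "\<bar>cutoff N x ^ 2\<bar> * (1 / N\<^sup>2) \<le> 1 * (1 / N\<^sup>2)" by (intro mult_right_mono c2) auto
        then have 2: "\<bar>3 * cutoff N x ^ 2 * (- 2 / N\<^sup>2)\<bar> \<le> 6 * (1 / N\<^sup>2)" by (simp add: abs_mult)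
        have "\<bar>h2 x\<bar> \<le> 30 * (1 / N\<^sup>2)"
          unfolding h2_def using abs_triangle_ineq[of "6 * cutoff N x * (d x)\<^sup>2" "3 * cutoff N x ^ 2 * (- 2 / N\<^sup>2)"] 1 2
          by linarith
        then show ?thesis using NN by linarith
      qed
      have "cmod (f x) \<le> cmod (of_real (2 * h1 x) * ?y1 x) + cmod (of_real (h2 x) * ?y x)"
        unfolding f_def norm_minus_cancel by (rule norm_triangle_ineq)
      also have "\<dots> = \<bar>2 * h1 x\<bar> * cmod (?y1 x) + \<bar>h2 x\<bar> * cmod (?y x)" by (simp only: norm_mult norm_of_real)
      also have "\<dots> \<le> (2 * (6 / N)) * B + (30 / N) * B"
        using h1 h2 B[of x] B0 N0 by (intro add_mono mult_mono) auto
      also have "\<dots> = 42 * B / N" by (simp add: field_simps)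
      finally show "cmod (f x) \<le> 42 * B / N" .
    qed (use N0 cy in auto)
    also have "\<dots> = K / sqrt N"
    proof -
      have "sqrt (N - - N) = sqrt 2 * sqrt N" by (simp flip: real_sqrt_mult)
      moreover have "sqrt N / N = 1 / sqrt N" using N0 real_sqrt_pow2[of N] by (simp add: field_simps power2_eq_square)
      ultimately show ?thesis by (simp add: K_def)
        (metis (no_types, lifting) mult.commute mult.left_commute mult_1 times_divide_eq_right)
    qed
    finally have fn: "Ltwo_norm UNIV f \<le> K / sqrt N" .
    have "c \<le> Ltwo_norm {-N..N} y"
    proof -
      have i: "(\<lambda>x. (cmod (y x))\<^sup>2) integrable_on {a..b}" "(\<lambda>x. (cmod (?y x))\<^sup>2) integrable_on {a..b}" for a b
        by (intro integrable_continuous_real continuous_intros cy)+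
      have "integral {0..pi} (\<lambda>x. 1 / 16 * (cmod (?y x))\<^sup>2) \<le> integral {0..pi} (\<lambda>x. (cmod (y x))\<^sup>2)"
      proof (rule integral_le)
        fix x assume x: "x \<in> {0..pi}"
        have "x / N \<le> 1 / 2" using x N pi_less_4 N0 by (simp add: pos_divide_le_eq)
        moreover have "0 \<le> x / N" using x N0 by simp
        ultimately have "(x / N)\<^sup>2 \<le> (1 / 2)\<^sup>2" by (intro power_mono)
        moreover have "(1 / 2 :: real)\<^sup>2 = 1 / 4" by (simp add: power2_eq_square)
        moreover have "1 - (x / N)\<^sup>2 \<le> cutoff N x" unfolding cutoff_def by (rule max.cobounded2)
        ultimately have "3 / 4 \<le> cutoff N x" by linarith
        then have "(3 / 4) ^ 3 \<le> h x" unfolding h_def by (intro power_mono) auto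
        then have "1 / 4 \<le> h x" by (simp add: power3_eq_cube)
        then have "(1 / 4)\<^sup>2 \<le> (h x)\<^sup>2" by (intro power_mono) auto
        then have "(1 / 4)\<^sup>2 * (cmod (?y x))\<^sup>2 \<le> (h x)\<^sup>2 * (cmod (?y x))\<^sup>2" by (intro mult_right_mono) auto
        moreover have "(cmod (y x))\<^sup>2 = (h x)\<^sup>2 * (cmod (?y x))\<^sup>2"
          by (simp add: y_def norm_mult power_mult_distrib)
        moreover have "(1 / 4 :: real)\<^sup>2 = 1 / 16" by (simp add: power2_eq_square)
        ultimately show "1 / 16 * (cmod (?y x))\<^sup>2 \<le> (cmod (y x))\<^sup>2" by (simp only:)
      qed (intro integrable_continuous_real continuous_intros cy)+
      also have "\<dots> \<le> integral {-N..N} (\<lambda>x. (cmod (y x))\<^sup>2)"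
        using N pi_less_4 by (intro integral_subset_le i) auto
      finally have "sqrt (1 / 16 * integral {0..pi} (\<lambda>x. (cmod (?y x))\<^sup>2)) \<le> Ltwo_norm {-N..N} y"
        unfolding Ltwo_norm_continuous[OF cy(1)] by (intro real_sqrt_le_mono) simp
      moreover have "sqrt (1 / 16 :: real) = 1 / 4" by (simp add: real_sqrt_divide)
      ultimately show ?thesis
        unfolding c_def Ltwo_norm_continuous[OF continuous_on_sol(1)] real_sqrt_mult by simp
    qed
    also have "Ltwo_norm {-N..N} y = Ltwo_norm UNIV y"
      by (rule Ltwo_norm_compact_support[symmetric]) (auto intro: cy out)
    finally show ?thesis using mem fn by blast
  qed
  moreover have "K \<ge> 0" using B0 by (simp add: K_def)
  ultimately show ?thesis using c by blast
qed

lemma bloch_spectrum_subset_spectrum: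
  assumes "disc V \<mu> = multiplier t + 1 / multiplier t"
  shows "\<mu> \<in> spectrum_of UNIV (L_line V)"
proof (rule ccontr)
  assume "\<mu> \<notin> spectrum_of UNIV (L_line V)"
  then obtain C where C: "\<And>y f. (y, f) \<in> shift (L_line V) \<mu> \<Longrightarrow> Ltwo_norm UNIV y \<le> C * Ltwo_norm UNIV f"
    unfolding spectrum_of_def resolvent_set_def by blast
  obtain \<alpha> \<beta> where y: "\<alpha> \<noteq> 0 \<or> \<beta> \<noteq> 0" "floquet V \<mu> (multiplier t) \<alpha> \<beta>"
    using floquet_pair[OF assms] by blast
  have "cmod (multiplier t) = 1" by (simp add: multiplier_def)
  from weyl_sequence[OF y(2) this y(1)] obtain c K where c: "c > 0" "K \<ge> 0"
    and w: "\<And>N. N \<ge> 8 \<Longrightarrow> \<exists>y f. (y, f) \<in> shift (L_line V) \<mu> \<and> c \<le> Ltwo_norm UNIV y \<and> Ltwo_norm UNIV f \<le> K / sqrt N"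
    by blast
  \<comment> \<open>Large enough that \<open>c * sqrt N\<close> exceeds
    \<open>\<bar>C\<bar> * K\<close>, against the resolvent estimate; 8 is the threshold of
    \<open>weyl_sequence\<close>.\<close>
  define N where "N = max 8 ((\<bar>C\<bar> * K / c + 1)\<^sup>2)"
  obtain y f where yf: "(y, f) \<in> shift (L_line V) \<mu>" "c \<le> Ltwo_norm UNIV y" "Ltwo_norm UNIV f \<le> K / sqrt N"
    using w[of N] by (auto simp: N_def)
  have N0: "N > 0" by (simp add: N_def)
  have s: "\<bar>C\<bar> * K / c + 1 \<le> sqrt N" by (rule real_le_rsqrt) (simp add: N_def)
  have "c \<le> \<bar>C\<bar> * (K / sqrt N)"
    using yf(2) C[OF yf(1)] mult_mono[OF abs_ge_self[of C] yf(3)] Ltwo_norm_nonneg[of UNIV f] by simp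
  then have "c * sqrt N \<le> \<bar>C\<bar> * K" using N0 by (simp add: field_simps)
  moreover have "c * (\<bar>C\<bar> * K / c + 1) \<le> c * sqrt N" using s c by (intro mult_left_mono) auto
  ultimately show False using c by (simp add: distrib_left)
qed

section \<open>Spectral singularities\<close>

text \<open>Solves \<open>2 * cos (pi * t) = rdisc V u\<close> for \<open>t\<close> between 0 and 1
  when \<open>\<bar>rdisc V u\<bar> < 2\<close>, and so selects a boundary condition that has the
  real number \<open>u\<close> as eigenvalue.\<close>

definition quasimomentum :: "real \<Rightarrow> real \<Rightarrow> real" where
  "quasimomentum V u = arccos (rdisc V u / 2) / pi"

lemma quasimomentum:
  assumes "\<bar>rdisc V u\<bar> < 2"
  shows "quasimomentum V u \<in> {0<..<1}"
    and "disc V (of_real u) = multiplier (quasimomentum V u) + 1 / multiplier (quasimomentum V u)"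
    and "cmod (multiplier (quasimomentum V u) - 1 / multiplier (quasimomentum V u)) = 2 * sqrt (1 - (rdisc V u / 2)\<^sup>2)"
    and "multiplier (quasimomentum V u) \<noteq> 1 / multiplier (quasimomentum V u)"
proof -
  have r: "- 1 < rdisc V u / 2" "rdisc V u / 2 < 1" using assms by (auto simp: abs_less_iff)
  have p: "pi * quasimomentum V u = arccos (rdisc V u / 2)" by (simp add: quasimomentum_def)
  show "quasimomentum V u \<in> {0<..<1}"
    using arccos_lt_bounded[OF r] by (simp add: quasimomentum_def)
  show "disc V (of_real u) = multiplier (quasimomentum V u) + 1 / multiplier (quasimomentum V u)"
    unfolding multiplier_add_inverse p disc_eq_rdisc using r by simp
  have s: "sin (pi * quasimomentum V u) = sqrt (1 - (rdisc V u / 2)\<^sup>2)"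
    unfolding p using r by (intro sin_arccos) auto
  have "(rdisc V u / 2)\<^sup>2 < 1" using r by (simp add: abs_square_less_1 abs_less_iff)
  then have pos: "sqrt (1 - (rdisc V u / 2)\<^sup>2) > 0" by simp
  show c: "cmod (multiplier (quasimomentum V u) - 1 / multiplier (quasimomentum V u)) = 2 * sqrt (1 - (rdisc V u / 2)\<^sup>2)"
    unfolding multiplier_diff_inverse s using pos by (simp add: norm_mult)
  show "multiplier (quasimomentum V u) \<noteq> 1 / multiplier (quasimomentum V u)"
    using c pos by auto
qed

lemma isCont_quasimomentum:
  assumes "\<bar>rdisc V u\<bar> < 2"
  shows "isCont (quasimomentum V) u"
proof -
  have "isCont (rdisc V) u" using has_real_derivative_rdisc by (rule DERIV_isCont)
  then have "isCont (\<lambda>u. rdisc V u / 2) u" by (intro continuous_intros) auto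
  moreover have "isCont arccos (rdisc V u / 2)" using assms by (intro isCont_arccos) (auto simp: abs_less_iff)
  ultimately have "isCont (\<lambda>u. arccos (rdisc V u / 2)) u" by (rule isCont_o2)
  then show ?thesis unfolding quasimomentum_def[abs_def] by (intro continuous_intros) auto
qed

lemma numbering_disc:
  assumes num: "eigenvalue_numbering V lam" and t: "t \<in> {-1<..1}"
  shows "disc V (lam n t) = multiplier t + 1 / multiplier t"
proof (rule algebraic_multiplicity_nonzero_imp)
  have f: "finite {m. lam m t = lam n t}"
    and c: "card {m. lam m t = lam n t} = algebraic_multiplicity (L_bloch V t) (lam n t)"
    using num t unfolding eigenvalue_numbering_def by blast+
  have "n \<in> {m. lam m t = lam n t}" by simp
  then have "card {m. lam m t = lam n t} \<noteq> 0" using f by (metis card_eq_0_iff empty_iff)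
  then show "algebraic_multiplicity (L_bloch V t) (lam n t) \<noteq> 0" unfolding c .
qed

lemma numbering_simple:
  assumes num: "eigenvalue_numbering V lam" and t: "t \<in> {-1<..1}" and s: "simple_eigenvalue V t \<mu>"
  shows "\<exists>!n. lam n t = \<mu>"
proof -
  have "card {m. lam m t = \<mu>} = 1"
    using num t s unfolding eigenvalue_numbering_def simple_eigenvalue_def by metis
  then obtain n where n: "{m. lam m t = \<mu>} = {n}" unfolding One_nat_def card_1_singleton_iff by blast
  show ?thesis
  proof
    show "lam n t = \<mu>" using n by blast
    show "m = n" if "lam m t = \<mu>" for m using n that by blast
  qed
qed

text \<open>As the discriminant is locally injective and the \<open>lam n\<close> are continuous, the index of the
  eigenvalue \<open>u\<close> of \<open>L\<^sub>t(V)\<close>, \<open>t = quasimomentum V u\<close>, is locally constant.\<close>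

lemma numbering_constant:
  assumes num: "eigenvalue_numbering V lam" and I: "connected I" "u0 \<in> I"
    and r: "\<And>u. u \<in> I \<Longrightarrow> \<bar>rdisc V u\<bar> < 2" and d: "\<And>u. u \<in> I \<Longrightarrow> deriv (disc V) (of_real u) \<noteq> 0"
  shows "\<exists>n. \<forall>u\<in>I. lam n (quasimomentum V u) = of_real u"
proof -
  let ?\<tau> = "quasimomentum V"
  define \<nu> where "\<nu> u = (THE n. lam n (?\<tau> u) = of_real u)" for u
  have tau: "?\<tau> u \<in> {-1<..1}" if "u \<in> I" for u using quasimomentum(1)[OF r[OF that]] by auto
  have ex1: "\<exists>!n. lam n (?\<tau> u) = of_real u" if u: "u \<in> I" for u
    using quasimomentum(2,4)[OF r[OF u]] d[OF u]
    by (intro numbering_simple[OF num tau[OF u]] simple_eigenvalueI)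
  have nu: "lam (\<nu> u) (?\<tau> u) = of_real u" if "u \<in> I" for u
    unfolding \<nu>_def using ex1[OF that] by (rule theI')
  have nuI: "\<nu> u = n" if "u \<in> I" "lam n (?\<tau> u) = of_real u" for u n
    unfolding \<nu>_def using ex1[OF that(1)] that(2) by (rule the1_equality)
  have loc: "\<forall>\<^sub>F b in at a within I. \<nu> a = \<nu> b" if a: "a \<in> I" for a
  proof -
    define n where "n = \<nu> a"
    obtain \<rho> where \<rho>: "\<rho> > 0" "inj_on (disc V) (ball (of_real a) \<rho>)"
      using has_complex_derivative_locally_injective[OF holomorphic_on_disc[of V UNIV] _ open_UNIV d[OF a]] by auto
    have "?\<tau> a \<in> {-1<..<1}" using quasimomentum(1)[OF r[OF a]] by auto
    moreover have "continuous_on {-1<..<1} (lam n)"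
      using num unfolding eigenvalue_numbering_def by (meson continuous_on_subset greaterThanLessThan_subseteq_greaterThanAtMost_iff order_refl)
    ultimately have "isCont (lam n) (?\<tau> a)"
      by (simp add: continuous_on_eq_continuous_at)
    then have "isCont (\<lambda>b. lam n (?\<tau> b)) a"
      by (rule isCont_o2[OF isCont_quasimomentum[OF r[OF a]]])
    moreover have "lam n (?\<tau> a) = of_real a" unfolding n_def by (rule nu[OF a])
    ultimately have "((\<lambda>b. lam n (?\<tau> b)) \<longlongrightarrow> of_real a) (at a within I)"
      by (metis continuous_at_imp_continuous_at_within continuous_within)
    from tendstoD[OF this \<rho>(1)]
    have 1: "\<forall>\<^sub>F b in at a within I. lam n (?\<tau> b) \<in> ball (of_real a) \<rho>"
      by (simp add: dist_commute)
    have "((\<lambda>b. complex_of_real b) \<longlongrightarrow> of_real a) (at a within I)" by (intro tendsto_intros)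
    from tendstoD[OF this \<rho>(1)]
    have 2: "\<forall>\<^sub>F b in at a within I. of_real b \<in> ball (complex_of_real a) \<rho>"
      by (simp add: dist_commute)
    have 3: "\<forall>\<^sub>F b in at a within I. b \<in> I" by (simp add: eventually_at_filter)
    show ?thesis using 1 2 3
    proof eventually_elim
      case (elim b)
      \<comment> \<open>Both numbers lie in the ball on which the discriminant is injective, and
        both give it the value that belongs to \<open>?\<tau> b\<close>.\<close>
      have "disc V (lam n (?\<tau> b)) = disc V (of_real b)"
        using numbering_disc[OF num tau[OF elim(3)]] quasimomentum(2)[OF r[OF elim(3)]] by simp
      then have "lam n (?\<tau> b) = of_real b" using inj_onD[OF \<rho>(2)] elim by blast
      then show ?case using nuI[OF elim(3)] by (simp add: n_def)
    qed
  qed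
  have "\<nu> u0 = \<nu> u" if "u \<in> I" for u
    by (rule connected_local_const[OF I that]) (use loc in blast)
  then show ?thesis using nu by (intro exI[of _ "\<nu> u0"]) auto
qed

text \<open>The derivative is nonzero along the approach to \<open>s\<close>, which secures
  simplicity there, and \<open>\<bar>rdisc V s\<bar> < 2\<close> keeps the sine in the bound for
  \<open>d\<close> away from zero in the limit.\<close>

lemma critical_point_singular:
  assumes num: "eigenvalue_numbering V lam"
    and eig: "normalized_eigenfunctions V lam Psi Psi_star"
    and s: "\<bar>rdisc V s\<bar> < 2" "deriv (disc V) (of_real s) = 0"
  shows "spectral_singularity V lam Psi Psi_star (of_real s)"
proof -
  let ?\<tau> = "quasimomentum V"
  obtain \<delta>1 where \<delta>1: "\<delta>1 > 0" "\<And>u. s < u \<Longrightarrow> u < s + \<delta>1 \<Longrightarrow> deriv (disc V) (of_real u) \<noteq> 0"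
    using deriv_disc_nonzero_right[of s V] by blast
  have contr: "isCont (rdisc V) u" for u using has_real_derivative_rdisc by (rule DERIV_isCont)
  have "\<forall>\<^sub>F u in nhds s. \<bar>rdisc V u\<bar> < 2"
    using order_tendstoD(2)[OF tendsto_rabs[OF contr[of s, unfolded isCont_def]] s(1)] s(1)
    by (simp add: eventually_nhds_conv_at)
  then obtain \<delta>2 where \<delta>2: "\<delta>2 > 0" "\<And>u. dist u s < \<delta>2 \<Longrightarrow> \<bar>rdisc V u\<bar> < 2"
    unfolding eventually_nhds_metric by blast
  define \<delta> where "\<delta> = min \<delta>1 \<delta>2"
  define I where "I = {s<..<s + \<delta>}"
  have \<delta>: "\<delta> > 0" using \<delta>1 \<delta>2 by (simp add: \<delta>_def)
  have r: "\<bar>rdisc V u\<bar> < 2" if "u \<in> I" for u using that by (intro \<delta>2) (auto simp: I_def \<delta>_def dist_real_def)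
  have d: "deriv (disc V) (of_real u) \<noteq> 0" if "u \<in> I" for u using that by (intro \<delta>1) (auto simp: I_def \<delta>_def)
  have "connected I" "s + \<delta> / 2 \<in> I" using \<delta> by (simp_all add: I_def)
  then obtain n where n: "\<And>u. u \<in> I \<Longrightarrow> lam n (?\<tau> u) = of_real u"
    using numbering_constant[OF num _ _ r d] by blast
  \<comment> \<open>The shift by 2 keeps \<open>u 0\<close> strictly inside the open interval
    \<open>I\<close>.\<close>
  define u where "u k = s + \<delta> / (real k + 2)" for k :: nat
  have uI: "u k \<in> I" for k
  proof -
    have "\<delta> / (real k + 2) < \<delta>" "\<delta> / (real k + 2) > 0" using \<delta> by (simp_all add: divide_less_eq)
    then show ?thesis by (simp add: u_def I_def)
  qed
  have ulim: "u \<longlonglongrightarrow> s"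
  proof -
    have "(\<lambda>k. \<delta> / real (k + 2)) \<longlonglongrightarrow> 0"
      by (rule LIMSEQ_ignore_initial_segment[OF lim_const_over_n])
    from tendsto_add[OF tendsto_const[of s] this] show ?thesis
      unfolding u_def[abs_def] by (simp add: add.commute)
  qed
  define t where "t k = ?\<tau> (u k)" for k
  have t: "t k \<in> {-1<..1}" for k using quasimomentum(1)[OF r[OF uI[of k]]] by (auto simp: t_def)
  have lam: "lam n (t k) = of_real (u k)" for k unfolding t_def by (rule n[OF uI])
  have simple: "simple_eigenvalue V (t k) (lam n (t k))" for k
    unfolding lam unfolding t_def using quasimomentum(2,4)[OF r[OF uI]] d[OF uI] by (intro simple_eigenvalueI)
  have llim: "(\<lambda>k. lam n (t k)) \<longlonglongrightarrow> of_real s" unfolding lam by (intro tendsto_of_real ulim)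
  \<comment> \<open>One constant serves all \<open>k\<close>, because the eigenvalues
    \<open>u k\<close> stay in a fixed disc.\<close>
  obtain C where C: "\<And>\<mu> t u v. cmod \<mu> \<le> \<bar>s\<bar> + \<delta> \<Longrightarrow> multiplier t \<noteq> 1 / multiplier t \<Longrightarrow>
    normalized_eigenfunction {0..pi} (L_bloch V t) \<mu> u \<Longrightarrow>
    normalized_eigenfunction {0..pi} (adjoint_graph {0..pi} (L_bloch V t)) (cnj \<mu>) v \<Longrightarrow>
    cmod (Ltwo_inner {0..pi} u v) * cmod (multiplier t - 1 / multiplier t) \<le> C * cmod (deriv (disc V) \<mu>)"
    using d_bound[of "\<bar>s\<bar> + \<delta>" V] by blast
  define e where "e u = C * cmod (deriv (disc V) (of_real u)) / (2 * sqrt (1 - (rdisc V u / 2)\<^sup>2))" for u :: real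
  have sq: "1 - (rdisc V u / 2)\<^sup>2 > 0" if "\<bar>rdisc V u\<bar> < 2" for u
    using that by (simp add: abs_square_less_1)
  have dlim: "(\<lambda>k. cmod (d_coef Psi Psi_star n (t k))) \<longlonglongrightarrow> 0"
  proof (rule Lim_null_comparison)
    show "\<forall>\<^sub>F k in sequentially. norm (cmod (d_coef Psi Psi_star n (t k))) \<le> e (u k)"
    proof (intro always_eventually allI)
      fix k
      have "normalized_eigenfunction {0..pi} (L_bloch V (t k)) (of_real (u k)) (Psi n (t k))"
        "normalized_eigenfunction {0..pi} (adjoint_graph {0..pi} (L_bloch V (t k))) (cnj (of_real (u k))) (Psi_star n (t k))"
        using eig t[of k] simple[of k] unfolding normalized_eigenfunctions_def lam[symmetric] by blast+
      moreover have "cmod (of_real (u k)) \<le> \<bar>s\<bar> + \<delta>" using uI[of k] by (auto simp: I_def)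
      moreover note q = quasimomentum(3,4)[OF r[OF uI[of k]], folded t_def]
      ultimately have "cmod (d_coef Psi Psi_star n (t k)) * cmod (multiplier (t k) - 1 / multiplier (t k)) \<le> C * cmod (deriv (disc V) (of_real (u k)))"
        unfolding d_coef_def by (intro C)
      then show "norm (cmod (d_coef Psi Psi_star n (t k))) \<le> e (u k)"
        unfolding q(1) e_def using sq[OF r[OF uI[of k]]] by (simp add: pos_le_divide_eq)
    qed
    have hol: "deriv (disc V) holomorphic_on UNIV"
      by (intro holomorphic_deriv holomorphic_on_disc) simp
    have "isCont (deriv (disc V)) (of_real s)"
      using holomorphic_on_imp_continuous_on[OF hol] by (simp add: continuous_on_eq_continuous_at)
    then have 1: "(\<lambda>k. deriv (disc V) (of_real (u k))) \<longlonglongrightarrow> deriv (disc V) (of_real s)"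
      by (rule isCont_tendsto_compose) (intro tendsto_of_real ulim)
    have 2: "(\<lambda>k. rdisc V (u k)) \<longlonglongrightarrow> rdisc V s"
      by (rule isCont_tendsto_compose[OF contr ulim])
    have "(\<lambda>k. e (u k)) \<longlonglongrightarrow> C * cmod (deriv (disc V) (of_real s)) / (2 * sqrt (1 - (rdisc V s / 2)\<^sup>2))"
      unfolding e_def using sq[OF s(1)] by (intro tendsto_intros 1 2) simp_all
    then show "(\<lambda>k. e (u k)) \<longlonglongrightarrow> 0" by (simp add: s(2))
  qed
  have "of_real s \<in> spectrum_of UNIV (L_line V)"
    by (rule bloch_spectrum_subset_spectrum[OF quasimomentum(2)[OF s(1)]])
  then show ?thesis
    unfolding spectral_singularity_def using t simple llim dlim by blast
qed

theorem theorem10: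
  fixes V :: real
    and lam :: "nat \<Rightarrow> real \<Rightarrow> complex"
    and Psi Psi_star :: "nat \<Rightarrow> real \<Rightarrow> real \<Rightarrow> complex"
  assumes "V > 1/2"
    and "eigenvalue_numbering V lam"
    and "normalized_eigenfunctions V lam Psi Psi_star"
  shows "infinite {\<mu>. spectral_singularity V lam Psi Psi_star \<mu>} \<and>
    spectral_singularity_at_infinity V lam Psi Psi_star"
proof -
  obtain N where N: "\<And>j. j \<ge> N \<Longrightarrow> \<exists>s. (real (2 * j))\<^sup>2 < s \<and> s < (real (2 * j + 2))\<^sup>2 \<and>
     - 2 < rdisc V s \<and> rdisc V s < 2 \<and> deriv (disc V) (of_real s) = 0"
    using critical_points[OF assms(1)] by blast
  \<comment> \<open>The margin 1 is spent below: an eigenvalue within distance 1 of \<open>s\<close>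
    still has modulus at least \<open>k\<close>.\<close>
  have large: "\<exists>s. real k + 1 < s \<and> spectral_singularity V lam Psi Psi_star (of_real s)" for k :: nat
  proof -
    define j where "j = N + k + 1"
    obtain s where s: "(real (2 * j))\<^sup>2 < s" "- 2 < rdisc V s" "rdisc V s < 2" "deriv (disc V) (of_real s) = 0"
      using N[of j] by (auto simp: j_def)
    have "real k + 1 \<le> (real (2 * j))\<^sup>2"
    proof -
      have "real k + 1 \<le> real (2 * j)" by (simp add: j_def)
      also have "\<dots> \<le> real (2 * j) * real (2 * j)" by (simp add: j_def mult_le_cancel_left1)
      finally show ?thesis by (simp add: power2_eq_square)
    qed
    moreover have "spectral_singularity V lam Psi Psi_star (of_real s)"
      using critical_point_singular[OF assms(2,3) _ s(4)] s(2,3) by (simp add: abs_less_iff)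
    ultimately show ?thesis using s(1) by (intro exI[of _ s]) auto
  qed
  have "infinite {\<mu>. spectral_singularity V lam Psi Psi_star \<mu>}"
  proof
    assume "finite {\<mu>. spectral_singularity V lam Psi Psi_star \<mu>}"
    then have "bounded {\<mu>. spectral_singularity V lam Psi Psi_star \<mu>}" by (rule finite_imp_bounded)
    then obtain B where B: "\<And>\<mu>. spectral_singularity V lam Psi Psi_star \<mu> \<Longrightarrow> cmod \<mu> \<le> B"
      unfolding bounded_iff by blast
    obtain k :: nat where "B < real k" using reals_Archimedean2 by blast
    moreover obtain s where "real k + 1 < s" "spectral_singularity V lam Psi Psi_star (of_real s)"
      using large by blast
    ultimately show False using B[of "of_real s"] by simp
  qed
  moreover have "spectral_singularity_at_infinity V lam Psi Psi_star"
  proof -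
    \<comment> \<open>Diagonal choice: from the sequence defining a singularity beyond
      \<open>k + 1\<close> a single eigenvalue is kept, close to the singularity and with
      \<open>d\<close> below \<open>1 / (k + 1)\<close>.\<close>
    have "\<exists>n t. t \<in> {-1<..1} \<and> simple_eigenvalue V t (lam n t) \<and> real k \<le> cmod (lam n t) \<and>
        cmod (d_coef Psi Psi_star n t) < 1 / real (Suc k)" for k :: nat
    proof -
      obtain s where s: "real k + 1 < s" "spectral_singularity V lam Psi Psi_star (of_real s)"
        using large by blast
      then obtain n and t :: "nat \<Rightarrow> real" where t: "\<And>i. t i \<in> {-1<..1}" "\<And>i. simple_eigenvalue V (t i) (lam n (t i))"
        and lims: "(\<lambda>i. lam n (t i)) \<longlonglongrightarrow> of_real s" "(\<lambda>i. cmod (d_coef Psi Psi_star n (t i))) \<longlonglongrightarrow> 0"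
        unfolding spectral_singularity_def by blast
      have "\<forall>\<^sub>F i in sequentially. dist (lam n (t i)) (of_real s) < 1 \<and> cmod (d_coef Psi Psi_star n (t i)) < 1 / real (Suc k)"
        by (intro eventually_conj tendstoD[OF lims(1)] order_tendstoD(2)[OF lims(2)]) simp_all
      then obtain i where i: "dist (lam n (t i)) (of_real s) < 1" "cmod (d_coef Psi Psi_star n (t i)) < 1 / real (Suc k)"
        by (auto simp: eventually_sequentially)
      have "s - cmod (lam n (t i)) \<le> dist (lam n (t i)) (of_real s)"
        using norm_triangle_ineq2[of "of_real s" "lam n (t i)"] s(1) by (simp add: dist_norm norm_minus_commute)
      then have "real k \<le> cmod (lam n (t i))" using i(1) s(1) by linarith
      then show ?thesis using t i(2) by blast
    qed
    then obtain n t where nt: "\<And>k :: nat. t k \<in> {-1<..1} \<and> simple_eigenvalue V (t k) (lam (n k) (t k)) \<and>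
        real k \<le> cmod (lam (n k) (t k)) \<and> cmod (d_coef Psi Psi_star (n k) (t k)) < 1 / real (Suc k)"
      by metis
    have "filterlim (\<lambda>k. cmod (lam (n k) (t k))) at_top sequentially"
      by (rule filterlim_at_top_mono[OF filterlim_real_sequentially]) (use nt in auto)
    moreover have "(\<lambda>k. cmod (d_coef Psi Psi_star (n k) (t k))) \<longlonglongrightarrow> 0"
    proof (rule Lim_null_comparison)
      show "\<forall>\<^sub>F k in sequentially. norm (cmod (d_coef Psi Psi_star (n k) (t k))) \<le> 1 / real (Suc k)"
        using nt by (auto intro!: always_eventually simp: less_imp_le)
      show "(\<lambda>k. 1 / real (Suc k)) \<longlonglongrightarrow> 0" by (rule LIMSEQ_Suc[OF lim_const_over_n])
    qed
    ultimately show ?thesis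
      unfolding spectral_singularity_at_infinity_def using nt by blast
  qed
  ultimately show ?thesis by blast
qed

end
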